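(* Let $n\ge 2$, $s\in(0,1)$, and let $p\in\left(1,\frac{n+2}{n-2}\right)$ if $n>2$, $p\in(1,+\infty)$ if $n=2$. Let $u\in H^1(\mathbb{R}^n)$ be a bounded weak solution of $-\Delta u+(-\Delta)^su+u=u^p$ in $\mathbb{R}^n$. Then $u\in C^{1,\alpha}(\mathbb{R}^n)$ for any $\alpha\in(0,1)$ and $$\|u\|_{C^{1,\alpha}(\mathbb{R}^n)}\le c\left(\|u\|_{L^\infty(\mathbb{R}^n)}+\|u\|^p_{L^\infty(\mathbb{R}^n)}\right),$$ for some $c>0$ depending only on $n$, $s$ and $p$. Moreover, $$\lim_{|x|\to+\infty}u(x)=0.$$
   Context: Weak solution: $u\in H^1(\mathbb{R}^n)$ is a weak solution of the equation $-\Delta u+(-\Delta)^su+u=u^p$ in $\mathbb{R}^n$ if for all $v\in H^1(\mathbb{R}^n)$ $$\int_{\mathbb{R}^n}\big(u(x)v(x)+\nabla u(x)\cdot\nabla v(x)\big)\,dx+\iint_{\mathbb{R}^{2n}}\frac{(u(x)-u(y))(v(x)-v(y))}{|x-y|^{n+2s}}\,dx\,dy=\int_{\mathbb{R}^n}|u(x)|^{p-1}u(x)v(x)\,dx.$$ Bounded means $u\in L^\infty(\mathbb{R}^n)$. The space $C^{1,\alpha}(\mathbb{R}^n)$ has its usual norm (sup norms of $u$ and $\nabla u$ plus the $\alpha$-Hölder seminorm of $\nabla u$); membership is understood up to a.e. modification. *)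

theory Defs
  imports "HOL-Analysis.Analysis" "HOL-Probability.Essential_Supremum"
begin

text \<open>
  Elements of Lebesgue and Sobolev spaces are represented by Lebesgue measurable functions
  defined everywhere. Weak gradients, \<open>H1\<close>, weak solutions and \<open>Linfty\<close> are
  invariant under modification on a null set; the Hoelder space consists of actual functions.
\<close>

primrec Ck :: "nat \<Rightarrow> ('a::euclidean_space \<Rightarrow> real) \<Rightarrow> bool" where
  "Ck 0 f \<longleftrightarrow> continuous_on UNIV f"
| "Ck (Suc k) f \<longleftrightarrow> (\<forall>x. f differentiable (at x)) \<and>
     (\<forall>b\<in>Basis. Ck k (\<lambda>x. frechet_derivative f (at x) b))"

definition test_functions :: "('a::euclidean_space \<Rightarrow> real) set" where
  "test_functions = {\<phi>. (\<forall>k. Ck k \<phi>) \<and> compact (closure {x. \<phi> x \<noteq> 0})}"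

definition has_weak_gradient ::
  "('a::euclidean_space \<Rightarrow> real) \<Rightarrow> ('a \<Rightarrow> 'a) \<Rightarrow> bool" where
  "has_weak_gradient u g \<longleftrightarrow>
     (\<forall>K. compact K \<longrightarrow> u absolutely_integrable_on K \<and> g absolutely_integrable_on K) \<and>
     (\<forall>\<phi>\<in>test_functions. \<forall>b\<in>Basis.
        (LINT x|lebesgue. u x * frechet_derivative \<phi> (at x) b)
          = - (LINT x|lebesgue. (g x \<bullet> b) * \<phi> x))"

definition square_integrable :: "('a::euclidean_space \<Rightarrow> 'b::euclidean_space) \<Rightarrow> bool" where
  "square_integrable f \<longleftrightarrow>
     f \<in> borel_measurable lebesgue \<and> integrable lebesgue (\<lambda>x. (norm (f x))\<^sup>2)"

definition H1 :: "('a::euclidean_space \<Rightarrow> real) set" where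
  "H1 = {u. square_integrable u \<and> (\<exists>g. has_weak_gradient u g \<and> square_integrable g)}"

text \<open>
  Weak gradients are unique up to null sets, so quantifying over all of them below is the same as
  fixing one for each of \<open>u\<close> and \<open>v\<close>. On the diagonal \<open>x = y\<close>, a null set, the
  integrand of the double integral is \<open>0 / 0 = 0\<close>. All integrals converge absolutely
  for \<open>u, v \<in> H1\<close> and \<open>p\<close> in the subcritical range.
\<close>

definition weak_solution :: "real \<Rightarrow> real \<Rightarrow> ('a::euclidean_space \<Rightarrow> real) \<Rightarrow> bool" where
  "weak_solution s p u \<longleftrightarrow> u \<in> H1 \<and>
     (\<forall>v\<in>H1. \<forall>Du Dv. has_weak_gradient u Du \<longrightarrow> has_weak_gradient v Dv \<longrightarrow>
        (LINT x|lebesgue. u x * v x + Du x \<bullet> Dv x)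
        + (LINT z|(lebesgue :: ('a \<times> 'a) measure).
             (u (fst z) - u (snd z)) * (v (fst z) - v (snd z))
               / norm (fst z - snd z) powr (real DIM('a) + 2 * s))
        = (LINT x|lebesgue. \<bar>u x\<bar> powr (p - 1) * u x * v x))"

definition Linfty :: "('a::euclidean_space \<Rightarrow> real) set" where
  "Linfty = {u. u \<in> borel_measurable lebesgue \<and> esssup lebesgue (\<lambda>x. ereal \<bar>u x\<bar>) < \<infinity>}"

definition Linfty_norm :: "('a::euclidean_space \<Rightarrow> real) \<Rightarrow> real" where
  "Linfty_norm u = real_of_ereal (esssup lebesgue (\<lambda>x. ereal \<bar>u x\<bar>))"

definition grad :: "('a::euclidean_space \<Rightarrow> real) \<Rightarrow> 'a \<Rightarrow> 'a" where
  "grad w x = (\<Sum>b\<in>Basis. frechet_derivative w (at x) b *\<^sub>R b)"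

definition hoelder_quotients ::
  "real \<Rightarrow> ('a::real_normed_vector \<Rightarrow> 'b::real_normed_vector) \<Rightarrow> real set" where
  "hoelder_quotients \<alpha> f = {norm (f x - f y) / norm (x - y) powr \<alpha> | x y. x \<noteq> y}"

text \<open>Continuity of the gradient follows from Hoelder continuity, as \<open>\<alpha> > 0\<close>.\<close>

definition C1_hoelder :: "real \<Rightarrow> ('a::euclidean_space \<Rightarrow> real) set" where
  "C1_hoelder \<alpha> = {w. (\<forall>x. w differentiable (at x)) \<and>
     bounded (range w) \<and> bounded (range (grad w)) \<and> bdd_above (hoelder_quotients \<alpha> (grad w))}"

definition C1_hoelder_norm :: "real \<Rightarrow> ('a::euclidean_space \<Rightarrow> real) \<Rightarrow> real" where
  "C1_hoelder_norm \<alpha> w =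
     (SUP x. \<bar>w x\<bar>) + (SUP x. norm (grad w x)) + Sup (hoelder_quotients \<alpha> (grad w))"

end

theory Submission
  imports Defs "HOL-Computational_Algebra.Polynomial"
begin

text \<open>
  Mollifying the distributional form of the equation gives smooth bounded functions \<open>w\<close> with
  \<open>- \<Delta> w + A w + w = f\<close>, where \<open>A w (x)\<close> is minus the integral of the second differences
  \<open>w (x + h) + w (x - h) - 2 w (x)\<close> against \<open>|h|\<close> to the power \<open>-n - 2s\<close>. Averages
  \<open>\<Phi>(t) = \<integral> \<rho>(z) w(x - t z) dz\<close> with \<open>z \<rho>(z) = - \<nabla>\<psi>(z)\<close> satisfy
  \<open>\<Phi>'(t) = t \<integral> \<psi>(z) \<Delta>w(x - t z) dz\<close>, and integrating second differences of this identity over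
  \<open>0 < t < T\<close> bounds second differences of \<open>w\<close> by \<open>\<Delta>w\<close>. The operator \<open>A\<close> is of lower order and is
  absorbed: a first pass uses only the sup norm of \<open>f\<close> and makes \<open>w\<close> Lipschitz, so that \<open>f\<close> becomes
  Hoelder continuous; a second pass bounds the second differences by \<open>N |h|\<close> squared. With
  \<open>M\<close> the sup norm of \<open>u\<close> and the scale \<open>T = min 1 (M powr ((1 - p) / 2))\<close>, \<open>N\<close> is a multiple of
  \<open>M + M powr p\<close>. Since the gradient is Lipschitz, the constant does not depend on \<open>\<alpha>\<close>. Decay
  at infinity follows because the solution is Lipschitz and square integrable.
\<close>

section \<open>Smooth functions and test functions\<close>

text \<open>The estimates must not see the mollifier, although smoothness of \<open>w\<close> is
  known only through it. Hence each second difference bound is first assumed with an unknown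
  constant, improved to half of that constant plus known terms, and iterated; the mollification only
  supplies a finite start. The exponents are forced. Second differences of order |h|^(1 + s) make
  the kernel integrable near 0, since 1 + s > 2 s, and are controlled by the sup norm of the
  Laplacian, since 1 + s < 2; at order 2 the same bound diverges logarithmically at small scales
  unless the Laplacian is Hoelder continuous. Its exponent 1 - s is what remains of N |h|^2 after
  |h|^(1 + s) is spent on the kernel. A further obstacle is that mollification does not commute with
  the power: the right-hand side is the mollified nonlinearity of \<open>u\<close>, not the
  nonlinearity of \<open>w\<close>. So the Lipschitz bound is passed to the limit first, and the
  Hoelder bound of the mollified right-hand side is read off from that limit.\<close>

definition smooth :: "('a::euclidean_space \<Rightarrow> real) \<Rightarrow> bool" where
  "smooth f \<longleftrightarrow> (\<forall>k. Ck k f)"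

definition partial :: "'a \<Rightarrow> ('a::euclidean_space \<Rightarrow> real) \<Rightarrow> 'a \<Rightarrow> real" where
  "partial b f x = frechet_derivative f (at x) b"

definition laplacian :: "('a::euclidean_space \<Rightarrow> real) \<Rightarrow> 'a \<Rightarrow> real" where
  "laplacian f x = (\<Sum>b\<in>Basis. partial b (partial b f) x)"

definition diff2 :: "('a::euclidean_space \<Rightarrow> real) \<Rightarrow> 'a \<Rightarrow> 'a \<Rightarrow> real" where
  "diff2 f h x = f (x + h) + f (x - h) - 2 * f x"

section \<open>Closure properties of C^k and smooth functions\<close>

lemma Ck_SucI:
  assumes "\<And>x. (f has_derivative f' x) (at x)" "\<And>b. b \<in> Basis \<Longrightarrow> Ck k (\<lambda>x. f' x b)"
  shows "Ck (Suc k) f"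
proof -
  have "frechet_derivative f (at x) = f' x" for x
    using assms(1) by (metis frechet_derivative_at)
  then show ?thesis
    using assms by (auto simp: differentiable_def)
qed

lemma Ck_Suc_has_derivative:
  "Ck (Suc k) f \<Longrightarrow> (f has_derivative frechet_derivative f (at x)) (at x)"
  using frechet_derivative_works by auto

lemma Ck_SucD: "Ck (Suc k) f \<Longrightarrow> Ck k f"
proof (induction k arbitrary: f)
  case 0
  then show ?case
    by (simp add: continuous_at_imp_continuous_on differentiable_imp_continuous_within)
next
  case (Suc k)
  then show ?case by (metis Ck.simps(2))
qed

lemma Ck_const: "Ck k (\<lambda>x. c)"
proof (induction k arbitrary: c)
  case (Suc k)
  show ?case by (rule Ck_SucI[OF has_derivative_const]) (rule Suc)
qed simp

lemma Ck_add:
  assumes "Ck k f" "Ck k g" shows "Ck k (\<lambda>x. f x + g x)"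
  using assms
proof (induction k arbitrary: f g)
  case (Suc k)
  show ?case
    by (rule Ck_SucI[OF has_derivative_add[OF Ck_Suc_has_derivative Ck_Suc_has_derivative]])
       (use Suc in auto)
qed (auto intro: continuous_intros)

lemma Ck_mult:
  assumes "Ck k f" "Ck k g" shows "Ck k (\<lambda>x. f x * g x)"
  using assms
proof (induction k arbitrary: f g)
  case (Suc k)
  show ?case
    by (rule Ck_SucI[OF has_derivative_mult[OF Ck_Suc_has_derivative Ck_Suc_has_derivative]])
       (use Suc Ck_SucD[OF Suc.prems(1)] Ck_SucD[OF Suc.prems(2)] in \<open>auto intro!: Ck_add\<close>)
qed (auto intro: continuous_intros)

lemma Ck_sum:
  assumes "\<And>i. i \<in> I \<Longrightarrow> Ck k (f i)" shows "Ck k (\<lambda>x. \<Sum>i\<in>I. f i x)"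
  using assms by (induction I rule: infinite_finite_induct) (auto intro: Ck_const Ck_add)

lemma Ck_linear:
  assumes "bounded_linear L" shows "Ck k L"
proof (cases k)
  case 0
  then show ?thesis using assms by (simp add: linear_continuous_on)
next
  case (Suc j)
  have "Ck (Suc j) L"
    by (rule Ck_SucI[where f'="\<lambda>_. L"])
       (use assms in \<open>auto intro: Ck_const bounded_linear_imp_has_derivative\<close>)
  then show ?thesis using Suc by simp
qed

lemma Ck_affine:
  assumes "Ck k f" shows "Ck k (\<lambda>y. f (a + c *\<^sub>R y))"
  using assms
proof (induction k arbitrary: f)
  case 0
  then show ?case by (auto intro!: continuous_on_compose2[of UNIV f] continuous_intros)
next
  case (Suc k)
  have d: "((\<lambda>y. f (a + c *\<^sub>R y)) has_derivative
      (\<lambda>h. frechet_derivative f (at (a + c *\<^sub>R y)) (c *\<^sub>R h))) (at y)" for y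
    by (rule has_derivative_compose[of "\<lambda>y. a + c *\<^sub>R y", OF _ Ck_Suc_has_derivative[OF Suc.prems]])
       (auto intro!: derivative_eq_intros)
  have l: "frechet_derivative f (at x) (c *\<^sub>R h) = c * frechet_derivative f (at x) h" for x h
    using Ck_Suc_has_derivative[OF Suc.prems] has_derivative_linear linear_scale
    by (metis real_scaleR_def)
  show ?case
    by (rule Ck_SucI[OF d]) (use Suc in \<open>auto simp: l intro: Ck_mult Ck_const\<close>)
qed

text \<open>Differentiating \<open>B j\<close> composed with \<open>q\<close> produces
  \<open>B (Suc j)\<close> composed with \<open>q\<close>. Generalising over \<open>j\<close>
  therefore lets the induction on \<open>k\<close> close without a general chain rule for C^k
  functions.\<close>

lemma Ck_compose_family:
  fixes B :: "nat \<Rightarrow> real \<Rightarrow> real"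
  assumes "\<And>j t. (B j has_real_derivative B (Suc j) t) (at t)" "\<And>k. Ck k q"
  shows "Ck k (\<lambda>x. B j (q x))"
proof (induction k arbitrary: j)
  case 0
  have "continuous_on UNIV (B j)"
    using assms(1) DERIV_isCont continuous_at_imp_continuous_on by blast
  moreover have "continuous_on UNIV q" using assms(2)[of 0] by simp
  ultimately show ?case by (auto intro: continuous_on_compose2)
next
  case (Suc k)
  have d: "((\<lambda>x. B j (q x)) has_derivative
      (\<lambda>h. B (Suc j) (q x) * frechet_derivative q (at x) h)) (at x)" for x
    using has_derivative_compose[OF Ck_Suc_has_derivative[OF assms(2)]
        assms(1)[of j "q x", unfolded has_field_derivative_def]] .
  show ?case
    by (rule Ck_SucI[OF d]) (use assms(2)[of "Suc k"] Suc in \<open>auto intro: Ck_mult\<close>)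
qed

lemma smooth_const: "smooth (\<lambda>x. c)" by (simp add: smooth_def Ck_const)
lemma smooth_add: "smooth f \<Longrightarrow> smooth g \<Longrightarrow> smooth (\<lambda>x. f x + g x)"
  by (simp add: smooth_def Ck_add)
lemma smooth_mult: "smooth f \<Longrightarrow> smooth g \<Longrightarrow> smooth (\<lambda>x. f x * g x)"
  by (simp add: smooth_def Ck_mult)
lemma smooth_affine: "smooth f \<Longrightarrow> smooth (\<lambda>y. f (a + c *\<^sub>R y))"
  by (simp add: smooth_def Ck_affine)

lemma smooth_quadratic: "smooth (\<lambda>x::'a::euclidean_space. a - c * (x \<bullet> x))"
proof -
  have "Ck k (\<lambda>x::'a. (- 2 * c) * (x \<bullet> b))" for k b
    by (intro Ck_mult Ck_const Ck_linear bounded_linear_inner_left)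
  then have "Ck (Suc k) (\<lambda>x::'a. a - c * (x \<bullet> x))" for k
    by (intro Ck_SucI[where f'="\<lambda>x h. (- 2 * c) * (x \<bullet> h)"])
       (auto intro!: derivative_eq_intros simp: inner_commute)
  then show ?thesis unfolding smooth_def using Ck_SucD by blast
qed

lemma smooth_partial: "smooth f \<Longrightarrow> b \<in> Basis \<Longrightarrow> smooth (partial b f)"
  unfolding smooth_def partial_def by (metis Ck.simps(2))

lemma smooth_has_derivative:
  fixes f :: "'a::euclidean_space \<Rightarrow> real"
  assumes "smooth f"
  shows "(f has_derivative (\<lambda>h. \<Sum>b\<in>Basis. (h \<bullet> b) * partial b f x)) (at x)"
proof -
  have d: "(f has_derivative frechet_derivative f (at x)) (at x)"
    using assms Ck_Suc_has_derivative unfolding smooth_def by blast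
  then have l: "linear (frechet_derivative f (at x))" using has_derivative_linear by blast
  have "frechet_derivative f (at x) h = (\<Sum>b\<in>Basis. (h \<bullet> b) * partial b f x)" for h
  proof -
    have "frechet_derivative f (at x) h = frechet_derivative f (at x) (\<Sum>b\<in>Basis. (h \<bullet> b) *\<^sub>R b)"
      by (simp add: euclidean_representation)
    also have "\<dots> = (\<Sum>b\<in>Basis. (h \<bullet> b) * partial b f x)"
      by (simp add: linear_sum[OF l] linear_scale[OF l] partial_def)
    finally show ?thesis .
  qed
  then have "frechet_derivative f (at x) = (\<lambda>h. \<Sum>b\<in>Basis. (h \<bullet> b) * partial b f x)" by auto
  with d show ?thesis by simp
qed

lemma partial_eqI: "(f has_derivative f') (at x) \<Longrightarrow> partial b f x = f' b"
  unfolding partial_def using frechet_derivative_at by metis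

lemma smooth_continuous: "smooth f \<Longrightarrow> continuous_on UNIV f"
  unfolding smooth_def by (metis Ck.simps(1))

lemma partial_affine:
  assumes "smooth f"
  shows "partial b (\<lambda>y. f (a + c *\<^sub>R y)) y = c * partial b f (a + c *\<^sub>R y)"
proof -
  have d: "(f has_derivative frechet_derivative f (at x)) (at x)" for x
    using assms Ck_Suc_has_derivative unfolding smooth_def by blast
  have "((\<lambda>y. f (a + c *\<^sub>R y)) has_derivative
      (\<lambda>h. frechet_derivative f (at (a + c *\<^sub>R y)) (c *\<^sub>R h))) (at y)"
    by (rule has_derivative_compose[of "\<lambda>y. a + c *\<^sub>R y", OF _ d])
       (auto intro!: derivative_eq_intros)
  then have "partial b (\<lambda>y. f (a + c *\<^sub>R y)) y = frechet_derivative f (at (a + c *\<^sub>R y)) (c *\<^sub>R b)"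
    by (rule partial_eqI)
  then show ?thesis
    using has_derivative_linear[OF d[of "a + c *\<^sub>R y"]] by (simp add: linear_scale partial_def)
qed

section \<open>Test functions and their stability under the operations used later\<close>

lemma test_functionsI:
  assumes "smooth \<phi>" "\<And>x. norm x > R \<Longrightarrow> \<phi> x = 0"
  shows "\<phi> \<in> test_functions"
proof -
  have "{x. \<phi> x \<noteq> 0} \<subseteq> cball 0 R" using assms(2) by (force simp: not_less[symmetric])
  then have "bounded {x. \<phi> x \<noteq> 0}" using bounded_cball bounded_subset by blast
  then show ?thesis using assms(1) unfolding test_functions_def smooth_def by auto
qed

lemma test_smooth: "\<phi> \<in> test_functions \<Longrightarrow> smooth \<phi>"
  unfolding test_functions_def smooth_def by auto

lemma test_support:
  assumes "\<phi> \<in> test_functions" obtains R where "R > 0" "\<And>x. norm x > R \<Longrightarrow> \<phi> x = 0"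
proof -
  have "bounded {x. \<phi> x \<noteq> 0}"
    using assms unfolding test_functions_def
    by (auto intro: bounded_subset[OF compact_imp_bounded closure_subset])
  then obtain R where "R > 0" "\<And>x. \<phi> x \<noteq> 0 \<Longrightarrow> norm x \<le> R"
    unfolding bounded_pos by auto
  then show thesis using that by force
qed

lemma partial_eq_0_outside:
  assumes "\<And>x. norm x > R \<Longrightarrow> \<phi> x = 0" "norm x > R"
  shows "partial b \<phi> x = 0"
proof -
  have o: "open {y::'a. norm y > R}" by (intro open_Collect_less continuous_intros)
  have "((\<lambda>_. 0) has_derivative (\<lambda>_. 0)) (at x)" by simp
  then have "(\<phi> has_derivative (\<lambda>_. 0)) (at x)"
    by (rule has_derivative_transform_within_open[OF _ o]) (use assms in auto)
  then show ?thesis by (rule partial_eqI)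
qed

lemma test_partial:
  assumes "\<phi> \<in> test_functions" "b \<in> Basis" shows "partial b \<phi> \<in> test_functions"
proof -
  obtain R where "\<And>x. norm x > R \<Longrightarrow> \<phi> x = 0" using test_support assms by metis
  then show ?thesis
    using test_functionsI[of "partial b \<phi>" R] smooth_partial test_smooth assms
      partial_eq_0_outside by metis
qed

lemma test_affine:
  assumes "\<phi> \<in> test_functions" "c \<noteq> 0" shows "(\<lambda>y. \<phi> (a + c *\<^sub>R y)) \<in> test_functions"
proof -
  obtain R where R: "\<And>x. norm x > R \<Longrightarrow> \<phi> x = 0" using test_support assms by metis
  show ?thesis
  proof (rule test_functionsI[of _ "(R + norm a) / \<bar>c\<bar>"])
    fix y :: 'a assume "norm y > (R + norm a) / \<bar>c\<bar>"
    then have "norm (c *\<^sub>R y) > R + norm a" using assms(2) by (simp add: field_simps)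
    moreover have "norm (c *\<^sub>R y) \<le> norm (a + c *\<^sub>R y) + norm a"
      by (metis add_diff_cancel_left' norm_triangle_ineq4 add.commute)
    ultimately show "\<phi> (a + c *\<^sub>R y) = 0" by (intro R) linarith
  qed (intro smooth_affine test_smooth assms)
qed

lemma test_mult:
  assumes "\<phi> \<in> test_functions" "smooth f" shows "(\<lambda>x. \<phi> x * f x) \<in> test_functions"
proof -
  obtain R where "\<And>x. norm x > R \<Longrightarrow> \<phi> x = 0" using test_support assms by metis
  then show ?thesis
    using test_functionsI[of "\<lambda>x. \<phi> x * f x" R] smooth_mult[OF test_smooth] assms by auto
qed

lemma test_bounded:
  fixes \<phi> :: "'a::euclidean_space \<Rightarrow> real"
  assumes "\<phi> \<in> test_functions" obtains C where "C > 0" "\<And>x. \<bar>\<phi> x\<bar> \<le> C"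
proof -
  obtain R where R: "R > 0" "\<And>x. norm x > R \<Longrightarrow> \<phi> x = 0" using test_support assms by metis
  have "compact (\<phi> ` cball 0 R)"
    by (intro compact_continuous_image continuous_on_subset[OF smooth_continuous] test_smooth assms) auto
  then obtain C where C: "C > 0" "\<And>x. x \<in> cball 0 R \<Longrightarrow> \<bar>\<phi> x\<bar> \<le> C"
    using compact_imp_bounded bounded_pos by (metis (no_types, lifting) image_eqI real_norm_def)
  have "\<bar>\<phi> x\<bar> \<le> C" for x
    using C(1) C(2)[of x] R(2)[of x] by (cases "norm x > R") (auto simp: not_less)
  then show thesis using that C(1) by blast
qed

section \<open>Flat functions and radial bumps\<close>

definition flat :: "real poly \<Rightarrow> real \<Rightarrow> real" where
  "flat P t = (if t > 0 then poly P (1 / t) * exp (- (1 / t)) else 0)"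

text \<open>With r = 1/t the chain rule turns P(r) exp(-r) into r^2 (P(r) - P'(r)) exp(-r). So
  functions of the form \<open>flat P\<close> are closed under differentiation, and this is the map
  induced on \<open>P\<close>.\<close>

definition flat_step :: "real poly \<Rightarrow> real poly" where
  "flat_step P = [:0, 0, 1:] * (P - pderiv P)"

lemma poly_exp_tendsto_0: "((\<lambda>s::real. poly P s * exp (- s)) \<longlongrightarrow> 0) at_top"
proof -
  have "((\<lambda>s. \<Sum>i\<le>degree P. coeff P i * (s ^ i / exp s)) \<longlongrightarrow> (\<Sum>i\<le>degree P. coeff P i * 0)) at_top"
    by (intro tendsto_intros tendsto_power_div_exp_0)
  then show ?thesis
    by (simp add: poly_altdef sum_distrib_right exp_minus divide_inverse mult.assoc)
qed

lemma flat_deriv: "(flat P has_real_derivative flat (flat_step P) t) (at t)"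
proof -
  consider "t > 0" | "t < 0" | "t = 0" by linarith
  then show ?thesis
  proof cases
    case 1
    have "((\<lambda>t. poly P (1 / t) * exp (- (1 / t))) has_real_derivative flat (flat_step P) t) (at t)"
      using 1 by (auto intro!: derivative_eq_intros DERIV_chain2[OF poly_DERIV]
          simp: flat_def flat_step_def field_simps power2_eq_square)
    then show ?thesis
      by (rule has_field_derivative_transform_within_open[where S="{0<..}"])
         (use 1 in \<open>auto simp: flat_def\<close>)
  next
    case 2
    have "((\<lambda>t. 0) has_real_derivative flat (flat_step P) t) (at t)"
      using 2 by (auto simp: flat_def)
    then show ?thesis
      by (rule has_field_derivative_transform_within_open[where S="{..<0}"])
         (use 2 in \<open>auto simp: flat_def\<close>)
  next
    case 3
    \<comment> \<open>The difference quotient at 0 from the right is r P(r) exp(-r) with r = 1/t,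
      and \<open>pCons 0 P\<close> is the polynomial r P(r).\<close>
    have "((\<lambda>t::real. poly (pCons 0 P) (1 / t) * exp (- (1 / t))) \<longlongrightarrow> 0) (at_right 0)"
      by (rule filterlim_compose[OF poly_exp_tendsto_0])
         (simp add: divide_inverse filterlim_inverse_at_top_right)
    then have r: "((\<lambda>t. flat P t / t) \<longlongrightarrow> 0) (at_right 0)"
      by (rule Lim_transform_eventually)
         (auto simp: eventually_at_filter flat_def field_simps)
    have l: "((\<lambda>t. flat P t / t) \<longlongrightarrow> 0) (at_left 0)"
      by (rule Lim_transform_eventually[OF tendsto_const])
         (auto simp: eventually_at_filter flat_def)
    have "((\<lambda>t. flat P t / t) \<longlongrightarrow> 0) (at 0)"
      using l r by (rule filterlim_split_at)
    then show ?thesis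
      unfolding 3 has_field_derivative_iff by (simp add: flat_def)
  qed
qed

text \<open>The successive derivatives of exp(-1/t) extended by 0. Only \<open>flats 0\<close> and
  \<open>flats 1\<close>, which is exp(-1/t) / t^2, are known to be positive on the right half line,
  and only these two serve as profiles of kernels.\<close>

definition flats :: "nat \<Rightarrow> real \<Rightarrow> real" where
  "flats j = flat ((flat_step ^^ j) 1)"

lemma flats_deriv: "(flats j has_real_derivative flats (Suc j) t) (at t)"
  unfolding flats_def using flat_deriv by simp

lemma flats_nonpos: "t \<le> 0 \<Longrightarrow> flats j t = 0"
  by (simp add: flats_def flat_def)

lemma flats_0_pos: "t > 0 \<Longrightarrow> flats 0 t > 0"
  by (simp add: flats_def flat_def)

lemma flats_1_pos: "t > 0 \<Longrightarrow> flats 1 t > 0"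
  by (simp add: flats_def flat_def flat_step_def pderiv_1)

text \<open>A radial function supported in the ball of radius \<open>e\<close>. The index is kept
  because the gradient of \<open>bump j e\<close> is a scalar multiple of x times
  \<open>bump (Suc j) e\<close>, which is the relation required of the averaging kernels.\<close>

definition bump :: "nat \<Rightarrow> real \<Rightarrow> 'a::euclidean_space \<Rightarrow> real" where
  "bump j e x = flats j (1 - (1 / e\<^sup>2) * (x \<bullet> x))"

lemma bump_outside:
  assumes "e > 0" "norm x \<ge> e" shows "bump j e x = 0"
proof -
  have "e\<^sup>2 \<le> x \<bullet> x"
    using assms power_mono[of e "norm x" 2] by (simp add: power2_norm_eq_inner)
  then show ?thesis unfolding bump_def using assms(1) by (intro flats_nonpos) simp
qed

lemma bump_inside:
  assumes "e > 0" "norm x < e" shows "1 - (1 / e\<^sup>2) * (x \<bullet> x) > 0"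
proof -
  have "x \<bullet> x < e\<^sup>2"
    using assms power_strict_mono[of "norm x" e 2] by (simp add: power2_norm_eq_inner)
  then show ?thesis using assms(1) by simp
qed

lemma bump_smooth: "smooth (bump j e)"
proof -
  have q: "Ck k (\<lambda>x::'a. 1 - (1 / e\<^sup>2) * (x \<bullet> x))" for k
    using smooth_quadratic unfolding smooth_def by blast
  have "Ck k (\<lambda>x::'a. flats j (1 - (1 / e\<^sup>2) * (x \<bullet> x)))" for k
    by (rule Ck_compose_family[of flats, OF flats_deriv q])
  then show ?thesis unfolding smooth_def bump_def by blast
qed

lemma bump_test: "e > 0 \<Longrightarrow> bump j e \<in> test_functions"
  by (rule test_functionsI[of _ e, OF bump_smooth]) (simp add: bump_outside)

section \<open>Convolution with test functions\<close>

lemma integral_lborel_affine: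
  fixes f :: "'a::euclidean_space \<Rightarrow> real"
  assumes [measurable]: "f \<in> borel_measurable borel" and c: "\<bar>c\<bar> = 1"
  shows "(LINT y|lborel. f (a + c *\<^sub>R y)) = (LINT y|lborel. f y)"
proof -
  have "(LINT y|lborel. f y) = (LINT y|density (distr lborel borel (\<lambda>y::'a. a + c *\<^sub>R y)) (\<lambda>_. \<bar>c\<bar> ^ DIM('a)). f y)"
    using c lborel_affine[of c a] by auto
  then show ?thesis using c by (simp add: integral_distr density_1)
qed

lemma nn_integral_lborel_affine:
  fixes f :: "'a::euclidean_space \<Rightarrow> ennreal"
  assumes [measurable]: "f \<in> borel_measurable borel" and c: "\<bar>c\<bar> = 1"
  shows "(\<integral>\<^sup>+y. f (a + c *\<^sub>R y) \<partial>lborel) = (\<integral>\<^sup>+y. f y \<partial>lborel)"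
proof -
  have "(\<integral>\<^sup>+y. f y \<partial>lborel) = (\<integral>\<^sup>+y. f y \<partial>density (distr lborel borel (\<lambda>y::'a. a + c *\<^sub>R y)) (\<lambda>_. \<bar>c\<bar> ^ DIM('a)))"
    using c lborel_affine[of c a] by auto
  then show ?thesis using c by (simp add: nn_integral_distr density_1)
qed

lemmas integral_shift = integral_lborel_affine[of _ 1, simplified]
lemmas integral_reflect = integral_lborel_affine[of _ "-1", simplified]
lemmas nn_integral_shift = nn_integral_lborel_affine[of _ 1, simplified]

lemma integrable_bounded_support:
  fixes f :: "'a::euclidean_space \<Rightarrow> real"
  assumes "f \<in> borel_measurable borel" "\<And>x. \<bar>f x\<bar> \<le> C" "\<And>x. norm (x - a) > R \<Longrightarrow> f x = 0"
  shows "integrable lborel f"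
proof (rule Bochner_Integration.integrable_bound)
  show "integrable lborel (\<lambda>x. C * indicator (cball a R) x)"
    by (intro integrable_mult_right integrable_real_indicator emeasure_lborel_cball_finite) auto
  show "AE x in lborel. norm (f x) \<le> norm (C * indicator (cball a R) x)"
  proof (intro AE_I2)
    fix x
    show "norm (f x) \<le> norm (C * indicator (cball a R) x)"
      using assms(2)[of x] assms(3)[of x]
      by (cases "norm (x - a) > R") (auto simp: indicator_def dist_norm norm_minus_commute)
  qed
qed (use assms in simp)

lemma integral_bounded_support:
  fixes f :: "'a::euclidean_space \<Rightarrow> real"
  assumes "\<And>x. \<bar>f x\<bar> \<le> C" "\<And>x. norm (x - a) > R \<Longrightarrow> f x = 0"
  shows "\<bar>LINT x|lborel. f x\<bar> \<le> C * measure lborel (cball 0 R :: 'a set)"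
proof -
  have C: "C \<ge> 0" using assms(1)[of a] by simp
  have i: "integrable lborel (\<lambda>x. C * indicator (cball a R) x)"
    by (intro integrable_mult_right integrable_real_indicator emeasure_lborel_cball_finite) auto
  have b: "\<bar>f x\<bar> \<le> C * indicator (cball a R) x" for x
    using assms(1)[of x] assms(2)[of x]
    by (cases "norm (x - a) > R") (auto simp: indicator_def dist_norm norm_minus_commute)
  have "\<bar>LINT x|lborel. f x\<bar> \<le> (LINT x|lborel. C * indicator (cball a R) x)"
  proof (cases "integrable lborel f")
    case True
    then show ?thesis
      using integral_mono[OF integrable_abs[OF True] i b] integral_abs_bound[of lborel f] by linarith
  next
    case False
    \<comment> \<open>A function that is not integrable has integral 0 by convention, so here it is
      enough that the right-hand side is nonnegative.\<close>
    have "0 \<le> (LINT x|lborel. C * indicator (cball a R) x)"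
      using C by (intro Bochner_Integration.integral_nonneg) auto
    with False show ?thesis by (simp add: not_integrable_integral_eq)
  qed
  also have "\<dots> = C * measure lborel (cball a R)" by simp
  also have "measure lborel (cball a R) = measure lborel (cball 0 R :: 'a set)"
  proof (cases "R \<ge> 0")
    case True then show ?thesis by (simp add: content_cball)
  qed simp
  finally show ?thesis .
qed

lemma test_borel: "\<phi> \<in> test_functions \<Longrightarrow> \<phi> \<in> borel_measurable borel"
  by (intro borel_measurable_continuous_onI smooth_continuous test_smooth)

lemma smooth_borel: "smooth \<phi> \<Longrightarrow> \<phi> \<in> borel_measurable borel"
  by (intro borel_measurable_continuous_onI smooth_continuous)

lemma integrable_mult_test:
  fixes u :: "'a::euclidean_space \<Rightarrow> real"
  assumes [measurable]: "u \<in> borel_measurable borel" and "\<And>x. \<bar>u x\<bar> \<le> M" and "\<phi> \<in> test_functions"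
  shows "integrable lborel (\<lambda>y. u y * \<phi> y)"
proof -
  obtain R where R: "\<And>x. norm x > R \<Longrightarrow> \<phi> x = 0" using test_support assms by metis
  obtain C where C: "\<And>x. \<bar>\<phi> x\<bar> \<le> C" using test_bounded assms by metis
  have [measurable]: "\<phi> \<in> borel_measurable borel" by (intro test_borel assms)
  have "M \<ge> 0" "C \<ge> 0" using assms(2)[of 0] C[of 0] by auto
  then have "\<bar>u y * \<phi> y\<bar> \<le> M * C" for y
    using assms(2) C by (simp add: abs_mult mult_mono)
  moreover have "(\<lambda>y. u y * \<phi> y) \<in> borel_measurable borel" by simp
  ultimately show ?thesis
    using R by (intro integrable_bounded_support[where C="M * C" and a=0 and R=R]) auto
qed

lemma test_integrable:
  fixes \<phi> :: "'a::euclidean_space \<Rightarrow> real"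
  assumes "\<phi> \<in> test_functions" shows "integrable lborel \<phi>"
  using integrable_mult_test[of "\<lambda>_. 1" 1 \<phi>] assms by simp

section \<open>First and second differences bounded by partial derivatives\<close>

lemma onorm_partials:
  fixes C :: real
  assumes "\<And>b. b \<in> Basis \<Longrightarrow> \<bar>c b\<bar> \<le> C"
  shows "onorm (\<lambda>h::'a::euclidean_space. \<Sum>b\<in>Basis. (h \<bullet> b) * c b) \<le> DIM('a) * C"
proof (rule onorm_le)
  fix h :: 'a
  have "norm (\<Sum>b\<in>Basis. (h \<bullet> b) * c b) \<le> (\<Sum>b\<in>(Basis :: 'a set). norm h * C)"
    by (intro sum_norm_le) (auto simp: abs_mult intro!: mult_mono assms Basis_le_norm)
  then show "norm (\<Sum>b\<in>Basis. (h \<bullet> b) * c b) \<le> DIM('a) * C * norm h"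
    by (simp add: mult_ac)
qed

lemma lipschitz_of_partials:
  fixes w :: "'a::euclidean_space \<Rightarrow> real" and C :: real
  assumes "smooth w" "\<And>b x. b \<in> Basis \<Longrightarrow> \<bar>partial b w x\<bar> \<le> C"
  shows "\<bar>w (x + h) - w x\<bar> \<le> DIM('a) * C * norm h"
  using differentiable_bound[OF convex_UNIV smooth_has_derivative[OF assms(1)]
      onorm_partials[of "\<lambda>b. partial b w _"], OF assms(2), of "x + h" x] by simp

lemma partial_diff:
  assumes "smooth f" "smooth g"
  shows "partial b (\<lambda>x. f x - g x) x = partial b f x - partial b g x"
proof -
  have "(f has_derivative frechet_derivative f (at x)) (at x)"
    "(g has_derivative frechet_derivative g (at x)) (at x)"
    using assms Ck_Suc_has_derivative unfolding smooth_def by blast+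
  then have "((\<lambda>x. f x - g x) has_derivative
      (\<lambda>h. frechet_derivative f (at x) h - frechet_derivative g (at x) h)) (at x)"
    by (rule has_derivative_diff)
  from partial_eqI[OF this] show ?thesis by (simp add: partial_def)
qed

lemma smooth_diff: "smooth f \<Longrightarrow> smooth g \<Longrightarrow> smooth (\<lambda>x. f x - g x)"
  using smooth_add[of f "\<lambda>x. (-1) * g x"] smooth_mult[OF smooth_const[of "-1"], of g] by simp

lemma smooth_shift: "smooth f \<Longrightarrow> smooth (\<lambda>x. f (x + h))"
  using smooth_affine[of f h 1] by (simp add: add.commute)

lemma partial_shift: "smooth f \<Longrightarrow> partial b (\<lambda>x. f (x + h)) x = partial b f (x + h)"
  using partial_affine[of f b h 1] by (simp add: add.commute)

lemma partial_reflect: "smooth f \<Longrightarrow> partial b (\<lambda>y. f (a - y)) y = - partial b f (a - y)"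
  using partial_affine[of f b a "-1"] by simp

lemma test_reflect: "f \<in> test_functions \<Longrightarrow> (\<lambda>y. f (a - y)) \<in> test_functions"
  using test_affine[of f "-1" a] by simp

lemma test_shift: "f \<in> test_functions \<Longrightarrow> (\<lambda>y. f (y + a)) \<in> test_functions"
  using test_affine[of f 1 a] by (simp add: add.commute)

text \<open>The second difference is the increment from \<open>x - h\<close> to \<open>x\<close> of
  the first difference \<open>v\<close>, and the partial derivatives of \<open>v\<close> are
  themselves increments of those of \<open>w\<close>. The Lipschitz bound is used twice, which
  accounts for the square of the dimension.\<close>

lemma diff2_of_partials:
  fixes w :: "'a::euclidean_space \<Rightarrow> real" and C :: real
  assumes "smooth w" "\<And>b c x. b \<in> Basis \<Longrightarrow> c \<in> Basis \<Longrightarrow> \<bar>partial c (partial b w) x\<bar> \<le> C"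
  shows "\<bar>diff2 w h x\<bar> \<le> DIM('a)\<^sup>2 * C * (norm h)\<^sup>2"
proof -
  define v where "v y = w (y + h) - w y" for y
  have p: "\<bar>partial b v y\<bar> \<le> DIM('a) * C * norm h" if "b \<in> Basis" for b y
    unfolding v_def using lipschitz_of_partials[OF smooth_partial[OF assms(1) that] assms(2)[OF that]] assms(1)
    by (simp add: partial_diff smooth_shift partial_shift)
  have "smooth v" unfolding v_def by (intro smooth_diff smooth_shift assms)
  from lipschitz_of_partials[OF this p, of "x - h" h] show ?thesis
    by (simp add: v_def diff2_def power2_eq_square algebra_simps)
qed

lemma taylor_of_partials:
  fixes w :: "'a::euclidean_space \<Rightarrow> real" and C :: real
  assumes "smooth w" "\<And>b c x. b \<in> Basis \<Longrightarrow> c \<in> Basis \<Longrightarrow> \<bar>partial c (partial b w) x\<bar> \<le> C"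
  shows "\<bar>w (x + h) - w x - (\<Sum>b\<in>Basis. (h \<bullet> b) * partial b w x)\<bar> \<le> DIM('a)\<^sup>2 * C * (norm h)\<^sup>2"
proof -
  let ?d = "\<lambda>y h. \<Sum>b\<in>Basis. (h \<bullet> b) * partial b w y"
  have C: "C \<ge> 0" using assms(2)[of "SOME b. b \<in> Basis" "SOME b. b \<in> Basis" 0] SOME_Basis
    by fastforce
  have o: "onorm (\<lambda>h. ?d y h - ?d x h) \<le> DIM('a) * (DIM('a) * C * norm h)" if "y \<in> cball x (norm h)" for y
  proof -
    have "\<bar>partial b w y - partial b w x\<bar> \<le> DIM('a) * C * norm h" if "b \<in> Basis" for b
    proof -
      have "\<bar>partial b w y - partial b w x\<bar> \<le> DIM('a) * C * norm (y - x)"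
        using lipschitz_of_partials[OF smooth_partial[OF assms(1) that] assms(2)[OF that], of x "y - x"] by simp
      also have "\<dots> \<le> DIM('a) * C * norm h"
        using \<open>y \<in> cball x (norm h)\<close> C by (intro mult_left_mono) (auto simp: dist_norm norm_minus_commute)
      finally show ?thesis .
    qed
    from onorm_partials[of "\<lambda>b. partial b w y - partial b w x", OF this]
    show ?thesis by (simp add: right_diff_distrib sum_subtractf)
  qed
  have "norm (w (x + h) - w x - ?d x (x + h - x)) \<le> norm (x + h - x) * (DIM('a) * (DIM('a) * C * norm h))"
  proof (rule differentiable_bound_linearization[where S="cball x (norm h)" and f'="?d"])
    show "x + t *\<^sub>R (x + h - x) \<in> cball x (norm h)" if "t \<in> {0..1}" for t
      using that by (auto simp: dist_norm mult_left_le_one_le)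
    show "(w has_derivative ?d y) (at y within cball x (norm h))" for y
      by (rule has_derivative_at_withinI[OF smooth_has_derivative[OF assms(1)]])
    show "onorm (?d y - ?d x) \<le> DIM('a) * (DIM('a) * C * norm h)" if "y \<in> cball x (norm h)" for y
      using o[OF that] by (simp add: fun_diff_def)
  qed auto
  then show ?thesis by (simp add: power2_eq_square mult_ac)
qed

lemma test_partials2_bounded:
  fixes \<phi> :: "'a::euclidean_space \<Rightarrow> real"
  assumes "\<phi> \<in> test_functions"
  obtains C where "C > 0" "\<And>b x. b \<in> Basis \<Longrightarrow> \<bar>partial b \<phi> x\<bar> \<le> C"
    "\<And>b c x. b \<in> Basis \<Longrightarrow> c \<in> Basis \<Longrightarrow> \<bar>partial c (partial b \<phi>) x\<bar> \<le> C"
proof -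
  have "\<exists>C. \<forall>x. \<bar>f x\<bar> \<le> C" if "f \<in> test_functions" for f :: "'a \<Rightarrow> real"
    using test_bounded[OF that] by metis
  then obtain K where K: "\<And>f x. f \<in> test_functions \<Longrightarrow> \<bar>f x :: real\<bar> \<le> K (f :: 'a \<Rightarrow> real)"
    by metis
  define S where "S = (\<lambda>b. partial b \<phi>) ` Basis \<union> (\<lambda>(b,c). partial c (partial b \<phi>)) ` (Basis \<times> Basis)"
  have f: "finite S" by (simp add: S_def)
  have t: "f \<in> test_functions" if "f \<in> S" for f
    using that assms test_partial by (auto simp: S_def)
  have K0: "K f \<ge> 0" if "f \<in> S" for f using K[OF t[OF that], of 0] by linarith
  \<comment> \<open>The sum over a finite set stands in for a maximum; the summand 1 makes it
    positive.\<close>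
  define C where "C = sum K S + 1"
  have *: "\<bar>f x\<bar> \<le> C" if "f \<in> S" for f x
    using member_le_sum[of f S K] K0 that f K[OF t[OF that], of x] by (auto simp: C_def)
  show thesis
  proof (rule that)
    have "sum K S \<ge> 0" by (rule sum_nonneg[OF K0])
    then show "C > 0" unfolding C_def by linarith
    show "\<bar>partial b \<phi> x\<bar> \<le> C" if "b \<in> Basis" for b x
      by (rule *) (use that in \<open>auto simp: S_def\<close>)
    show "\<bar>partial c (partial b \<phi>) x\<bar> \<le> C" if "b \<in> Basis" "c \<in> Basis" for b c x
      by (rule *) (use that in \<open>auto simp: S_def\<close>)
  qed
qed

lemma test_difference_bounds:
  fixes \<phi> :: "'a::euclidean_space \<Rightarrow> real"
  assumes "\<phi> \<in> test_functions"
  obtains C where "C > 0" "\<And>x. \<bar>\<phi> x\<bar> \<le> C" "\<And>x h. \<bar>\<phi> (x + h) - \<phi> x\<bar> \<le> C * norm h"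
    "\<And>x h. \<bar>diff2 \<phi> h x\<bar> \<le> C * (norm h)\<^sup>2"
    "\<And>x h. \<bar>\<phi> (x + h) - \<phi> x - (\<Sum>b\<in>Basis. (h \<bullet> b) * partial b \<phi> x)\<bar> \<le> C * (norm h)\<^sup>2"
proof -
  note s = test_smooth[OF assms]
  obtain C where C: "C > 0" "\<And>b x. b \<in> Basis \<Longrightarrow> \<bar>partial b \<phi> x\<bar> \<le> C"
    "\<And>b c x. b \<in> Basis \<Longrightarrow> c \<in> Basis \<Longrightarrow> \<bar>partial c (partial b \<phi>) x\<bar> \<le> C"
    using test_partials2_bounded[OF assms] by metis
  obtain D where D: "D > 0" "\<And>x. \<bar>\<phi> x\<bar> \<le> D" using test_bounded[OF assms] by metis
  define E where "E = D + DIM('a) * C + DIM('a)\<^sup>2 * C"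
  have E: "D \<le> E" "DIM('a) * C \<le> E" "DIM('a)\<^sup>2 * C \<le> E" using C(1) D(1) by (auto simp: E_def)
  show thesis
  proof (rule that)
    show "E > 0" "\<And>x. \<bar>\<phi> x\<bar> \<le> E" using D E by (auto intro: order_trans)
    show "\<bar>\<phi> (x + h) - \<phi> x\<bar> \<le> E * norm h" for x h
      using lipschitz_of_partials[OF s C(2)] E by (meson mult_right_mono norm_ge_zero order_trans)
    show "\<bar>diff2 \<phi> h x\<bar> \<le> E * (norm h)\<^sup>2" for x h
      using diff2_of_partials[OF s C(3)] E by (meson mult_right_mono zero_le_power2 order_trans)
    show "\<bar>\<phi> (x + h) - \<phi> x - (\<Sum>b\<in>Basis. (h \<bullet> b) * partial b \<phi> x)\<bar> \<le> E * (norm h)\<^sup>2" for x h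
      using taylor_of_partials[OF s C(3)] E by (meson mult_right_mono zero_le_power2 order_trans)
  qed
qed

section \<open>Convolution of a bounded Borel function with a test function\<close>

definition conv :: "('a::euclidean_space \<Rightarrow> real) \<Rightarrow> ('a \<Rightarrow> real) \<Rightarrow> 'a \<Rightarrow> real" where
  "conv u \<phi> x = (LINT y|lborel. u y * \<phi> (x - y))"

locale bounded_borel =
  fixes u :: "'a::euclidean_space \<Rightarrow> real" and M :: real
  assumes borel [measurable]: "u \<in> borel_measurable borel" and bound: "\<And>x. \<bar>u x\<bar> \<le> M"
begin

lemma conv_integrable:
  assumes "\<phi> \<in> test_functions" shows "integrable lborel (\<lambda>y. u y * \<phi> (x - y))"
  using integrable_mult_test[OF borel bound test_reflect[OF assms]] .

lemma conv_bound:
  assumes "\<phi> \<in> test_functions" shows "\<bar>conv u \<phi> x\<bar> \<le> M * (LINT y|lborel. \<bar>\<phi> y\<bar>)"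
proof -
  have i: "integrable lborel (\<lambda>y. \<phi> (x - y))" using test_integrable test_reflect assms by blast
  have [measurable]: "\<phi> \<in> borel_measurable borel" by (intro test_borel assms)
  have "\<bar>conv u \<phi> x\<bar> \<le> (LINT y|lborel. \<bar>u y * \<phi> (x - y)\<bar>)"
    unfolding conv_def by (rule integral_abs_bound)
  also have "\<dots> \<le> (LINT y|lborel. M * \<bar>\<phi> (x - y)\<bar>)"
    by (intro integral_mono integrable_abs integrable_mult_right conv_integrable assms i)
       (auto simp: abs_mult intro!: mult_right_mono bound)
  also have "\<dots> = M * (LINT y|lborel. \<bar>\<phi> y\<bar>)"
    using integral_reflect[of "\<lambda>y. \<bar>\<phi> y\<bar>" x] by simp
  finally show ?thesis .
qed

text \<open>Differentiation under the integral: the Taylor remainder of \<phi> is uniformly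
  quadratic, and for \<open>dist y x < 1\<close> all integrands live in the ball of radius
  \<open>R + 1\<close> around \<open>x\<close>, so the integrated remainder is still
  quadratic.\<close>

lemma conv_has_derivative:
  assumes t: "\<phi> \<in> test_functions"
  shows "(conv u \<phi> has_derivative (\<lambda>h. \<Sum>b\<in>Basis. (h \<bullet> b) * conv u (partial b \<phi>) x)) (at x)"
proof -
  obtain C where C: "C > 0"
    "\<And>x h. \<bar>\<phi> (x + h) - \<phi> x - (\<Sum>b\<in>Basis. (h \<bullet> b) * partial b \<phi> x)\<bar> \<le> C * (norm h)\<^sup>2"
    using test_difference_bounds[OF t] by metis
  obtain R where R: "\<And>x. norm x > R \<Longrightarrow> \<phi> x = 0" using test_support t by metis
  have M: "M \<ge> 0" using bound[of 0] by linarith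
  define K where "K = M * C * measure lborel (cball 0 (R + 1) :: 'a set)"
  have K: "\<bar>conv u \<phi> y - conv u \<phi> x - (\<Sum>b\<in>Basis. ((y - x) \<bullet> b) * conv u (partial b \<phi>) x)\<bar>
      \<le> K * (norm (y - x))\<^sup>2" if "dist y x < 1" for y
  proof -
    have "conv u \<phi> y - conv u \<phi> x - (\<Sum>b\<in>Basis. ((y - x) \<bullet> b) * conv u (partial b \<phi>) x)
       = (LINT z|lborel. u z * \<phi> (y - z)) - (LINT z|lborel. u z * \<phi> (x - z))
         - (LINT z|lborel. (\<Sum>b\<in>Basis. ((y - x) \<bullet> b) * (u z * partial b \<phi> (x - z))))"
      unfolding conv_def by (subst Bochner_Integration.integral_sum) (auto intro!: conv_integrable test_partial t)
    also have "\<dots> = (LINT z|lborel. u z * \<phi> (y - z) - u z * \<phi> (x - z)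
         - (\<Sum>b\<in>Basis. ((y - x) \<bullet> b) * (u z * partial b \<phi> (x - z))))"
      by (simp add: conv_integrable test_partial t)
    also have "\<dots> = (LINT z|lborel. u z * (\<phi> ((x - z) + (y - x)) - \<phi> (x - z)
         - (\<Sum>b\<in>Basis. ((y - x) \<bullet> b) * partial b \<phi> (x - z))))"
      by (intro Bochner_Integration.integral_cong) (auto simp: right_diff_distrib sum_distrib_left mult_ac)
    finally have e: "conv u \<phi> y - conv u \<phi> x - (\<Sum>b\<in>Basis. ((y - x) \<bullet> b) * conv u (partial b \<phi>) x) = \<dots>" .
    have "\<bar>\<dots>\<bar> \<le> M * (C * (norm (y - x))\<^sup>2) * measure lborel (cball 0 (R + 1) :: 'a set)"
    proof (rule integral_bounded_support[where a=x])
      show "\<bar>u z * (\<phi> ((x - z) + (y - x)) - \<phi> (x - z) - (\<Sum>b\<in>Basis. ((y - x) \<bullet> b) * partial b \<phi> (x - z)))\<bar>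
        \<le> M * (C * (norm (y - x))\<^sup>2)" for z
        unfolding abs_mult by (intro mult_mono bound C(2) M) auto
      fix z assume z: "norm (z - x) > R + 1"
      then have "norm (x - z) > R + 1" by (simp add: norm_minus_commute)
      moreover have "norm (x - z) \<le> norm ((x - z) + (y - x)) + norm (y - x)"
        by (metis add_diff_cancel norm_triangle_ineq4)
      ultimately have "norm ((x - z) + (y - x)) > R" "norm (x - z) > R"
        using that by (auto simp: dist_norm)
      then show "u z * (\<phi> ((x - z) + (y - x)) - \<phi> (x - z) - (\<Sum>b\<in>Basis. ((y - x) \<bullet> b) * partial b \<phi> (x - z))) = 0"
        using partial_eq_0_outside[of R \<phi>, OF R] R by simp
    qed
    then show ?thesis unfolding e K_def by (simp add: mult_ac)
  qed
  show ?thesis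
  proof (rule has_derivativeI_sandwich[of 1 _ _ _ _ "\<lambda>y. K * norm (y - x)"])
    show "bounded_linear (\<lambda>h. \<Sum>b\<in>Basis. (h \<bullet> b) * conv u (partial b \<phi>) x)"
      by (intro bounded_linear_sum bounded_linear_mult_const bounded_linear_inner_left)
    show "norm (conv u \<phi> y - conv u \<phi> x - (\<Sum>b\<in>Basis. ((y - x) \<bullet> b) * conv u (partial b \<phi>) x)) / norm (y - x)
        \<le> K * norm (y - x)" if "y \<noteq> x" "dist y x < 1" for y
      using K[OF that(2)] that(1) by (simp add: divide_le_eq power2_eq_square mult_ac)
    have "((\<lambda>y. K * norm (y - x)) \<longlongrightarrow> K * norm (x - x)) (at x)"
      by (intro tendsto_intros)
    then show "((\<lambda>y. K * norm (y - x)) \<longlongrightarrow> 0) (at x)" by simp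
  qed simp
qed

lemma partial_conv:
  assumes "\<phi> \<in> test_functions" "b \<in> Basis"
  shows "partial b (conv u \<phi>) x = conv u (partial b \<phi>) x"
  using partial_eqI[OF conv_has_derivative[OF assms(1)], of b] assms(2)
  by (simp add: inner_Basis if_distrib if_distribR cong: if_cong)

lemma smooth_conv: "\<phi> \<in> test_functions \<Longrightarrow> smooth (conv u \<phi>)"
proof -
  have "Ck k (conv u \<phi>)" if "\<phi> \<in> test_functions" for k \<phi>
    using that
  proof (induction k arbitrary: \<phi>)
    case 0
    then show ?case
      using has_derivative_continuous[OF conv_has_derivative[OF 0]]
      by (auto intro: continuous_at_imp_continuous_on)
  next
    case (Suc k)
    have "(\<lambda>x. \<Sum>c\<in>Basis. (b \<bullet> c) * conv u (partial c \<phi>) x) = conv u (partial b \<phi>)" if "b \<in> Basis" for b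
      using that by (simp add: inner_Basis if_distrib if_distribR cong: if_cong)
    then show ?case
      by (intro Ck_SucI[OF conv_has_derivative[OF Suc.prems]]) (use Suc test_partial in auto)
  qed
  then show "\<phi> \<in> test_functions \<Longrightarrow> smooth (conv u \<phi>)" unfolding smooth_def by blast
qed

lemma laplacian_conv:
  assumes "\<phi> \<in> test_functions"
  shows "laplacian (conv u \<phi>) x = conv u (laplacian \<phi>) x"
proof -
  have "partial b (partial b (conv u \<phi>)) x = conv u (partial b (partial b \<phi>)) x" if "b \<in> Basis" for b
  proof -
    have "partial b (conv u \<phi>) = conv u (partial b \<phi>)" using partial_conv assms that by blast
    then show ?thesis using partial_conv test_partial assms that by metis
  qed
  then show ?thesis
    unfolding laplacian_def conv_def
    by (simp add: sum_distrib_left conv_integrable test_partial assms Bochner_Integration.integral_sum)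
qed

lemma diff2_conv:
  assumes "\<phi> \<in> test_functions"
  shows "diff2 (conv u \<phi>) h x = conv u (diff2 \<phi> h) x"
proof -
  have "conv u (diff2 \<phi> h) x = (LINT y|lborel. u y * \<phi> ((x + h) - y) + u y * \<phi> ((x - h) - y) - 2 * (u y * \<phi> (x - y)))"
    unfolding conv_def diff2_def
    by (intro Bochner_Integration.integral_cong) (auto simp: algebra_simps)
  also have "\<dots> = diff2 (conv u \<phi>) h x"
    unfolding diff2_def conv_def by (simp add: conv_integrable assms)
  finally show ?thesis by simp
qed

end

text \<open>The convolution of the constant 1 with \<phi> is a constant function, namely the
  integral of \<phi>; its derivative vanishes and is at the same time the convolution of 1 with
  \<open>partial b \<phi>\<close>. This is the source of every integration by parts.\<close>

lemma integral_partial_test: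
  fixes \<phi> :: "'a::euclidean_space \<Rightarrow> real"
  assumes "\<phi> \<in> test_functions" "b \<in> Basis"
  shows "(LINT x|lborel. partial b \<phi> x) = 0"
proof -
  interpret bounded_borel "\<lambda>_::'a. 1" 1 by unfold_locales auto
  have [measurable]: "\<phi> \<in> borel_measurable borel" by (intro test_borel assms)
  have m: "partial b \<phi> \<in> borel_measurable borel" by (intro test_borel test_partial assms)
  have c: "conv (\<lambda>_. 1) \<phi> = (\<lambda>x. LINT y|lborel. \<phi> y)"
    unfolding conv_def using integral_reflect[of \<phi>] by auto
  have "partial b (conv (\<lambda>_. 1) \<phi>) 0 = 0"
    unfolding c by (rule partial_eqI) simp
  then have "(LINT y|lborel. partial b \<phi> (0 - y)) = 0"
    using partial_conv[OF assms, of 0] by (simp add: conv_def)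
  then show ?thesis using integral_reflect[OF m, of 0] by simp
qed

section \<open>Mollification\<close>

definition mollifier :: "real \<Rightarrow> ('a::euclidean_space \<Rightarrow> real) \<Rightarrow> bool" where
  "mollifier e \<eta> \<longleftrightarrow> \<eta> \<in> test_functions \<and> (\<forall>x. \<eta> x \<ge> 0) \<and> (\<forall>x. norm x \<ge> e \<longrightarrow> \<eta> x = 0) \<and>
     (LINT x|lborel. \<eta> x) = 1"

lemma flats_0_nonneg: "flats 0 t \<ge> 0"
  using flats_0_pos[of t] flats_nonpos[of t 0] by (cases "t > 0") (auto simp: less_imp_le)

lemma flats_1_nonneg: "flats 1 t \<ge> 0"
  using flats_1_pos[of t] flats_nonpos[of t 1] by (cases "t > 0") (auto simp: less_imp_le)

text \<open>A nonnegative function with integral 0 vanishes almost everywhere, but the bump is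
  positive on a ball of positive measure. The index stays free because \<open>j = 0\<close>
  normalises the mollifier and \<open>j = 1\<close> the averaging kernel.\<close>

lemma integral_bump_pos:
  assumes e: "e > 0" and pos: "\<And>t. t > 0 \<Longrightarrow> flats j t > 0" and nonneg: "\<And>t. flats j t \<ge> 0"
  shows "(LINT x|lborel. bump j e (x :: 'a::euclidean_space)) > 0"
proof (rule ccontr)
  assume "\<not> ?thesis"
  moreover have n: "bump j e x \<ge> 0" for x :: 'a by (simp add: bump_def nonneg)
  then have "(LINT x|lborel. bump j e (x :: 'a)) \<ge> 0" by (rule Bochner_Integration.integral_nonneg)
  ultimately have "(LINT x|lborel. bump j e (x :: 'a)) = 0" by linarith
  then have "AE x in lborel. bump j e (x :: 'a) = 0"
    using n by (subst (asm) integral_nonneg_eq_0_iff_AE[OF test_integrable[OF bump_test[OF e]]]) auto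
  then have "AE x in lborel. (x :: 'a) \<notin> ball 0 e"
  proof eventually_elim
    case (elim x)
    then have "\<not> norm x < e"
      using pos[OF bump_inside[OF e, of x]] by (auto simp: bump_def)
    then show ?case by simp
  qed
  then have "emeasure lborel (ball 0 e :: 'a set) = 0"
    by (subst (asm) AE_iff_measurable[of "ball 0 e"]) auto
  then have "measure lborel (ball 0 e :: 'a set) = 0" by (simp add: measure_def)
  then show False using content_ball_pos[OF e, of "0 :: 'a"] by simp
qed

lemma mollifier_exists:
  assumes "e > 0" shows "\<exists>\<eta> :: 'a::euclidean_space \<Rightarrow> real. mollifier e \<eta>"
proof -
  define c where "c = (LINT x|lborel. bump 0 e (x :: 'a))"
  have c: "c > 0" unfolding c_def by (rule integral_bump_pos[OF assms flats_0_pos flats_0_nonneg])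
  define \<eta> where "\<eta> x = bump 0 e (x :: 'a) * (1 / c)" for x
  have "\<eta> \<in> test_functions"
    unfolding \<eta>_def using test_mult[OF bump_test[OF assms, of 0] smooth_const[of "1 / c"]] .
  moreover have "(LINT x|lborel. \<eta> x) = 1"
  proof -
    have "(LINT x|lborel. \<eta> x) = (LINT x|lborel. bump 0 e (x :: 'a)) * (1 / c)"
      unfolding \<eta>_def by (rule integral_mult_left_zero)
    then show ?thesis using c unfolding c_def by simp
  qed
  moreover have "\<eta> x \<ge> 0" for x
    using c by (simp add: \<eta>_def bump_def flats_0_nonneg)
  moreover have "\<eta> x = 0" if "norm x \<ge> e" for x
    using bump_outside[OF assms that] by (simp add: \<eta>_def)
  ultimately show ?thesis unfolding mollifier_def by blast
qed

lemma mollifier_test: "mollifier e \<eta> \<Longrightarrow> \<eta> \<in> test_functions"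
  by (simp add: mollifier_def)

lemma mollifier_mono: "mollifier e \<eta> \<Longrightarrow> e \<le> d \<Longrightarrow> mollifier d \<eta>"
  by (auto simp: mollifier_def)

lemma mollifier_outside: "mollifier e \<eta> \<Longrightarrow> norm x \<ge> e \<Longrightarrow> \<eta> x = 0"
  by (auto simp: mollifier_def)

lemma integral_mollifier_reflect:
  assumes "mollifier e \<eta>"
  shows "integrable lborel (\<lambda>y. \<eta> (x - y))" "(LINT y|lborel. \<eta> (x - y)) = 1"
  using test_integrable[OF test_reflect[OF mollifier_test[OF assms]]]
    integral_reflect[OF test_borel[OF mollifier_test[OF assms]], of x] assms
  by (auto simp: mollifier_def)

context bounded_borel
begin

lemma conv_mollifier_bound:
  assumes "mollifier e \<eta>" shows "\<bar>conv u \<eta> x\<bar> \<le> M"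
  using conv_bound[OF mollifier_test[OF assms], of x] assms by (simp add: mollifier_def abs_of_nonneg)

lemma conv_mollifier_minus:
  assumes m: "mollifier e \<eta>" and c: "\<And>y. dist x y < e \<Longrightarrow> \<bar>u y - c\<bar> \<le> d"
  shows "\<bar>conv u \<eta> x - c\<bar> \<le> d"
proof -
  note i = integral_mollifier_reflect[OF m, of x]
  note ci = conv_integrable[OF mollifier_test[OF m], of x]
  have *: "norm ((u y - c) * \<eta> (x - y)) \<le> d * \<eta> (x - y)" for y
  proof (cases "dist x y < e")
    case True
    have "\<eta> (x - y) \<ge> 0" using m by (simp add: mollifier_def)
    then show ?thesis using c[OF True] by (simp add: abs_mult mult_right_mono)
  next
    case False then show ?thesis using mollifier_outside[OF m, of "x - y"] by (simp add: dist_norm)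
  qed
  have e: "conv u \<eta> x - c = (LINT y|lborel. (u y - c) * \<eta> (x - y))"
    unfolding conv_def using i ci by (simp add: left_diff_distrib)
  have ii: "integrable lborel (\<lambda>y. (u y - c) * \<eta> (x - y))"
    using i ci by (simp add: left_diff_distrib)
  have "\<bar>conv u \<eta> x - c\<bar> \<le> (LINT y|lborel. norm ((u y - c) * \<eta> (x - y)))"
    unfolding e real_norm_def by (rule integral_abs_bound)
  also have "\<dots> \<le> (LINT y|lborel. d * \<eta> (x - y))"
    by (intro integral_mono integrable_norm ii integrable_mult_right i(1) *)
  finally show ?thesis using i(2) by simp
qed

text \<open>Lebesgue measurability provides continuous functions converging to \<open>u\<close>
  almost everywhere. Truncating them at level \<open>M\<close> does not disturb the limit and gives
  the dominating function on the ball.\<close>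

lemma continuous_approx:
  assumes "e > 0"
  shows "\<exists>g. continuous_on UNIV g \<and> (\<forall>x. \<bar>g x\<bar> \<le> M) \<and>
    (LINT x|lborel. indicator (cball 0 R) x * \<bar>u x - g x\<bar>) < e"
proof -
  have M: "M \<ge> 0" using bound[of 0] by linarith
  have "u measurable_on UNIV"
    by (rule lebesgue_measurable_imp_measurable_on) (auto intro: measurable_completion)
  then obtain N g where N: "negligible N" and g: "\<And>n. continuous_on UNIV (g n)"
    "\<And>x. x \<notin> N \<Longrightarrow> (\<lambda>n. g n x) \<longlonglongrightarrow> u x"
    unfolding measurable_on_def by auto
  define G where "G n x = max (- M) (min M (g n x))" for n x
  have Gc: "continuous_on UNIV (G n)" for n
    unfolding G_def by (intro continuous_intros g)
  then have Gm: "G n \<in> borel_measurable borel" for n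
    by (rule borel_measurable_continuous_onI)
  have Gb: "\<bar>G n x\<bar> \<le> M" for n x unfolding G_def using M by auto
  have Gl: "(\<lambda>n. G n x) \<longlonglongrightarrow> u x" if "x \<notin> N" for x
  proof -
    have "(\<lambda>n. G n x) \<longlonglongrightarrow> max (- M) (min M (u x))"
      unfolding G_def by (intro tendsto_intros g that)
    moreover have "max (- M) (min M (u x)) = u x" using bound[of x] by linarith
    ultimately show ?thesis by simp
  qed
  have ae: "AE x in lborel. x \<notin> N"
    using N AE_not_in[of N lebesgue] by (simp add: negligible_iff_null_sets AE_completion_iff)
  have "(\<lambda>n. LINT x|lborel. indicator (cball 0 R) x * \<bar>u x - G n x\<bar>) \<longlonglongrightarrow> (LINT x|(lborel :: 'a measure). (0 :: real))"
  proof (rule integral_dominated_convergence[where w="\<lambda>x::'a. 2 * M * indicator (cball 0 R) x"])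
    show "integrable lborel (\<lambda>x::'a. 2 * M * indicator (cball 0 R) x)"
      by (intro integrable_mult_right integrable_real_indicator emeasure_lborel_cball_finite) auto
    show "AE x in lborel. (\<lambda>n. indicator (cball 0 R) x * \<bar>u x - G n x\<bar>) \<longlonglongrightarrow> 0"
      using ae
    proof eventually_elim
      case (elim x)
      have "(\<lambda>n. indicator (cball 0 R) x * \<bar>u x - G n x\<bar>) \<longlonglongrightarrow> indicator (cball 0 R) x * \<bar>u x - u x\<bar>"
        by (intro tendsto_intros Gl elim)
      then show ?case by simp
    qed
    show "AE x in lborel. norm (indicator (cball 0 R) x * \<bar>u x - G n x\<bar>) \<le> 2 * M * indicator (cball 0 R) x" for n
    proof (intro AE_I2)
      fix x
      have "\<bar>u x - G n x\<bar> \<le> 2 * M" using bound[of x] Gb[of n x] by linarith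
      then show "norm (indicator (cball 0 R) x * \<bar>u x - G n x\<bar>) \<le> 2 * M * indicator (cball 0 R) x"
        by (simp add: indicator_def)
    qed
    show "(\<lambda>x. indicator (cball 0 R) x * \<bar>u x - G n x\<bar>) \<in> borel_measurable lborel" for n
      by (intro borel_measurable_times borel_measurable_abs borel_measurable_diff borel_measurable_indicator)
         (use Gm[of n] borel in auto)
  qed auto
  then have "eventually (\<lambda>n. (LINT x|lborel. indicator (cball 0 R) x * \<bar>u x - G n x\<bar>) < e) sequentially"
    using assms by (intro order_tendstoD) auto
  then obtain n where "(LINT x|lborel. indicator (cball 0 R) x * \<bar>u x - G n x\<bar>) < e"
    using eventually_sequentially by auto
  then show ?thesis using Gc Gb by blast
qed

lemma integrable_indicator_cball:
  assumes [measurable]: "f \<in> borel_measurable borel" and "\<And>x. \<bar>f x\<bar> \<le> C"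
  shows "integrable lborel (\<lambda>x::'a. indicator (cball 0 R) x * (f x :: real))"
proof (rule integrable_bounded_support[where C="C" and R=R and a=0])
  show "\<bar>indicator (cball 0 R) x * f x\<bar> \<le> C" for x
    using assms(2)[of x] by (auto simp: indicator_def)
qed (auto simp: indicator_def)

text \<open>Local L^1 contraction of mollification. After Tonelli, points of the ball of radius
  \<open>R\<close> receive mass only from the ball of radius \<open>R + 1\<close>, and the kernel
  has total mass 1.\<close>

lemma integral_conv_le:
  assumes m: "mollifier e \<eta>" and e: "e \<le> 1" and nonneg: "\<And>x. u x \<ge> 0"
  shows "(LINT x|lborel. indicator (cball 0 R) x * conv u \<eta> x)
    \<le> (LINT x|lborel. indicator (cball 0 (R + 1)) x * u x)"
proof -
  note t = mollifier_test[OF m]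
  have [measurable]: "\<eta> \<in> borel_measurable borel" by (rule test_borel[OF t])
  have n: "\<eta> x \<ge> 0" for x using m by (simp add: mollifier_def)
  have cn: "conv u \<eta> x \<ge> 0" for x
    unfolding conv_def by (intro Bochner_Integration.integral_nonneg mult_nonneg_nonneg nonneg n)
  have cb: "conv u \<eta> \<in> borel_measurable borel" by (rule smooth_borel[OF smooth_conv[OF t]])
  have "ennreal (LINT x|lborel. indicator (cball 0 R) x * conv u \<eta> x)
     = (\<integral>\<^sup>+x. ennreal (indicator (cball 0 R) x * conv u \<eta> x) \<partial>lborel)"
    by (intro nn_integral_eq_integral[symmetric] integrable_indicator_cball[OF cb conv_mollifier_bound[OF m]])
       (auto intro!: AE_I2 mult_nonneg_nonneg cn)
  also have "\<dots> = (\<integral>\<^sup>+x. (\<integral>\<^sup>+y. ennreal (indicator (cball 0 R) x * (u y * \<eta> (x - y))) \<partial>lborel) \<partial>lborel)"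
  proof (intro nn_integral_cong)
    fix x :: 'a
    have "indicator (cball 0 R) x * conv u \<eta> x = (LINT y|lborel. indicator (cball 0 R) x * (u y * \<eta> (x - y)))"
      unfolding conv_def by simp
    then show "ennreal (indicator (cball 0 R) x * conv u \<eta> x)
       = (\<integral>\<^sup>+y. ennreal (indicator (cball 0 R) x * (u y * \<eta> (x - y))) \<partial>lborel)"
      by (simp only:) (intro nn_integral_eq_integral[symmetric] integrable_mult_right conv_integrable t,
        auto intro!: AE_I2 mult_nonneg_nonneg nonneg n)
  qed
  also have "\<dots> = (\<integral>\<^sup>+y. (\<integral>\<^sup>+x. ennreal (indicator (cball 0 R) x * (u y * \<eta> (x - y))) \<partial>lborel) \<partial>lborel)"
    by (rule lborel_pair.Fubini') (simp add: split_def cball_def, measurable)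
  also have "\<dots> \<le> (\<integral>\<^sup>+y. (\<integral>\<^sup>+x. ennreal (indicator (cball 0 (R + 1)) y * u y) * ennreal (\<eta> (x - y)) \<partial>lborel) \<partial>lborel)"
  proof (intro nn_integral_mono)
    fix x y :: 'a
    have "indicator (cball 0 R) x * (u y * \<eta> (x - y)) \<le> (indicator (cball 0 (R + 1)) y * u y) * \<eta> (x - y)"
    proof (cases "norm (x - y) \<ge> e")
      case True then show ?thesis using mollifier_outside[OF m] by simp
    next
      case False
      then have "norm y \<le> norm x + 1" using e norm_triangle_ineq3[of x y] by linarith
      then have "indicator (cball 0 R) x \<le> (indicator (cball 0 (R + 1)) y :: real)"
        by (auto simp: indicator_def)
      then show ?thesis using nonneg[of y] n[of "x - y"] by (simp add: mult_ac mult_left_mono)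
    qed
    then show "ennreal (indicator (cball 0 R) x * (u y * \<eta> (x - y)))
        \<le> ennreal (indicator (cball 0 (R + 1)) y * u y) * ennreal (\<eta> (x - y))"
      using nonneg[of y] n[of "x - y"] by (simp add: ennreal_mult[symmetric])
  qed
  also have "\<dots> = (\<integral>\<^sup>+y. ennreal (indicator (cball 0 (R + 1)) y * u y) \<partial>lborel)"
  proof (intro nn_integral_cong)
    fix y :: 'a
    have "(\<integral>\<^sup>+x. ennreal (\<eta> (x - y)) \<partial>lborel) = (\<integral>\<^sup>+x. ennreal (\<eta> x) \<partial>lborel)"
      using nn_integral_shift[of "\<lambda>x. ennreal (\<eta> x)" "- y"] by simp
    also have "\<dots> = 1"
      using m n by (subst nn_integral_eq_integral[OF test_integrable[OF t]]) (auto simp: mollifier_def)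
    finally show "(\<integral>\<^sup>+x. ennreal (indicator (cball 0 (R + 1)) y * u y) * ennreal (\<eta> (x - y)) \<partial>lborel)
      = ennreal (indicator (cball 0 (R + 1)) y * u y)"
      by (simp add: nn_integral_cmult)
  qed
  also have "\<dots> = ennreal (LINT x|lborel. indicator (cball 0 (R + 1)) x * u x)"
    by (intro nn_integral_eq_integral integrable_indicator_cball[OF borel bound])
       (auto intro!: AE_I2 mult_nonneg_nonneg nonneg)
  finally show ?thesis
    by (subst (asm) ennreal_le_iff) (auto intro!: Bochner_Integration.integral_nonneg mult_nonneg_nonneg nonneg)
qed

text \<open>Three errors of size \<open>e / 3\<close>: \<open>u\<close> against a continuous
  \<open>g\<close>, the mollified \<open>u - g\<close> by local contraction, and \<open>g\<close>
  against its own mollification by uniform continuity on a compact ball.\<close>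

lemma mollification_L1:
  assumes e: "e > 0"
  shows "\<exists>d>0. \<forall>\<eta>. mollifier d \<eta> \<longrightarrow>
    (LINT x|lborel. indicator (cball 0 R) x * \<bar>conv u \<eta> x - u x\<bar>) \<le> e"
proof -
  have M: "M \<ge> 0" using bound[of 0] by linarith
  define V where "V = measure lborel (cball 0 R :: 'a set) + 1"
  \<comment> \<open>The added 1 in \<open>V\<close> covers a ball of measure zero; \<open>q\<close>
    is then the pointwise error whose integral over the ball is at most
    \<open>e / 3\<close>.\<close>
  have V: "V > 0" unfolding V_def by (simp add: add_nonneg_pos)
  define q where "q = e / (3 * V)"
  have q: "q > 0" "V * q = e / 3" using e V by (auto simp: q_def)
  obtain g where g: "continuous_on UNIV g" "\<And>x. \<bar>g x\<bar> \<le> M"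
    "(LINT x|lborel. indicator (cball 0 (R + 1)) x * \<bar>u x - g x\<bar>) < e / 3"
    using continuous_approx[of "e / 3" "R + 1"] e by auto
  have [measurable]: "g \<in> borel_measurable borel" using g(1) by (rule borel_measurable_continuous_onI)
  interpret g: bounded_borel g M by unfold_locales (use g in auto)
  interpret D: bounded_borel "\<lambda>x. \<bar>u x - g x\<bar>" "2 * M"
  proof unfold_locales
    show "\<bar>\<bar>u x - g x\<bar>\<bar> \<le> 2 * M" for x using bound[of x] g(2)[of x] by linarith
  qed simp
  have "uniformly_continuous_on (cball 0 (R + 1)) g"
    by (intro compact_uniformly_continuous continuous_on_subset[OF g(1)]) auto
  then obtain d where d: "d > 0" "\<And>x y. x \<in> cball 0 (R + 1) \<Longrightarrow> y \<in> cball 0 (R + 1) \<Longrightarrow> dist y x < d \<Longrightarrow>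
      dist (g y) (g x) < q"
    unfolding uniformly_continuous_on_def using q(1) by metis
  show ?thesis
  proof (intro exI[of _ "min d 1"] conjI allI impI)
    show "min d 1 > 0" using d by simp
    fix \<eta> :: "'a \<Rightarrow> real" assume m: "mollifier (min d 1) \<eta>"
    note t = mollifier_test[OF m]
    have [measurable]: "conv u \<eta> \<in> borel_measurable borel" "conv (\<lambda>x. \<bar>u x - g x\<bar>) \<eta> \<in> borel_measurable borel"
      by (auto intro: smooth_borel smooth_conv D.smooth_conv t)
    have n: "\<eta> x \<ge> 0" for x using m by (simp add: mollifier_def)
    have p: "indicator (cball 0 R) x * \<bar>conv u \<eta> x - u x\<bar>
       \<le> indicator (cball 0 R) x * conv (\<lambda>x. \<bar>u x - g x\<bar>) \<eta> x + indicator (cball 0 R) x * q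
         + indicator (cball 0 (R + 1)) x * \<bar>u x - g x\<bar>" for x
    proof (cases "x \<in> cball 0 R")
      case True
      have 1: "\<bar>conv u \<eta> x - conv g \<eta> x\<bar> \<le> conv (\<lambda>x. \<bar>u x - g x\<bar>) \<eta> x"
      proof -
        have "conv u \<eta> x - conv g \<eta> x = (LINT y|lborel. u y * \<eta> (x - y) - g y * \<eta> (x - y))"
          unfolding conv_def by (simp add: conv_integrable g.conv_integrable t)
        also have "\<bar>\<dots>\<bar> \<le> (LINT y|lborel. \<bar>u y * \<eta> (x - y) - g y * \<eta> (x - y)\<bar>)"
          by (rule integral_abs_bound)
        also have "\<dots> = conv (\<lambda>x. \<bar>u x - g x\<bar>) \<eta> x"
          unfolding conv_def using n by (simp add: left_diff_distrib[symmetric] abs_mult)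
        finally show ?thesis .
      qed
      have 2: "\<bar>conv g \<eta> x - g x\<bar> \<le> q"
      proof (rule g.conv_mollifier_minus[OF m])
        fix y assume y: "dist x y < min d 1"
        have "norm y \<le> norm x + norm (x - y)" using norm_triangle_ineq3[of x y] by linarith
        then have "y \<in> cball 0 (R + 1)" "x \<in> cball 0 (R + 1)" using True y by (auto simp: dist_norm)
        then show "\<bar>g y - g x\<bar> \<le> q"
          using d(2)[of x y] y by (simp add: dist_commute dist_real_def)
      qed
      have "x \<in> cball 0 (R + 1)" using True by simp
      then show ?thesis using True 1 2 by (simp add: indicator_def)
    qed (auto simp: indicator_def)
    have i1: "integrable lborel (\<lambda>x. indicator (cball 0 R) x * \<bar>conv u \<eta> x - u x\<bar>)"
    proof (rule integrable_indicator_cball[of _ "2 * M"])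
      show "\<bar>\<bar>conv u \<eta> x - u x\<bar>\<bar> \<le> 2 * M" for x using conv_mollifier_bound[OF m, of x] bound[of x] by linarith
    qed simp
    have i2: "integrable lborel (\<lambda>x. indicator (cball 0 R) x * conv (\<lambda>x. \<bar>u x - g x\<bar>) \<eta> x)"
      by (rule integrable_indicator_cball[OF _ D.conv_mollifier_bound[OF m]]) simp
    have i3: "integrable lborel (\<lambda>x. indicator (cball 0 R) x * q)"
      by (intro integrable_mult_left integrable_real_indicator emeasure_lborel_cball_finite) auto
    have i4: "integrable lborel (\<lambda>x. indicator (cball 0 (R + 1)) x * \<bar>u x - g x\<bar>)"
      by (rule integrable_indicator_cball[OF _ D.bound]) simp
    have "(LINT x|lborel. indicator (cball 0 R) x * \<bar>conv u \<eta> x - u x\<bar>)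
      \<le> (LINT x|lborel. indicator (cball 0 R) x * conv (\<lambda>x. \<bar>u x - g x\<bar>) \<eta> x + indicator (cball 0 R) x * q
         + indicator (cball 0 (R + 1)) x * \<bar>u x - g x\<bar>)"
      by (intro integral_mono p i1 Bochner_Integration.integrable_add i2 i3 i4)
    also have "\<dots> = (LINT x|lborel. indicator (cball 0 R) x * conv (\<lambda>x. \<bar>u x - g x\<bar>) \<eta> x)
       + measure lborel (cball 0 R :: 'a set) * q
       + (LINT x|lborel. indicator (cball 0 (R + 1)) x * \<bar>u x - g x\<bar>)"
      by (simp only: Bochner_Integration.integral_add[OF Bochner_Integration.integrable_add[OF i2 i3] i4]
          Bochner_Integration.integral_add[OF i2 i3]) simp
    also have "\<dots> \<le> e / 3 + e / 3 + e / 3"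
    proof (intro add_mono)
      show "(LINT x|lborel. indicator (cball 0 R) x * conv (\<lambda>x. \<bar>u x - g x\<bar>) \<eta> x) \<le> e / 3"
        using D.integral_conv_le[OF m, of R] g(3) by simp
      have "measure lborel (cball 0 R :: 'a set) * q \<le> V * q"
        using q by (intro mult_right_mono) (auto simp: V_def)
      then show "measure lborel (cball 0 R :: 'a set) * q \<le> e / 3" using q(2) by linarith
    qed (use g(3) in simp)
    finally show "(LINT x|lborel. indicator (cball 0 R) x * \<bar>conv u \<eta> x - u x\<bar>) \<le> e" by simp
  qed
qed

end

text \<open>If \<open>f\<close> is not integrable its integral is 0 by convention, so pointwise
  domination by an integrable \<open>g\<close> is enough in either case.\<close>

lemma abs_integral_le:
  fixes f g :: "'a \<Rightarrow> real"
  assumes g: "integrable M g" and le: "\<And>x. \<bar>f x\<bar> \<le> g x"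
  shows "\<bar>LINT x|M. f x\<bar> \<le> (LINT x|M. g x)"
proof (cases "integrable M f")
  case True
  then show ?thesis
    using integral_mono[OF integrable_abs[OF True] g le] integral_abs_bound[of M f] by linarith
next
  case False
  have "g x \<ge> 0" for x using le[of x] by linarith
  then have "(LINT x|M. g x) \<ge> 0" by (rule Bochner_Integration.integral_nonneg)
  with False show ?thesis by (simp add: not_integrable_integral_eq)
qed

section \<open>The L^1 modulus of translation from the weak gradient\<close>

context bounded_borel
begin

text \<open>The weak gradient is tested with the reflected function
  \<open>\<lambda>y. \<phi> (x - y)\<close>; the sign from reflecting cancels the sign in the
  definition of the weak gradient.\<close>

lemma conv_partial_weak_gradient:
  assumes w: "has_weak_gradient u Du" and t: "\<phi> \<in> test_functions" and b: "b \<in> Basis"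
  shows "conv u (partial b \<phi>) x = (LINT y|lebesgue. (Du y \<bullet> b) * \<phi> (x - y))"
proof -
  have m: "(\<lambda>y. u y * partial b \<phi> (x - y)) \<in> borel_measurable lborel"
    using borel_measurable_integrable[OF conv_integrable[OF test_partial[OF t b]]] by simp
  have "(LINT y|lebesgue. u y * partial b (\<lambda>y. \<phi> (x - y)) y) = - (LINT y|lebesgue. (Du y \<bullet> b) * \<phi> (x - y))"
    using w test_reflect[OF t, of x] b unfolding has_weak_gradient_def partial_def by blast
  then have "(LINT y|lebesgue. u y * partial b \<phi> (x - y)) = (LINT y|lebesgue. (Du y \<bullet> b) * \<phi> (x - y))"
    by (simp add: partial_reflect[OF test_smooth[OF t]])
  then show ?thesis
    unfolding conv_def using integral_completion[OF m] by simp
qed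

text \<open>The constant depends only on the L^1 norm of \<open>Du\<close> on a ball and not on
  \<phi>; this uniformity over all \<phi> bounded by 1 is what the duality argument below needs. The
  radius \<open>R + 2\<close> adds to the support radius \<open>R + 1\<close> the unit ball in which
  the base point moves.\<close>

lemma shift_conv_bound:
  assumes w: "has_weak_gradient u Du"
  shows "\<exists>C\<ge>0. \<forall>\<phi> h. \<phi> \<in> test_functions \<longrightarrow> (\<forall>x. \<bar>\<phi> x\<bar> \<le> 1) \<longrightarrow> (\<forall>x. norm x > R + 1 \<longrightarrow> \<phi> x = 0) \<longrightarrow>
    norm h \<le> 1 \<longrightarrow> \<bar>conv u \<phi> h - conv u \<phi> 0\<bar> \<le> C * norm h"
proof -
  define A where "A b = (LINT y|lebesgue. \<bar>indicator (cball 0 (R + 2)) y * (Du y \<bullet> b)\<bar>)" for b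
  have i: "integrable lebesgue (\<lambda>y. \<bar>indicator (cball 0 (R + 2)) y * (Du y \<bullet> b)\<bar>)" for b
  proof -
    have "Du absolutely_integrable_on cball 0 (R + 2)"
      using w unfolding has_weak_gradient_def by simp
    then have "integrable lebesgue (\<lambda>y. (indicator (cball 0 (R + 2)) y *\<^sub>R Du y) \<bullet> b)"
      unfolding set_integrable_def by (rule integrable_inner_left)
    then show ?thesis by (intro integrable_abs) simp
  qed
  have A: "A b \<ge> 0" for b unfolding A_def by (rule Bochner_Integration.integral_nonneg) simp
  show ?thesis
  proof (intro exI[of _ "DIM('a) * sum A Basis"] conjI allI impI)
    show "0 \<le> DIM('a) * sum A Basis" using A by (intro mult_nonneg_nonneg sum_nonneg) auto
    fix \<phi> :: "'a \<Rightarrow> real" and h :: 'a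
    assume t: "\<phi> \<in> test_functions" and b1: "\<forall>x. \<bar>\<phi> x\<bar> \<le> 1" and z: "\<forall>x. norm x > R + 1 \<longrightarrow> \<phi> x = 0" and h: "norm h \<le> 1"
    have d: "\<bar>conv u (partial b \<phi>) x\<bar> \<le> sum A Basis" if "b \<in> Basis" "x \<in> cball 0 1" for b x
    proof -
      have "\<bar>conv u (partial b \<phi>) x\<bar> \<le> A b"
        unfolding conv_partial_weak_gradient[OF w t that(1)] A_def
      proof (rule abs_integral_le[OF i])
        fix y
        show "\<bar>(Du y \<bullet> b) * \<phi> (x - y)\<bar> \<le> \<bar>indicator (cball 0 (R + 2)) y * (Du y \<bullet> b)\<bar>"
        proof (cases "norm (x - y) > R + 1")
          case False
          then have "norm y \<le> R + 2" using that(2) norm_triangle_ineq3[of x y] by simp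
          then show ?thesis using b1 by (simp add: abs_mult mult_left_le)
        qed (use z in simp)
      qed
      also have "\<dots> \<le> sum A Basis" using A by (intro member_le_sum that) auto
      finally show ?thesis .
    qed
    have "norm (conv u \<phi> h - conv u \<phi> 0) \<le> (DIM('a) * sum A Basis) * norm (h - 0)"
      by (rule differentiable_bound[OF convex_cball[of 0 1] has_derivative_at_withinI[OF conv_has_derivative[OF t]]
          onorm_partials]) (use d h in auto)
    then show "\<bar>conv u \<phi> h - conv u \<phi> 0\<bar> \<le> DIM('a) * sum A Basis * norm h" by simp
  qed
qed

text \<open>Duality: the L^1 norm of the difference \<open>v\<close> over the ball is its pairing
  with the truncated sign of \<open>v\<close>. The sign is mollified into a test function, and the
  pairing with a test function is an increment of a convolution.\<close>

lemma translation_L1_bound: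
  assumes w: "has_weak_gradient u Du"
  shows "\<exists>C\<ge>0. \<forall>h. norm h \<le> 1 \<longrightarrow>
    (LINT x|lborel. indicator (cball 0 R) x * \<bar>u (x + h) - u x\<bar>) \<le> C * norm h"
proof -
  have M: "M \<ge> 0" using bound[of 0] by linarith
  obtain C where C: "C \<ge> 0" "\<And>\<phi> h. \<phi> \<in> test_functions \<Longrightarrow> (\<And>x. \<bar>\<phi> x\<bar> \<le> 1) \<Longrightarrow>
      (\<And>x. norm x > R + 1 \<Longrightarrow> \<phi> x = 0) \<Longrightarrow> norm h \<le> 1 \<Longrightarrow> \<bar>conv u \<phi> h - conv u \<phi> 0\<bar> \<le> C * norm h"
    using shift_conv_bound[OF w, of R] by metis
  show ?thesis
  proof (intro exI[of _ C] conjI allI impI C(1))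
    fix h :: 'a assume h: "norm h \<le> 1"
    define v where "v x = u (x + h) - u x" for x
    define \<sigma> where "\<sigma> x = indicator (cball 0 R) x * sgn (v x)" for x
    have [measurable]: "v \<in> borel_measurable borel" unfolding v_def by measurable
    have vb: "\<bar>v x\<bar> \<le> 2 * M" for x unfolding v_def using bound[of x] bound[of "x + h"] by linarith
    have sm: "\<sigma> \<in> borel_measurable borel"
      unfolding \<sigma>_def by (intro borel_measurable_times borel_measurable_indicator) auto
    interpret S: bounded_borel \<sigma> 1
      by unfold_locales (auto simp: sm \<sigma>_def indicator_def sgn_real_def)
    have bd: "(LINT x|lborel. indicator (cball 0 R) x * \<bar>v x\<bar>) \<le> C * norm h + e" if e: "e > 0" for e
    proof -
      \<comment> \<open>Replacing the sign by its mollification within L^1 distance \<open>q\<close>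
        costs at most \<open>2 * M * q\<close>, since \<open>v\<close> is bounded by
        \<open>2 * M\<close>.\<close>
      define q where "q = e / (2 * M + 1)"
      have q: "q > 0" "2 * M * q \<le> e" using e M by (auto simp: q_def field_simps)
      obtain d where d: "d > 0" "\<And>\<eta>. mollifier d \<eta> \<Longrightarrow>
          (LINT x|lborel. indicator (cball 0 (R + 1)) x * \<bar>conv \<sigma> \<eta> x - \<sigma> x\<bar>) \<le> q"
        using S.mollification_L1[OF q(1), of "R + 1"] by auto
      obtain \<eta> :: "'a \<Rightarrow> real" where m1: "mollifier (min d 1) \<eta>" using mollifier_exists[of "min d 1"] d(1) by auto
      then have m: "mollifier d \<eta>" "mollifier 1 \<eta>"
        using mollifier_mono[of "min d 1" \<eta> d] mollifier_mono[of "min d 1" \<eta> 1] by auto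
      define \<psi> where "\<psi> = conv \<sigma> \<eta>"
      have z: "\<psi> x = 0" if "norm x > R + 1" for x
      proof -
        have "\<sigma> y * \<eta> (x - y) = 0" for y
        proof (cases "norm y > R")
          case False
          then have "norm (x - y) \<ge> 1" using that norm_triangle_ineq2[of x y] by linarith
          then show ?thesis using mollifier_outside[OF m(2)] by simp
        qed (simp add: \<sigma>_def)
        then show ?thesis unfolding \<psi>_def conv_def by (simp only:) simp
      qed
      have t: "\<psi> \<in> test_functions"
        by (rule test_functionsI[of _ "R + 1"]) (use z S.smooth_conv[OF mollifier_test[OF m(1)]] \<psi>_def in auto)
      have b1: "\<bar>\<psi> x\<bar> \<le> 1" for x using S.conv_mollifier_bound[OF m(1)] by (simp add: \<psi>_def)
      have [measurable]: "\<psi> \<in> borel_measurable borel" by (rule test_borel[OF t])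
      have tr: "(\<lambda>y. \<psi> (- y)) \<in> test_functions" using test_reflect[OF t, of 0] by simp
      \<comment> \<open>With the reflected kernel, the convolution at \<open>h\<close> pairs \<psi>
        with the translate of \<open>u\<close> by \<open>h\<close>, and the convolution at 0 pairs
        \<psi> with \<open>u\<close> itself.\<close>
      have "\<bar>conv u (\<lambda>y. \<psi> (- y)) h - conv u (\<lambda>y. \<psi> (- y)) 0\<bar> \<le> C * norm h"
        by (rule C(2)[OF tr]) (use b1 z h in auto)
      moreover have "conv u (\<lambda>y. \<psi> (- y)) h = (LINT y|lborel. u (y + h) * \<psi> y)"
      proof -
        have "(\<lambda>y. u y * \<psi> (- (h - y))) \<in> borel_measurable borel" by measurable
        from integral_shift[OF this, of h] show ?thesis by (simp add: conv_def add.commute)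
      qed
      moreover have "conv u (\<lambda>y. \<psi> (- y)) 0 = (LINT y|lborel. u y * \<psi> y)"
        by (simp add: conv_def)
      moreover have iv: "integrable lborel (\<lambda>y. u (y + h) * \<psi> y)" "integrable lborel (\<lambda>y. u y * \<psi> y)"
        by (rule integrable_mult_test[OF _ bound t], measurable)+
      ultimately have 1: "\<bar>LINT y|lborel. v y * \<psi> y\<bar> \<le> C * norm h"
        unfolding v_def by (simp add: left_diff_distrib)
      have i1: "integrable lborel (\<lambda>y. v y * \<psi> y)" using iv unfolding v_def by (simp add: left_diff_distrib)
      have i2: "integrable lborel (\<lambda>y. indicator (cball 0 R) y * \<bar>v y\<bar>)"
        by (rule integrable_indicator_cball[of _ "2 * M"]) (use vb in auto)
      have i3: "integrable lborel (\<lambda>y. 2 * M * (indicator (cball 0 (R + 1)) y * \<bar>\<psi> y - \<sigma> y\<bar>))"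
      proof (intro integrable_mult_right integrable_indicator_cball[of _ 2])
        show "\<bar>\<bar>\<psi> y - \<sigma> y\<bar>\<bar> \<le> 2" for y using b1[of y] S.bound[of y] by linarith
      qed (use sm in measurable)
      have "(LINT x|lborel. indicator (cball 0 R) x * \<bar>v x\<bar>) - (LINT y|lborel. v y * \<psi> y)
          = (LINT y|lborel. indicator (cball 0 R) y * \<bar>v y\<bar> - v y * \<psi> y)"
        using i1 i2 by simp
      also have "\<dots> \<le> \<bar>\<dots>\<bar>" by simp
      also have "\<dots> \<le> (LINT y|lborel. 2 * M * (indicator (cball 0 (R + 1)) y * \<bar>\<psi> y - \<sigma> y\<bar>))"
      proof (rule abs_integral_le[OF i3])
        fix y
        have "indicator (cball 0 R) y * \<bar>v y\<bar> = v y * \<sigma> y" by (simp add: \<sigma>_def abs_sgn mult_ac)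
        then have "\<bar>indicator (cball 0 R) y * \<bar>v y\<bar> - v y * \<psi> y\<bar> = \<bar>v y\<bar> * \<bar>\<psi> y - \<sigma> y\<bar>"
          by (simp add: right_diff_distrib[symmetric] abs_mult abs_minus_commute)
        also have "\<dots> \<le> 2 * M * \<bar>\<psi> y - \<sigma> y\<bar>" using vb by (intro mult_right_mono) auto
        also have "\<dots> = 2 * M * (indicator (cball 0 (R + 1)) y * \<bar>\<psi> y - \<sigma> y\<bar>)"
          using z[of y] by (auto simp: indicator_def \<sigma>_def)
        finally show "\<bar>indicator (cball 0 R) y * \<bar>v y\<bar> - v y * \<psi> y\<bar> \<le> \<dots>" .
      qed
      also have "\<dots> = 2 * M * (LINT y|lborel. (indicator (cball 0 (R + 1)) y * \<bar>\<psi> y - \<sigma> y\<bar>))"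
        by (rule integral_mult_right_zero)
      also have "\<dots> \<le> 2 * M * q" using d(2)[OF m(1)] M by (intro mult_left_mono) (auto simp: \<psi>_def)
      finally show ?thesis using 1 q(2) by linarith
    qed
    then have "(LINT x|lborel. indicator (cball 0 R) x * \<bar>v x\<bar>) \<le> C * norm h"
      by (rule field_le_epsilon)
    then show "(LINT x|lborel. indicator (cball 0 R) x * \<bar>u (x + h) - u x\<bar>) \<le> C * norm h"
      by (simp add: v_def)
  qed
qed

end

section \<open>The fractional Laplacian kernel and the bilinear form\<close>

text \<open>The fractional Laplacian kernel without a normalising constant. At \<open>h = 0\<close>
  division by zero gives the value 0.\<close>

definition kern :: "real \<Rightarrow> 'a::euclidean_space \<Rightarrow> real" where
  "kern s h = 1 / norm h powr (real DIM('a) + 2 * s)"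

lemma kern_nonneg: "kern s h \<ge> 0" by (simp add: kern_def)

lemma kern_borel [measurable]: "kern s \<in> borel_measurable borel"
  unfolding kern_def by measurable

text \<open>Ball volumes scale like the power \<open>DIM('a)\<close> of the radius, so a series of
  multiples of ball indicators is integrated term by term. This does the work of polar coordinates
  for radial majorants.\<close>

lemma nn_integral_ball_series:
  assumes a: "\<And>k. a k \<ge> 0" "\<And>k. r k \<ge> 0" and s: "summable (\<lambda>k. a k * r k ^ DIM('a))"
  shows "(\<integral>\<^sup>+h. (\<Sum>k. ennreal (a k * indicator (cball 0 (r k)) (h :: 'a::euclidean_space))) \<partial>lborel) < \<infinity>"
proof -
  have "(\<integral>\<^sup>+h. (\<Sum>k. ennreal (a k * indicator (cball 0 (r k)) (h :: 'a))) \<partial>lborel)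
     = (\<Sum>k. \<integral>\<^sup>+h. ennreal (a k * indicator (cball 0 (r k)) (h :: 'a)) \<partial>lborel)"
    by (rule nn_integral_suminf)
       (auto intro!: measurable_compose[OF _ measurable_ennreal] borel_measurable_times borel_measurable_indicator)
  also have "\<dots> = (\<Sum>k. ennreal (unit_ball_vol (real DIM('a)) * (a k * r k ^ DIM('a))))"
  proof (intro suminf_cong)
    fix k
    have "integrable lborel (\<lambda>h::'a. a k * indicator (cball 0 (r k)) h)"
      by (intro integrable_mult_right integrable_real_indicator emeasure_lborel_cball_finite) auto
    then have "(\<integral>\<^sup>+h. ennreal (a k * indicator (cball 0 (r k)) (h :: 'a)) \<partial>lborel)
       = ennreal (LINT h|lborel. a k * indicator (cball 0 (r k)) (h :: 'a))"
      by (rule nn_integral_eq_integral) (use a in \<open>auto intro!: AE_I2\<close>)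
    then show "(\<integral>\<^sup>+h. ennreal (a k * indicator (cball 0 (r k)) (h :: 'a)) \<partial>lborel)
       = ennreal (unit_ball_vol (real DIM('a)) * (a k * r k ^ DIM('a)))"
      using a(2)[of k] by (simp add: content_cball mult_ac)
  qed
  also have "\<dots> = ennreal (\<Sum>k. unit_ball_vol (real DIM('a)) * (a k * r k ^ DIM('a)))"
    using a s by (intro suminf_ennreal2 summable_mult) auto
  finally show ?thesis by simp
qed

lemma dyadic_scale:
  fixes r :: real assumes "0 < r" "r \<le> 1"
  obtains k :: nat where "2 powr (- real k - 1) \<le> r" "r \<le> 2 powr (- real k)"
proof -
  define k where "k = nat \<lfloor>- log 2 r\<rfloor>"
  have l: "log 2 r \<le> 0" using assms by simp
  then have "real k \<le> - log 2 r" "- log 2 r \<le> real k + 1"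
    unfolding k_def by linarith+
  then have "2 powr (- real k - 1) \<le> 2 powr (log 2 r)" "2 powr (log 2 r) \<le> 2 powr (- real k)"
    by (intro powr_mono; simp)+
  then show thesis using that assms by simp
qed

text \<open>Near 0 the integrand is |h| to the power -(n - 1 + s), of order less than n because s <
  1; at infinity it is |h| to the power -(n + 2s), of order more than n because s > 0. Dyadic step
  functions bound both parts by geometric series of ratios 2^(s - 1) and 2^(-2s).\<close>

lemma kern_integrable:
  fixes s :: real assumes s: "0 < s" "s < 1"
  shows "integrable lborel (\<lambda>h::'a::euclidean_space. kern s h * min 1 (norm h powr (1 + s)))"
proof -
  let ?n = "real DIM('a)"
  have n: "?n \<ge> 1" by (simp add: Suc_leI)
  \<comment> \<open>\<open>a k\<close> is the value of the inner power at radius 2^(-k-1), the inner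
    edge of the dyadic shell, spread over the whole ball of radius 2^(-k). Likewise
    \<open>b k\<close> is the outer power at radius 2^k, spread over the ball of radius
    2^(k+1).\<close>
  define a where "a k = 2 powr ((real k + 1) * (?n - 1 + s))" for k :: nat
  define b where "b k = 2 powr (- (real k * (?n + 2 * s)))" for k :: nat
  define ra where "ra k = 2 powr (- real k)" for k :: nat
  define rb where "rb k = 2 powr (real k + 1)" for k :: nat
  have A: "a k * ra k ^ DIM('a) = 2 powr (?n - 1 + s) * (2 powr (s - 1)) ^ k" for k
    by (simp add: a_def ra_def powr_realpow[symmetric] powr_powr powr_add[symmetric] algebra_simps)
  have B: "b k * rb k ^ DIM('a) = 2 powr ?n * (2 powr (- 2 * s)) ^ k" for k
    by (simp add: b_def rb_def powr_realpow[symmetric] powr_powr powr_add[symmetric] algebra_simps)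
  have sA: "summable (\<lambda>k. a k * ra k ^ DIM('a))"
    unfolding A using s by (intro summable_mult summable_geometric) (simp add: powr_less_one)
  have sB: "summable (\<lambda>k. b k * rb k ^ DIM('a))"
    unfolding B using s by (intro summable_mult summable_geometric) (simp add: powr_less_one)
  let ?SA = "\<lambda>h::'a. (\<Sum>k. ennreal (a k * indicator (cball 0 (ra k)) h))"
  let ?SB = "\<lambda>h::'a. (\<Sum>k. ennreal (b k * indicator (cball 0 (rb k)) h))"
  have p: "ennreal (kern s h * min 1 (norm h powr (1 + s))) \<le> ?SA h + ?SB h" for h :: 'a
  proof -
    consider "h = 0" | "h \<noteq> 0" "norm h \<le> 1" | "norm h > 1" by linarith
    then show ?thesis
    proof cases
      case 1 then show ?thesis by (simp add: kern_def)
    next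
      case 2
      then obtain k where k: "2 powr (- real k - 1) \<le> norm h" "norm h \<le> ra k"
        using dyadic_scale[of "norm h"] unfolding ra_def by auto
      have "kern s h * min 1 (norm h powr (1 + s)) \<le> kern s h * norm h powr (1 + s)"
        by (intro mult_left_mono kern_nonneg) simp
      also have "\<dots> = norm h powr (- (?n - 1 + s))"
        using 2 by (simp add: kern_def powr_minus_divide[symmetric] powr_add[symmetric] algebra_simps
            flip: powr_diff)
      also have "\<dots> \<le> (2 powr (- real k - 1)) powr (- (?n - 1 + s))"
      proof (rule powr_mono2')
        show "- (?n - 1 + s) \<le> 0" using n s by linarith
      qed (use k in auto)
      also have "\<dots> = a k" by (simp add: a_def powr_powr algebra_simps)
      also have "\<dots> = a k * indicator (cball 0 (ra k)) h" using k by simp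
      finally have "ennreal (kern s h * min 1 (norm h powr (1 + s))) \<le> ennreal (a k * indicator (cball 0 (ra k)) h)"
        by (rule ennreal_leI)
      also have "\<dots> \<le> ?SA h"
        using sum_le_suminf[of "\<lambda>k. ennreal (a k * indicator (cball 0 (ra k)) h)" "{k}"] by simp
      finally show ?thesis by (simp add: add_increasing2)
    next
      case 3
      have "0 < norm h" using 3 by linarith
      then have h1: "0 < 1 / norm h" "1 / norm h \<le> 1" using 3 by auto
      obtain k where k: "2 powr (- real k - 1) \<le> 1 / norm h" "1 / norm h \<le> 2 powr (- real k)"
        using dyadic_scale[OF h1] .
      have k': "norm h \<le> rb k" "2 powr real k \<le> norm h"
        using k \<open>0 < norm h\<close> by (auto simp: rb_def powr_diff powr_minus field_simps powr_add simp flip: powr_realpow)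
      have "kern s h * min 1 (norm h powr (1 + s)) \<le> kern s h * 1"
        by (intro mult_left_mono kern_nonneg) simp
      also have "\<dots> = norm h powr (- (?n + 2 * s))" by (simp only: kern_def powr_minus_divide mult_1_right)
      also have "\<dots> \<le> (2 powr real k) powr (- (?n + 2 * s))"
        using k' s n by (intro powr_mono2') auto
      also have "\<dots> = b k" by (simp add: b_def powr_powr algebra_simps)
      also have "\<dots> = b k * indicator (cball 0 (rb k)) h" using k' by simp
      finally have "ennreal (kern s h * min 1 (norm h powr (1 + s))) \<le> ennreal (b k * indicator (cball 0 (rb k)) h)"
        by (rule ennreal_leI)
      also have "\<dots> \<le> ?SB h"
        using sum_le_suminf[of "\<lambda>k. ennreal (b k * indicator (cball 0 (rb k)) h)" "{k}"] by simp
      finally show ?thesis by (simp add: add_increasing)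
    qed
  qed
  show ?thesis
  proof (rule integrableI_bounded)
    have "(\<integral>\<^sup>+h. ennreal (norm (kern s h * min 1 (norm h powr (1 + s)))) \<partial>(lborel :: 'a measure)) \<le> (\<integral>\<^sup>+h. ?SA h + ?SB h \<partial>lborel)"
      using p by (intro nn_integral_mono) (simp add: kern_nonneg abs_mult)
    also have "\<dots> = (\<integral>\<^sup>+h. ?SA h \<partial>lborel) + (\<integral>\<^sup>+h. ?SB h \<partial>lborel)"
      by (intro nn_integral_add borel_measurable_suminf_order)
         (auto intro!: measurable_compose[OF _ measurable_ennreal] borel_measurable_times borel_measurable_indicator)
    also have "\<dots> < \<infinity>"
    proof -
      have "(\<integral>\<^sup>+h. ?SA h \<partial>lborel) < \<infinity>"
        by (rule nn_integral_ball_series[OF _ _ sA]) (simp_all add: a_def ra_def)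
      moreover have "(\<integral>\<^sup>+h. ?SB h \<partial>lborel) < \<infinity>"
        by (rule nn_integral_ball_series[OF _ _ sB]) (simp_all add: b_def rb_def)
      ultimately show ?thesis unfolding infinity_ennreal_def ennreal_add_less_top by blast
    qed
    finally show "(\<integral>\<^sup>+h. ennreal (norm (kern s h * min 1 (norm h powr (1 + s)))) \<partial>(lborel :: 'a measure)) < \<infinity>" .
  qed measurable
qed

lemma square_le_powr:
  fixes r s :: real
  assumes "s \<le> 1" "0 \<le> r" "r \<le> 1" shows "r\<^sup>2 \<le> r powr (1 + s)"
proof (cases "r = 0")
  case False
  then have "r\<^sup>2 = r powr 2" using assms by simp
  also have "\<dots> \<le> r powr (1 + s)" using assms False by (intro powr_mono') auto
  finally show ?thesis .
qed simp

section \<open>The double integral as an integral of second differences\<close>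

context bounded_borel
begin

text \<open>For small \<open>h\<close> one factor |h| comes from the L^1 translation bound of
  \<open>u\<close> and another from the Lipschitz bound of \<phi>; the product |h|^2 is below |h|^(1
  + s). For large \<open>h\<close> the sup bound of \<open>u\<close> and the L^1 norm of \<phi>
  suffice.\<close>

lemma product_difference_bound:
  assumes w: "has_weak_gradient u Du" and t: "\<phi> \<in> test_functions" and s: "0 < s" "s < 1"
  shows "\<exists>C\<ge>0. \<forall>h. (\<integral>\<^sup>+x. ennreal \<bar>(u x - u (x + h)) * (\<phi> x - \<phi> (x + h))\<bar> \<partial>lborel)
    \<le> ennreal (C * min 1 (norm h powr (1 + s)))"
proof -
  have M: "M \<ge> 0" using bound[of 0] by linarith
  have [measurable]: "\<phi> \<in> borel_measurable borel" by (rule test_borel[OF t])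
  obtain C1 where C1: "C1 > 0" "\<And>x h. \<bar>\<phi> (x + h) - \<phi> x\<bar> \<le> C1 * norm h"
    using test_difference_bounds[OF t] by metis
  obtain R where R: "\<And>x. norm x > R \<Longrightarrow> \<phi> x = 0" using test_support t by metis
  obtain C2 where C2: "C2 \<ge> 0" "\<And>h. norm h \<le> 1 \<Longrightarrow>
     (LINT x|lborel. indicator (cball 0 (R + 1)) x * \<bar>u (x + h) - u x\<bar>) \<le> C2 * norm h"
    using translation_L1_bound[OF w, of "R + 1"] by metis
  define I where "I = (LINT x|lborel. \<bar>\<phi> x\<bar>)"
  have I: "I \<ge> 0" unfolding I_def by simp
  define C where "C = C1 * C2 + 4 * M * I"
  have C: "C \<ge> 0" "C1 * C2 \<le> C" "4 * M * I \<le> C" using C1 C2 M I by (auto simp: C_def)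
  show ?thesis
  proof (intro exI[of _ C] conjI allI C(1))
    fix h :: 'a
    let ?f = "\<lambda>x. \<bar>(u x - u (x + h)) * (\<phi> x - \<phi> (x + h))\<bar>"
    have ub: "\<bar>u x - u (x + h)\<bar> \<le> 2 * M" for x using bound[of x] bound[of "x + h"] by linarith
    have ti: "integrable lborel \<phi>" "integrable lborel (\<lambda>x. \<phi> (x + h))"
      using test_integrable t test_shift by blast+
    define g where "g x = (if norm h \<le> 1 then (C1 * norm h) * (indicator (cball 0 (R + 1)) x * \<bar>u (x + h) - u x\<bar>)
        else 2 * M * (\<bar>\<phi> x\<bar> + \<bar>\<phi> (x + h)\<bar>))" for x
    have gi: "integrable lborel g"
    proof (cases "norm h \<le> 1")
      case True
      have "integrable lborel (\<lambda>x. indicator (cball 0 (R + 1)) x * \<bar>u (x + h) - u x\<bar>)"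
        by (rule integrable_indicator_cball[of _ "2 * M"])
           (use ub in \<open>auto simp: abs_minus_commute\<close>)
      then show ?thesis using True unfolding g_def by simp
    next
      case False
      then show ?thesis using ti unfolding g_def by simp
    qed
    have fg: "?f x \<le> g x" for x
    proof (cases "norm h \<le> 1")
      case True
      show ?thesis
      proof (cases "norm x > R + 1")
        case True
        then have "norm (x + h) > R" using \<open>norm h \<le> 1\<close> norm_triangle_ineq4[of "x + h" h] by simp
        then have "\<phi> x = 0" "\<phi> (x + h) = 0" using R True by auto
        then show ?thesis using \<open>norm h \<le> 1\<close> C1 by (simp add: g_def)
      next
        case False
        have "?f x \<le> \<bar>u x - u (x + h)\<bar> * (C1 * norm h)"
          unfolding abs_mult using C1(2)[of x h] by (intro mult_left_mono) (auto simp: abs_minus_commute)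
        then show ?thesis using False True by (simp add: g_def abs_minus_commute mult_ac)
      qed
    next
      case False
      have "?f x \<le> (2 * M) * (\<bar>\<phi> x\<bar> + \<bar>\<phi> (x + h)\<bar>)"
        unfolding abs_mult using ub M by (intro mult_mono) auto
      then show ?thesis using False by (simp add: g_def)
    qed
    have gI: "(LINT x|lborel. g x) \<le> C * min 1 (norm h powr (1 + s))"
    proof (cases "norm h \<le> 1")
      case True
      have "(LINT x|lborel. g x) = (C1 * norm h) * (LINT x|lborel. indicator (cball 0 (R + 1)) x * \<bar>u (x + h) - u x\<bar>)"
        unfolding g_def using True by simp
      also have "\<dots> \<le> (C1 * norm h) * (C2 * norm h)"
        using C1 C2(2)[OF True] by (intro mult_left_mono) auto
      also have "\<dots> = (C1 * C2) * (norm h)\<^sup>2" by (simp add: power2_eq_square mult_ac)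
      also have "\<dots> \<le> C * norm h powr (1 + s)"
        using C C1 C2 True s by (intro mult_mono square_le_powr) auto
      also have "\<dots> = C * min 1 (norm h powr (1 + s))"
        using True s powr_le1[of "1 + s" "norm h"] by simp
      finally show ?thesis .
    next
      case False
      have "(LINT x|lborel. \<bar>\<phi> (x + h)\<bar>) = I"
        unfolding I_def using integral_shift[of "\<lambda>x. \<bar>\<phi> x\<bar>" h] by (simp add: add.commute)
      then have "(LINT x|lborel. g x) = 4 * M * I"
        unfolding g_def using False ti by (simp add: I_def)
      also have "\<dots> \<le> C * min 1 (norm h powr (1 + s))"
        using C False s ge_one_powr_ge_zero[of "norm h" "1 + s"] by simp
      finally show ?thesis .
    qed
    have "(\<integral>\<^sup>+x. ennreal (?f x) \<partial>lborel) \<le> (\<integral>\<^sup>+x. ennreal (g x) \<partial>lborel)"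
      by (intro nn_integral_mono ennreal_leI fg)
    also have "\<dots> = ennreal (LINT x|lborel. g x)"
      using fg by (intro nn_integral_eq_integral gi AE_I2) (meson abs_ge_zero order_trans)
    also have "\<dots> \<le> ennreal (C * min 1 (norm h powr (1 + s)))" by (rule ennreal_leI[OF gI])
    finally show "(\<integral>\<^sup>+x. ennreal (?f x) \<partial>lborel) \<le> ennreal (C * min 1 (norm h powr (1 + s)))" .
  qed
qed

text \<open>A discrete integration by parts: expanding the product and translating moves every shift
  onto \<phi>, where the four terms combine into a second difference.\<close>

lemma integral_product_difference:
  assumes t: "\<phi> \<in> test_functions"
  shows "(LINT x|lborel. (u x - u (x + h)) * (\<phi> x - \<phi> (x + h))) = - (LINT x|lborel. u x * diff2 \<phi> h x)"
proof -
  have [measurable]: "\<phi> \<in> borel_measurable borel" by (rule test_borel[OF t])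
  note tp = test_shift[OF t, of h] and tm = test_shift[OF t, of "- h"]
  interpret U: bounded_borel "\<lambda>x. u (x + h)" M by unfold_locales (use bound in auto)
  note i = integrable_mult_test[OF borel bound t] integrable_mult_test[OF borel bound tp]
    integrable_mult_test[OF borel bound tm]
    integrable_mult_test[OF U.borel U.bound t] integrable_mult_test[OF U.borel U.bound tp]
  have 1: "(LINT x|lborel. u (x + h) * \<phi> (x + h)) = (LINT x|lborel. u x * \<phi> x)"
    using integral_shift[of "\<lambda>x. u x * \<phi> x" h] by (simp add: add.commute)
  have 2: "(LINT x|lborel. u (x + h) * \<phi> x) = (LINT x|lborel. u x * \<phi> (x - h))"
    using integral_shift[of "\<lambda>x. u x * \<phi> (x - h)" h] by (simp add: add.commute)
  have "(LINT x|lborel. (u x - u (x + h)) * (\<phi> x - \<phi> (x + h)))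
     = (LINT x|lborel. u x * \<phi> x - u x * \<phi> (x + h) - u (x + h) * \<phi> x + u (x + h) * \<phi> (x + h))"
    by (intro Bochner_Integration.integral_cong) (auto simp: algebra_simps)
  also have "\<dots> = (LINT x|lborel. u x * \<phi> x) - (LINT x|lborel. u x * \<phi> (x + h))
      - (LINT x|lborel. u x * \<phi> (x - h)) + (LINT x|lborel. u x * \<phi> x)"
    using i by (simp add: 1 2)
  also have "\<dots> = - (LINT x|lborel. u x * \<phi> (x + h) + u x * \<phi> (x - h) - 2 * (u x * \<phi> x))"
    using i by simp
  finally show ?thesis by (simp add: diff2_def algebra_simps)
qed

text \<open>Tonelli in the coordinates \<open>(x, h) = (x, y - x)\<close> gives absolute convergence; the weak
  gradient compensates the singularity of the kernel when \<open>s \<ge> 1/2\<close>.\<close>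

lemma bilinear_form_eq:
  assumes w: "has_weak_gradient u Du" and t: "\<phi> \<in> test_functions" and s: "0 < s" "s < 1"
  shows "(LINT z|(lborel :: ('a \<times> 'a) measure). (u (fst z) - u (snd z)) * (\<phi> (fst z) - \<phi> (snd z))
      / norm (fst z - snd z) powr (real DIM('a) + 2 * s))
    = - (LINT h|lborel. kern s h * (LINT x|lborel. u x * diff2 \<phi> h x))"
proof -
  have [measurable]: "\<phi> \<in> borel_measurable borel" by (rule test_borel[OF t])
  define F where "F x y = (u x - u y) * (\<phi> x - \<phi> y) * kern s (y - x)" for x y
  define G where "G x h = (u x - u (x + h)) * (\<phi> x - \<phi> (x + h)) * kern s h" for x h
  have FG: "F x (x + h) = G x h" for x h by (simp add: F_def G_def)
  have Fm: "case_prod F \<in> borel_measurable (lborel \<Otimes>\<^sub>M lborel)" unfolding F_def by measurable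
  have Gm: "case_prod G \<in> borel_measurable (lborel \<Otimes>\<^sub>M lborel)" unfolding G_def by measurable
  have Fx: "F x \<in> borel_measurable borel" for x unfolding F_def by measurable
  obtain C where C: "C \<ge> 0" "\<And>h. (\<integral>\<^sup>+x. ennreal \<bar>(u x - u (x + h)) * (\<phi> x - \<phi> (x + h))\<bar> \<partial>lborel)
    \<le> ennreal (C * min 1 (norm h powr (1 + s)))"
    using product_difference_bound[OF w t s] by metis
  have "(\<integral>\<^sup>+h. (\<integral>\<^sup>+x. ennreal (norm (G x h)) \<partial>lborel) \<partial>lborel)
      \<le> (\<integral>\<^sup>+h. ennreal (C * (kern s h * min 1 (norm h powr (1 + s)))) \<partial>(lborel :: 'a measure))"
  proof (intro nn_integral_mono)
    fix h :: 'a
    have "(\<integral>\<^sup>+x. ennreal (norm (G x h)) \<partial>lborel)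
        = (\<integral>\<^sup>+x. ennreal (kern s h) * ennreal \<bar>(u x - u (x + h)) * (\<phi> x - \<phi> (x + h))\<bar> \<partial>lborel)"
      by (intro nn_integral_cong)
         (simp add: G_def abs_mult kern_nonneg ennreal_mult[symmetric] mult_ac)
    also have "\<dots> = ennreal (kern s h) * (\<integral>\<^sup>+x. ennreal \<bar>(u x - u (x + h)) * (\<phi> x - \<phi> (x + h))\<bar> \<partial>lborel)"
      by (rule nn_integral_cmult) measurable
    also have "\<dots> \<le> ennreal (kern s h) * ennreal (C * min 1 (norm h powr (1 + s)))"
      by (intro mult_left_mono C) simp
    also have "\<dots> = ennreal (C * (kern s h * min 1 (norm h powr (1 + s))))"
      using C(1) kern_nonneg[of s h] by (simp add: ennreal_mult[symmetric] mult_ac)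
    finally show "(\<integral>\<^sup>+x. ennreal (norm (G x h)) \<partial>lborel)
      \<le> ennreal (C * (kern s h * min 1 (norm h powr (1 + s))))" .
  qed
  also have "\<dots> < \<infinity>"
  proof -
    have "integrable lborel (\<lambda>h::'a. C * (kern s h * min 1 (norm h powr (1 + s))))"
      by (intro integrable_mult_right kern_integrable s)
    then show ?thesis
      using C(1) by (subst nn_integral_eq_integral) (auto simp: kern_nonneg)
  qed
  finally have fin: "(\<integral>\<^sup>+h. (\<integral>\<^sup>+x. ennreal (norm (G x h)) \<partial>lborel) \<partial>lborel) < \<infinity>" .
  have sw: "(\<integral>\<^sup>+h. (\<integral>\<^sup>+x. ennreal (norm (G x h)) \<partial>lborel) \<partial>lborel)
      = (\<integral>\<^sup>+x. (\<integral>\<^sup>+h. ennreal (norm (G x h)) \<partial>lborel) \<partial>lborel)"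
    by (rule lborel_pair.Fubini') (use Gm in \<open>simp add: split_def\<close>)
  have Gi: "integrable (lborel \<Otimes>\<^sub>M lborel) (case_prod G)"
  proof (rule integrableI_bounded[OF Gm])
    have "(\<integral>\<^sup>+z. ennreal (norm (case_prod G z)) \<partial>(lborel \<Otimes>\<^sub>M lborel))
       = (\<integral>\<^sup>+x. (\<integral>\<^sup>+h. ennreal (norm (G x h)) \<partial>lborel) \<partial>lborel)"
      using Gm by (subst lborel.nn_integral_fst[symmetric]) auto
    then show "(\<integral>\<^sup>+z. ennreal (norm (case_prod G z)) \<partial>(lborel \<Otimes>\<^sub>M lborel)) < \<infinity>" using fin sw by simp
  qed
  have Fi: "integrable (lborel \<Otimes>\<^sub>M lborel) (case_prod F)"
  proof (rule integrableI_bounded[OF Fm])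
    have "(\<integral>\<^sup>+z. ennreal (norm (case_prod F z)) \<partial>(lborel \<Otimes>\<^sub>M lborel))
       = (\<integral>\<^sup>+x. (\<integral>\<^sup>+y. ennreal (norm (F x y)) \<partial>lborel) \<partial>lborel)"
      using Fm by (subst lborel.nn_integral_fst[symmetric]) auto
    also have "\<dots> = (\<integral>\<^sup>+x. (\<integral>\<^sup>+h. ennreal (norm (G x h)) \<partial>lborel) \<partial>lborel)"
    proof (rule nn_integral_cong)
      fix x :: 'a
      have "(\<lambda>y. ennreal (norm (F x y))) \<in> borel_measurable borel" using Fx[of x] by measurable
      from nn_integral_shift[OF this, of x]
      show "(\<integral>\<^sup>+y. ennreal (norm (F x y)) \<partial>lborel) = (\<integral>\<^sup>+h. ennreal (norm (G x h)) \<partial>lborel)"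
        by (simp only: FG)
    qed
    finally show "(\<integral>\<^sup>+z. ennreal (norm (case_prod F z)) \<partial>(lborel \<Otimes>\<^sub>M lborel)) < \<infinity>" using fin sw by simp
  qed
  have inner: "(LINT x|lborel. G x h) = - (kern s h * (LINT x|lborel. u x * diff2 \<phi> h x))" for h
  proof -
    have "(LINT x|lborel. G x h) = (LINT x|lborel. (u x - u (x + h)) * (\<phi> x - \<phi> (x + h))) * kern s h"
      unfolding G_def by (rule integral_mult_left_zero)
    then show ?thesis by (simp add: integral_product_difference[OF t])
  qed
  have "(LINT z|(lborel :: ('a \<times> 'a) measure). (u (fst z) - u (snd z)) * (\<phi> (fst z) - \<phi> (snd z))
      / norm (fst z - snd z) powr (real DIM('a) + 2 * s)) = (LINT z|(lborel \<Otimes>\<^sub>M lborel). case_prod F z)"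
    unfolding lborel_prod F_def kern_def by (simp add: split_def norm_minus_commute)
  also have "\<dots> = (LINT x|lborel. (LINT y|lborel. F x y))"
    using lborel_pair.integral_fst'[OF Fi] by simp
  also have "\<dots> = (LINT x|lborel. (LINT h|lborel. G x h))"
    using integral_shift[OF Fx] by (simp only: FG[symmetric])
  also have "\<dots> = (LINT h|lborel. (LINT x|lborel. G x h))"
    by (rule lborel_pair.Fubini_integral[OF Gi, symmetric])
  also have "\<dots> = (LINT h|lborel. - (kern s h * (LINT x|lborel. u x * diff2 \<phi> h x)))"
    by (simp only: inner)
  also have "\<dots> = - (LINT h|lborel. kern s h * (LINT x|lborel. u x * diff2 \<phi> h x))" by simp
  finally show ?thesis .
qed

end

section \<open>Averaging kernels\<close>

lemma partial_mult:
  assumes "smooth f" "smooth g"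
  shows "partial b (\<lambda>x. f x * g x) x = f x * partial b g x + partial b f x * g x"
proof -
  have "(f has_derivative frechet_derivative f (at x)) (at x)"
    "(g has_derivative frechet_derivative g (at x)) (at x)"
    using assms Ck_Suc_has_derivative unfolding smooth_def by blast+
  from partial_eqI[OF has_derivative_mult[OF this]] show ?thesis by (simp add: partial_def)
qed

lemma partial_bump: "partial b (bump j e) x = - (2 / e\<^sup>2) * (x \<bullet> b) * bump (Suc j) e x"
proof -
  have "((\<lambda>x. 1 - c * (x \<bullet> x)) has_derivative (\<lambda>h. - (2 * c) * (x \<bullet> h))) (at x)" for c
    by (auto intro!: derivative_eq_intros simp: inner_commute)
  from has_derivative_compose[OF this[of "1 / e\<^sup>2"] flats_deriv[of j, unfolded has_field_derivative_def]]
  have "(bump j e has_derivative (\<lambda>h. flats (Suc j) (1 - (1 / e\<^sup>2) * (x \<bullet> x)) * (- (2 * (1 / e\<^sup>2)) * (x \<bullet> h)))) (at x)"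
    unfolding bump_def .
  from partial_eqI[OF this] show ?thesis by (simp add: bump_def)
qed

text \<open>The gradient of \<open>bump 0 1\<close> at z is -2 z times \<open>bump 1 1\<close>. With
  \<open>c\<close> the integral of \<open>bump 1 1\<close>, dividing the latter by \<open>c\<close>
  gives unit mass, and dividing \<open>bump 0 1\<close> by \<open>2 * c\<close> absorbs the factor
  2.\<close>

lemma averaging_kernels_exist:
  "\<exists>\<rho> \<psi> :: 'a::euclidean_space \<Rightarrow> real. mollifier 1 \<rho> \<and> \<psi> \<in> test_functions \<and>
     (\<forall>b\<in>Basis. \<forall>z. partial b \<psi> z = - (z \<bullet> b) * \<rho> z)"
proof -
  define c where "c = (LINT x|lborel. bump 1 1 (x :: 'a))"
  have c: "c > 0" unfolding c_def by (rule integral_bump_pos[OF _ flats_1_pos flats_1_nonneg]) simp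
  define \<rho> where "\<rho> x = bump 1 1 (x :: 'a) * (1 / c)" for x
  define \<psi> where "\<psi> x = bump 0 1 (x :: 'a) * (1 / (2 * c))" for x
  have "\<rho> \<in> test_functions" "\<psi> \<in> test_functions"
    unfolding \<rho>_def \<psi>_def by (intro test_mult bump_test smooth_const, simp)+
  moreover have "(LINT x|lborel. \<rho> x) = 1"
  proof -
    have "(LINT x|lborel. \<rho> x) = (LINT x|lborel. bump 1 1 (x :: 'a)) * (1 / c)"
      unfolding \<rho>_def by (rule integral_mult_left_zero)
    then show ?thesis using c unfolding c_def by simp
  qed
  moreover have "\<rho> x \<ge> 0" for x
    using c flats_1_nonneg by (simp add: \<rho>_def bump_def)
  moreover have "\<rho> x = 0" if "norm x \<ge> 1" for x
    using bump_outside[OF _ that, of 1] by (simp add: \<rho>_def)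
  moreover have "partial b \<psi> z = - (z \<bullet> b) * \<rho> z" for b z
  proof -
    have "partial b \<psi> z = partial b (bump 0 1) z * (1 / (2 * c))"
      unfolding \<psi>_def using partial_mult[OF bump_smooth smooth_const, of b 0 1 "1 / (2 * c)" z]
      by (simp add: partial_eqI[OF has_derivative_const])
    then show ?thesis by (simp add: partial_bump \<rho>_def)
  qed
  ultimately show ?thesis unfolding mollifier_def by blast
qed

text \<open>The bounds must hold for every step, since \<open>k\<close> will be h / t with t
  arbitrarily small. For \<open>norm k \<le> 1\<close> the differences are small pointwise on a
  fixed ball; for larger \<open>k\<close> the triangle inequality is used, and on the support the
  weight \<open>1 + norm z\<close> is at most \<open>(R + 2) * norm k\<close>. The constant
  \<open>K\<close> adds up all cases.\<close>

lemma kernel_difference_L1: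
  fixes \<kappa> :: "'a::euclidean_space \<Rightarrow> real"
  assumes t: "\<kappa> \<in> test_functions"
  shows "\<exists>K>0. \<forall>k. (LINT z|lborel. \<bar>\<kappa> (z + k) - \<kappa> z\<bar>) \<le> K * norm k \<and>
    (LINT z|lborel. \<bar>diff2 \<kappa> k z\<bar> * (1 + norm z)) \<le> K * (norm k)\<^sup>2 \<and>
    (LINT z|lborel. \<bar>diff2 \<kappa> k z\<bar>) \<le> K"
proof -
  obtain C where C: "C > 0" "\<And>x. \<bar>\<kappa> x\<bar> \<le> C" "\<And>x h. \<bar>\<kappa> (x + h) - \<kappa> x\<bar> \<le> C * norm h"
    "\<And>x h. \<bar>diff2 \<kappa> h x\<bar> \<le> C * (norm h)\<^sup>2"
    by (rule test_difference_bounds[OF t]) blast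
  obtain R where R: "R > 0" "\<And>x. norm x > R \<Longrightarrow> \<kappa> x = 0" by (rule test_support[OF t]) blast
  define V where "V = measure lborel (cball 0 (R + 1) :: 'a set)"
  have V: "V \<ge> 0" by (simp add: V_def)
  define I where "I = (LINT z|lborel. \<bar>\<kappa> z\<bar>)"
  have I: "I \<ge> 0" unfolding I_def by simp
  have [measurable]: "\<kappa> \<in> borel_measurable borel" by (rule test_borel[OF t])
  have i: "integrable lborel (\<lambda>z. \<bar>\<kappa> (z + k)\<bar>)" for k
    by (intro integrable_abs test_integrable test_shift t)
  have iI: "(LINT z|lborel. \<bar>\<kappa> (z + k)\<bar>) = I" for k
    unfolding I_def using integral_shift[of "\<lambda>x. \<bar>\<kappa> x\<bar>" k] by (simp add: add.commute)
  define K where "K = C * V + C * (R + 2) * V + 4 * (R + 2) * I + 4 * I + 1"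
  have K: "K > 0" "C * V \<le> K" "C * (R + 2) * V \<le> K" "4 * (R + 2) * I \<le> K" "4 * I \<le> K"
    using C(1) V I R(1) by (auto simp: K_def intro!: add_nonneg_pos add_nonneg_nonneg)
  have z0: "\<kappa> (z + k) = 0" "\<kappa> z = 0" if "norm z > R + norm k" for z k
  proof -
    have "norm z \<le> norm (z + k) + norm k" using norm_triangle_ineq4[of "z + k" k] by simp
    moreover have "norm k \<ge> 0" by simp
    ultimately show "\<kappa> (z + k) = 0" "\<kappa> z = 0" using R(2)[of z] R(2)[of "z + k"] that by linarith+
  qed
  have d0: "diff2 \<kappa> k z = 0" if "norm z > R + norm k" for z k
    using z0[of k z] z0[of "- k" z] that by (simp add: diff2_def)
  show ?thesis
  proof (intro exI[of _ K] conjI allI K(1))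
    fix k :: 'a
    show "(LINT z|lborel. \<bar>\<kappa> (z + k) - \<kappa> z\<bar>) \<le> K * norm k"
    proof (cases "norm k \<le> 1")
      case True
      have "\<bar>LINT z|lborel. \<bar>\<kappa> (z + k) - \<kappa> z\<bar>\<bar> \<le> (C * norm k) * measure lborel (cball 0 (R + 1) :: 'a set)"
        by (rule integral_bounded_support[where a=0]) (use C(3) z0[of k] True in auto)
      also have "\<dots> = (C * V) * norm k" by (simp add: V_def)
      also have "\<dots> \<le> K * norm k" by (intro mult_right_mono K) auto
      finally show ?thesis by linarith
    next
      case False
      have "(LINT z|lborel. \<bar>\<kappa> (z + k) - \<kappa> z\<bar>) \<le> \<bar>(LINT z|lborel. \<bar>\<kappa> (z + k) - \<kappa> z\<bar>)\<bar>" by (rule abs_ge_self)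
      also have "\<dots> \<le> (LINT z|lborel. \<bar>\<kappa> (z + k)\<bar> + \<bar>\<kappa> (z + 0)\<bar>)"
        by (rule abs_integral_le) (use i[of k] i[of 0] in auto)
      also have "\<dots> = 2 * I"
        using i[of k] i[of 0] by (subst Bochner_Integration.integral_add) (auto simp: iI iI[of 0, simplified])
      also have "\<dots> \<le> 4 * I" using I by simp
      also have "\<dots> \<le> K * 1" using K by simp
      also have "\<dots> \<le> K * norm k" using False K(1) by (intro mult_left_mono) auto
      finally show ?thesis .
    qed
    have d3: "\<bar>diff2 \<kappa> k z\<bar> \<le> \<bar>\<kappa> (z + k)\<bar> + \<bar>\<kappa> (z + - k)\<bar> + 2 * \<bar>\<kappa> (z + 0)\<bar>" for z
      unfolding diff2_def by simp
    have i3: "integrable lborel (\<lambda>z. \<bar>\<kappa> (z + k)\<bar> + \<bar>\<kappa> (z + - k)\<bar> + 2 * \<bar>\<kappa> (z + 0)\<bar>)"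
      by (intro Bochner_Integration.integrable_add integrable_mult_right i)
    have e3: "(LINT z|lborel. \<bar>\<kappa> (z + k)\<bar> + \<bar>\<kappa> (z + - k)\<bar> + 2 * \<bar>\<kappa> (z + 0)\<bar>) = 4 * I"
      using i[of k] i[of "- k"] i[of 0] iI[of k] iI[of "- k"] iI[of 0] by simp
    have "(LINT z|lborel. \<bar>diff2 \<kappa> k z\<bar>) \<le> \<bar>(LINT z|lborel. \<bar>diff2 \<kappa> k z\<bar>)\<bar>" by (rule abs_ge_self)
    also have "\<dots> \<le> 4 * I" unfolding e3[symmetric] by (rule abs_integral_le[OF i3]) (use d3 in simp)
    finally show "(LINT z|lborel. \<bar>diff2 \<kappa> k z\<bar>) \<le> K" using K by linarith
    show "(LINT z|lborel. \<bar>diff2 \<kappa> k z\<bar> * (1 + norm z)) \<le> K * (norm k)\<^sup>2"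
    proof (cases "norm k \<le> 1")
      case True
      have "\<bar>LINT z|lborel. \<bar>diff2 \<kappa> k z\<bar> * (1 + norm z)\<bar> \<le> (C * (norm k)\<^sup>2 * (R + 2)) * measure lborel (cball 0 (R + 1) :: 'a set)"
      proof (rule integral_bounded_support[where a=0])
        fix z :: 'a
        show "\<bar>\<bar>diff2 \<kappa> k z\<bar> * (1 + norm z)\<bar> \<le> C * (norm k)\<^sup>2 * (R + 2)"
        proof (cases "norm z > R + 1")
          case True then show ?thesis using d0[of k z] \<open>norm k \<le> 1\<close> C(1) R(1) by simp
        next
          case False
          then show ?thesis using C(1,4) by (auto simp: abs_mult intro!: mult_mono)
        qed
        show "norm (z - 0) > R + 1 \<Longrightarrow> \<bar>diff2 \<kappa> k z\<bar> * (1 + norm z) = 0"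
          using d0[of k z] True by simp
      qed
      also have "\<dots> = (C * (R + 2) * V) * (norm k)\<^sup>2" by (simp add: V_def)
      also have "\<dots> \<le> K * (norm k)\<^sup>2" by (intro mult_right_mono K) auto
      finally show ?thesis by linarith
    next
      case False
      have "(LINT z|lborel. \<bar>diff2 \<kappa> k z\<bar> * (1 + norm z)) \<le> \<bar>(LINT z|lborel. \<bar>diff2 \<kappa> k z\<bar> * (1 + norm z))\<bar>" by (rule abs_ge_self)
      also have "\<dots> \<le> (LINT z|lborel. ((R + 2) * norm k) * (\<bar>\<kappa> (z + k)\<bar> + \<bar>\<kappa> (z + - k)\<bar> + 2 * \<bar>\<kappa> (z + 0)\<bar>))"
      proof (rule abs_integral_le[OF integrable_mult_right[OF i3]])
        fix z :: 'a
        show "\<bar>\<bar>diff2 \<kappa> k z\<bar> * (1 + norm z)\<bar> \<le> ((R + 2) * norm k) * (\<bar>\<kappa> (z + k)\<bar> + \<bar>\<kappa> (z + - k)\<bar> + 2 * \<bar>\<kappa> (z + 0)\<bar>)"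
        proof (cases "norm z > R + norm k")
          case True then show ?thesis using d0[OF True] R(1) by simp
        next
          case False
          have "R \<le> R * norm k" using R(1) \<open>\<not> norm k \<le> 1\<close> by simp
          then have "1 + norm z \<le> (R + 2) * norm k"
            using False \<open>\<not> norm k \<le> 1\<close> by (simp add: algebra_simps)
          then have "\<bar>\<bar>diff2 \<kappa> k z\<bar> * (1 + norm z)\<bar> \<le> \<bar>diff2 \<kappa> k z\<bar> * ((R + 2) * norm k)"
            by (simp add: abs_mult mult_left_mono)
          also have "\<dots> \<le> (\<bar>\<kappa> (z + k)\<bar> + \<bar>\<kappa> (z + - k)\<bar> + 2 * \<bar>\<kappa> (z + 0)\<bar>) * ((R + 2) * norm k)"
            using R(1) by (intro mult_right_mono d3) auto
          finally show ?thesis by (simp add: mult_ac)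
        qed
      qed
      also have "\<dots> = ((R + 2) * norm k) * (4 * I)" by (simp only: integral_mult_right_zero e3)
      also have "\<dots> = (4 * (R + 2) * I) * norm k" by simp
      also have "\<dots> \<le> K * (norm k)\<^sup>2"
        using False K self_le_power[of "norm k" 2] by (intro mult_mono) auto
      finally show ?thesis .
    qed
  qed
qed

text \<open>One constant \<open>K\<close> serves both kernels. The weighted bound is for Hoelder
  continuous functions, where the weight absorbs growth in z; the unweighted bound by
  \<open>K\<close> alone allows interpolation to the order 1 + s.\<close>

locale averaging_kernels =
  fixes \<rho> \<psi> :: "'a::euclidean_space \<Rightarrow> real" and K :: real
  assumes rho: "mollifier 1 \<rho>" and psi: "\<psi> \<in> test_functions"
    and partial_psi: "\<And>b z. b \<in> Basis \<Longrightarrow> partial b \<psi> z = - (z \<bullet> b) * \<rho> z"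
    and K: "K > 0" "\<And>\<kappa> k. \<kappa> \<in> {\<rho>, \<psi>} \<Longrightarrow> (LINT z|lborel. \<bar>\<kappa> (z + k) - \<kappa> z\<bar>) \<le> K * norm k"
      "\<And>\<kappa> k. \<kappa> \<in> {\<rho>, \<psi>} \<Longrightarrow> (LINT z|lborel. \<bar>diff2 \<kappa> k z\<bar> * (1 + norm z)) \<le> K * (norm k)\<^sup>2"
      "\<And>\<kappa> k. \<kappa> \<in> {\<rho>, \<psi>} \<Longrightarrow> (LINT z|lborel. \<bar>diff2 \<kappa> k z\<bar>) \<le> K"

lemma averaging_kernels_ex: "\<exists>\<rho> \<psi> :: 'a::euclidean_space \<Rightarrow> real. \<exists>K. averaging_kernels \<rho> \<psi> K"
proof -
  obtain \<rho> \<psi> :: "'a \<Rightarrow> real" where *: "mollifier 1 \<rho>" "\<psi> \<in> test_functions"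
     "\<And>b z. b \<in> Basis \<Longrightarrow> partial b \<psi> z = - (z \<bullet> b) * \<rho> z"
    using averaging_kernels_exist by metis
  obtain K1 where K1: "K1 > 0" "\<And>k. (LINT z|lborel. \<bar>\<rho> (z + k) - \<rho> z\<bar>) \<le> K1 * norm k"
    "\<And>k. (LINT z|lborel. \<bar>diff2 \<rho> k z\<bar> * (1 + norm z)) \<le> K1 * (norm k)\<^sup>2"
    "\<And>k. (LINT z|lborel. \<bar>diff2 \<rho> k z\<bar>) \<le> K1"
    using kernel_difference_L1[OF mollifier_test[OF *(1)]] by blast
  obtain K2 where K2: "K2 > 0" "\<And>k. (LINT z|lborel. \<bar>\<psi> (z + k) - \<psi> z\<bar>) \<le> K2 * norm k"
    "\<And>k. (LINT z|lborel. \<bar>diff2 \<psi> k z\<bar> * (1 + norm z)) \<le> K2 * (norm k)\<^sup>2"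
    "\<And>k. (LINT z|lborel. \<bar>diff2 \<psi> k z\<bar>) \<le> K2"
    using kernel_difference_L1[OF *(2)] by blast
  have m: "a \<le> (K1 + K2) * c" if "a \<le> K1 * c \<or> a \<le> K2 * c" "c \<ge> 0" for a c :: real
  proof -
    have "0 \<le> K1 * c" "0 \<le> K2 * c" using that(2) K1(1) K2(1) by auto
    then show ?thesis using that(1) by (simp only: distrib_right) linarith
  qed
  have "averaging_kernels \<rho> \<psi> (K1 + K2)"
  proof (unfold_locales)
    fix \<kappa> :: "'a \<Rightarrow> real" and k :: 'a assume \<kappa>: "\<kappa> \<in> {\<rho>, \<psi>}"
    show "(LINT z|lborel. \<bar>\<kappa> (z + k) - \<kappa> z\<bar>) \<le> (K1 + K2) * norm k"
      by (rule m) (use \<kappa> K1(2) K2(2) in auto)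
    show "(LINT z|lborel. \<bar>diff2 \<kappa> k z\<bar> * (1 + norm z)) \<le> (K1 + K2) * (norm k)\<^sup>2"
      by (rule m) (use \<kappa> K1(3) K2(3) in auto)
    show "(LINT z|lborel. \<bar>diff2 \<kappa> k z\<bar>) \<le> K1 + K2"
      using \<kappa> K1(1,4) K2(1,4) by (auto intro: add_increasing2 add_increasing less_imp_le)
  qed (use * K1(1) K2(1) in auto)
  then show ?thesis by blast
qed

text \<open>The bound is qualitative: it may depend on the mollifier. It justifies differentiating
  averages and starts the absorption argument, and it does not occur in any final constant.\<close>

definition bounded_C2 :: "('a::euclidean_space \<Rightarrow> real) \<Rightarrow> bool" where
  "bounded_C2 w \<longleftrightarrow> smooth w \<and> (\<exists>C. \<forall>x. \<bar>w x\<bar> \<le> C \<and> (\<forall>b\<in>Basis. \<bar>partial b w x\<bar> \<le> C \<and>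
     (\<forall>c\<in>Basis. \<bar>partial c (partial b w) x\<bar> \<le> C)))"

lemma (in bounded_borel) bounded_C2_conv:
  assumes t: "\<phi> \<in> test_functions" shows "bounded_C2 (conv u \<phi>)"
proof -
  have M: "M \<ge> 0" using bound[of 0] by linarith
  define J where "J f = (LINT y|lborel. \<bar>f y\<bar>)" for f :: "'a \<Rightarrow> real"
  define S where "S = insert \<phi> ((\<lambda>b. partial b \<phi>) ` Basis \<union> (\<lambda>(b,c). partial c (partial b \<phi>)) ` (Basis \<times> Basis))"
  have f: "finite S" by (simp add: S_def)
  have tS: "f \<in> test_functions" if "f \<in> S" for f
    using that t test_partial by (auto simp: S_def)
  have J: "J f \<ge> 0" for f unfolding J_def by simp
  have *: "\<bar>conv u f x\<bar> \<le> M * sum J S" if "f \<in> S" for f x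
  proof -
    have "\<bar>conv u f x\<bar> \<le> M * J f" unfolding J_def by (rule conv_bound[OF tS[OF that]])
    also have "\<dots> \<le> M * sum J S" using M J f that by (intro mult_left_mono member_le_sum) auto
    finally show ?thesis .
  qed
  have p1: "partial b (conv u \<phi>) = conv u (partial b \<phi>)" if "b \<in> Basis" for b
    using partial_conv[OF t that] by blast
  have p2: "partial c (partial b (conv u \<phi>)) = conv u (partial c (partial b \<phi>))" if "b \<in> Basis" "c \<in> Basis" for b c
    unfolding p1[OF that(1)] using partial_conv[OF test_partial[OF t that(1)] that(2)] by blast
  show ?thesis
    unfolding bounded_C2_def
    using * p1 p2 by (intro conjI smooth_conv t exI[of _ "M * sum J S"]) (auto simp: S_def)
qed

section \<open>Averages at scale t and their derivative in t\<close>

context averaging_kernels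
begin

definition avg :: "('a \<Rightarrow> real) \<Rightarrow> 'a \<Rightarrow> real \<Rightarrow> real" where
  "avg w x t = (LINT z|lborel. \<rho> z * w (x - t *\<^sub>R z))"

lemma integrable_test_affine:
  assumes "\<kappa> \<in> test_functions" "smooth g"
  shows "integrable lborel (\<lambda>z::'a. \<kappa> z * g (x - t *\<^sub>R z))"
  using test_integrable[OF test_mult[OF assms(1) smooth_affine[OF assms(2), of x "- t"]]] by simp

lemma rho_test: "\<rho> \<in> test_functions" using mollifier_test[OF rho] .

text \<open>Integration by parts: the radial derivative of the average is a Laplacian because
  \<open>z \<rho>(z)\<close> is the gradient of \<open>- \<psi>\<close>.\<close>

lemma avg_derivative_formula:
  assumes w: "smooth w"
  shows "(LINT z|lborel. \<rho> z * (\<Sum>b\<in>Basis. - (z \<bullet> b) * partial b w (x - t *\<^sub>R z)))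
    = t * (LINT z|lborel. \<psi> z * laplacian w (x - t *\<^sub>R z))"
proof -
  have sp: "smooth (partial b w)" if "b \<in> Basis" for b using smooth_partial[OF w that] .
  have i1: "integrable lborel (\<lambda>z. partial b \<psi> z * partial b w (x - t *\<^sub>R z))" if "b \<in> Basis" for b
    by (rule integrable_test_affine[OF test_partial[OF psi that] sp[OF that]])
  have i2: "integrable lborel (\<lambda>z. \<psi> z * partial b (partial b w) (x - t *\<^sub>R z))" if "b \<in> Basis" for b
    by (rule integrable_test_affine[OF psi smooth_partial[OF sp[OF that] that]])
  have *: "(LINT z|lborel. partial b \<psi> z * partial b w (x - t *\<^sub>R z))
     = t * (LINT z|lborel. \<psi> z * partial b (partial b w) (x - t *\<^sub>R z))" if b: "b \<in> Basis" for b
  proof -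
    let ?g = "\<lambda>z. partial b w (x - t *\<^sub>R z)"
    have sg: "smooth ?g" using smooth_affine[OF sp[OF b], of x "- t"] by simp
    have pg: "partial b ?g z = - t * partial b (partial b w) (x - t *\<^sub>R z)" for z
      using partial_affine[OF sp[OF b], of b x "- t" z] by simp
    have "0 = (LINT z|lborel. partial b (\<lambda>z. \<psi> z * ?g z) z)"
      using integral_partial_test[OF test_mult[OF psi sg] b] by simp
    also have "\<dots> = (LINT z|lborel. partial b \<psi> z * ?g z - t * (\<psi> z * partial b (partial b w) (x - t *\<^sub>R z)))"
      by (intro Bochner_Integration.integral_cong)
         (auto simp: partial_mult[OF test_smooth[OF psi] sg] pg)
    also have "\<dots> = (LINT z|lborel. partial b \<psi> z * ?g z) - t * (LINT z|lborel. \<psi> z * partial b (partial b w) (x - t *\<^sub>R z))"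
      using i1[OF b] i2[OF b] by simp
    finally show ?thesis by simp
  qed
  have "(LINT z|lborel. \<rho> z * (\<Sum>b\<in>Basis. - (z \<bullet> b) * partial b w (x - t *\<^sub>R z)))
     = (LINT z|lborel. (\<Sum>b\<in>Basis. partial b \<psi> z * partial b w (x - t *\<^sub>R z)))"
    by (intro Bochner_Integration.integral_cong) (auto simp: partial_psi sum_distrib_left mult_ac intro!: sum.cong)
  also have "\<dots> = (\<Sum>b\<in>Basis. LINT z|lborel. partial b \<psi> z * partial b w (x - t *\<^sub>R z))"
    by (rule Bochner_Integration.integral_sum) (rule i1)
  also have "\<dots> = t * (\<Sum>b\<in>Basis. LINT z|lborel. \<psi> z * partial b (partial b w) (x - t *\<^sub>R z))"
    by (simp add: * sum_distrib_left)
  also have "(\<Sum>b\<in>Basis. LINT z|lborel. \<psi> z * partial b (partial b w) (x - t *\<^sub>R z))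
     = (LINT z|lborel. (\<Sum>b\<in>Basis. \<psi> z * partial b (partial b w) (x - t *\<^sub>R z)))"
    by (rule Bochner_Integration.integral_sum[symmetric]) (rule i2)
  also have "\<dots> = (LINT z|lborel. \<psi> z * laplacian w (x - t *\<^sub>R z))"
    by (simp add: laplacian_def sum_distrib_left)
  finally show ?thesis .
qed

text \<open>Taylor's formula for \<open>w\<close> has a uniformly quadratic remainder and the mass
  of \<rho> lies in the unit ball, so the remainder of the average is at most
  \<open>D * (t' - t)\<^sup>2\<close>. The linear term is then rewritten by the integration by parts
  above.\<close>

lemma avg_has_derivative:
  assumes w: "bounded_C2 w"
  shows "(avg w x has_real_derivative t * (LINT z|lborel. \<psi> z * laplacian w (x - t *\<^sub>R z))) (at t)"
proof -
  have s: "smooth w" using w by (simp add: bounded_C2_def)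
  obtain C where "\<And>b c x. b \<in> Basis \<Longrightarrow> c \<in> Basis \<Longrightarrow> \<bar>partial c (partial b w) x\<bar> \<le> C"
    using w unfolding bounded_C2_def by blast
  then have tay: "\<bar>w (y + h) - w y - (\<Sum>b\<in>Basis. (h \<bullet> b) * partial b w y)\<bar> \<le> (DIM('a)\<^sup>2 * C) * (norm h)\<^sup>2" for y h
    using taylor_of_partials[OF s] by blast
  define D where "D = (DIM('a)\<^sup>2 * C)"
  have D: "D \<ge> 0"
  proof -
    obtain b :: 'a where "b \<in> Basis" using nonempty_Basis by blast
    then show ?thesis using tay[of 0 b] unfolding D_def by simp
  qed
  have n: "\<rho> z \<ge> 0" for z using rho by (simp add: mollifier_def)
  let ?d = "\<lambda>z. (\<Sum>b\<in>Basis. - (z \<bullet> b) * partial b w (x - t *\<^sub>R z))"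
  let ?D = "t * (LINT z|lborel. \<psi> z * laplacian w (x - t *\<^sub>R z))"
  have id: "integrable lborel (\<lambda>z. \<rho> z * ?d z)"
  proof -
    have "integrable lborel (\<lambda>z. \<Sum>b\<in>Basis. partial b \<psi> z * partial b w (x - t *\<^sub>R z))"
      by (intro Bochner_Integration.integrable_sum integrable_test_affine test_partial psi smooth_partial s)
    moreover have "(\<lambda>z. \<Sum>b\<in>Basis. partial b \<psi> z * partial b w (x - t *\<^sub>R z)) = (\<lambda>z. \<rho> z * ?d z)"
      by (auto simp: partial_psi sum_distrib_left mult_ac intro!: sum.cong)
    ultimately show ?thesis by simp
  qed
  have r: "\<bar>avg w x t' - avg w x t - (t' - t) * ?D\<bar> \<le> D * (t' - t)\<^sup>2" for t'
  proof -
    have "avg w x t' - avg w x t - (t' - t) * ?D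
        = (LINT z|lborel. \<rho> z * w (x - t' *\<^sub>R z)) - (LINT z|lborel. \<rho> z * w (x - t *\<^sub>R z)) - (LINT z|lborel. (t' - t) * (\<rho> z * ?d z))"
      unfolding avg_def avg_derivative_formula[OF s, symmetric] integral_mult_right_zero ..
    also have "\<dots> = (LINT z|lborel. \<rho> z * w (x - t' *\<^sub>R z) - \<rho> z * w (x - t *\<^sub>R z) - (t' - t) * (\<rho> z * ?d z))"
      using integrable_test_affine[OF rho_test s, of x t'] integrable_test_affine[OF rho_test s, of x t] id
      by (simp only: Bochner_Integration.integral_diff Bochner_Integration.integrable_diff integrable_mult_right)
    finally have e: "avg w x t' - avg w x t - (t' - t) * ?D = \<dots>" .
    have "\<bar>\<dots>\<bar> \<le> (LINT z|lborel. (D * (t' - t)\<^sup>2) * \<rho> z)"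
    proof (rule abs_integral_le)
      show "integrable lborel (\<lambda>z. (D * (t' - t)\<^sup>2) * \<rho> z)" by (intro integrable_mult_right test_integrable rho_test)
      fix z :: 'a
      let ?h = "(t - t') *\<^sub>R z" and ?y = "x - t *\<^sub>R z"
      have 1: "?y + ?h = x - t' *\<^sub>R z" by (simp add: algebra_simps)
      have 2: "(\<Sum>b\<in>Basis. (?h \<bullet> b) * partial b w ?y) = (t' - t) * ?d z"
        unfolding sum_distrib_left by (intro sum.cong) (auto simp: algebra_simps)
      have "\<bar>w (x - t' *\<^sub>R z) - w ?y - (t' - t) * ?d z\<bar> \<le> D * (norm ?h)\<^sup>2"
        using tay[of ?y ?h] unfolding 1 2 D_def .
      then have b: "\<rho> z * \<bar>w (x - t' *\<^sub>R z) - w ?y - (t' - t) * ?d z\<bar> \<le> \<rho> z * (D * (norm ?h)\<^sup>2)"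
        by (intro mult_left_mono n)
      have "\<rho> z * (D * (norm ?h)\<^sup>2) \<le> (D * (t' - t)\<^sup>2) * \<rho> z"
      proof (cases "norm z \<ge> 1")
        case True then show ?thesis using mollifier_outside[OF rho] by simp
      next
        case False
        then have "(norm ?h)\<^sup>2 \<le> (t' - t)\<^sup>2"
          by (simp add: power_mult_distrib power2_commute mult_left_le power_le_one)
        then have "D * (norm ?h)\<^sup>2 \<le> D * (t' - t)\<^sup>2" using D by (rule mult_left_mono)
        then show ?thesis using n[of z] by (metis mult.commute mult_left_mono)
      qed
      moreover have "\<bar>\<rho> z * w (x - t' *\<^sub>R z) - \<rho> z * w ?y - (t' - t) * (\<rho> z * ?d z)\<bar>
          = \<rho> z * \<bar>w (x - t' *\<^sub>R z) - w ?y - (t' - t) * ?d z\<bar>"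
      proof -
        have "\<rho> z * w (x - t' *\<^sub>R z) - \<rho> z * w ?y - (t' - t) * (\<rho> z * ?d z)
          = \<rho> z * (w (x - t' *\<^sub>R z) - w ?y - (t' - t) * ?d z)" by (simp only: right_diff_distrib mult_ac)
        then show ?thesis using n[of z] by (simp only: abs_mult abs_of_nonneg)
      qed
      ultimately show "\<bar>\<rho> z * w (x - t' *\<^sub>R z) - \<rho> z * w ?y - (t' - t) * (\<rho> z * ?d z)\<bar> \<le> (D * (t' - t)\<^sup>2) * \<rho> z"
        using b by linarith
    qed
    also have "\<dots> = D * (t' - t)\<^sup>2" using rho by (simp add: mollifier_def)
    finally show ?thesis unfolding e .
  qed
  show ?thesis
    unfolding has_field_derivative_def
  proof (rule has_derivativeI_sandwich[of 1 _ _ _ _ "\<lambda>t'. D * \<bar>t' - t\<bar>"])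
    show "bounded_linear ((*) ?D)" by (rule bounded_linear_mult_right)
    show "norm (avg w x t' - avg w x t - ?D * (t' - t)) / norm (t' - t) \<le> D * \<bar>t' - t\<bar>" if "t' \<noteq> t" for t'
      using r[of t'] that by (simp add: divide_le_eq power2_eq_square mult_ac)
    have "((\<lambda>t'. D * \<bar>t' - t\<bar>) \<longlongrightarrow> D * \<bar>t - t\<bar>) (at t)" by (intro tendsto_intros)
    then show "((\<lambda>t'. D * \<bar>t' - t\<bar>) \<longlongrightarrow> 0) (at t)" by simp
  qed simp
qed

lemma avg_0: "avg w x 0 = w x"
  using rho by (simp add: avg_def mollifier_def)

end

text \<open>Comparison with A t^a / a. For a < 1 the bound on the derivative is unbounded at 0 but
  integrable, which is why it is assumed only inside the interval while continuity covers the end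
  points.\<close>

lemma mean_value_powr:
  fixes f f' :: "real \<Rightarrow> real"
  assumes T: "T > 0" and a: "a > 0"
    and f: "\<And>t. (f has_real_derivative f' t) (at t)"
    and le: "\<And>t. 0 < t \<Longrightarrow> t < T \<Longrightarrow> \<bar>f' t\<bar> \<le> A * t powr (a - 1)"
  shows "\<bar>f T - f 0\<bar> \<le> A * T powr a / a"
proof -
  have "norm (f T - f 0) \<le> A * T powr a / a - A * 0 powr a / a"
  proof (rule differentiable_bound_general[where \<phi>="\<lambda>t. A * t powr a / a" and \<phi>'="\<lambda>t. A * t powr (a - 1)" and f'=f'])
    show "continuous_on {0..T} f"
      using f by (meson DERIV_isCont continuous_at_imp_continuous_on)
    show "continuous_on {0..T} (\<lambda>t. A * t powr a / a)"
      using a by (intro continuous_intros continuous_on_powr') auto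
    show "((\<lambda>t. A * t powr a / a) has_vector_derivative A * t powr (a - 1)) (at t)" if "0 < t" for t
      unfolding has_real_derivative_iff_has_vector_derivative[symmetric]
      using that a by (auto intro!: derivative_eq_intros)
    show "(f has_vector_derivative f' t) (at t)" for t
      using f has_real_derivative_iff_has_vector_derivative by blast
  qed (use T le in auto)
  then show ?thesis by simp
qed

lemma smooth_laplacian: "smooth w \<Longrightarrow> smooth (laplacian w)"
proof -
  assume "smooth w"
  then have "Ck k (\<lambda>x. \<Sum>b\<in>Basis. partial b (partial b w) x)" for k
    by (intro Ck_sum) (use smooth_partial smooth_def in blast)
  then show ?thesis unfolding smooth_def laplacian_def by simp
qed

lemma diff2_eq_0_outside:
  assumes R: "\<And>x. norm x > R \<Longrightarrow> \<kappa> x = 0" and z: "norm z > R + norm h"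
  shows "diff2 \<kappa> h z = 0"
proof -
  have "norm z \<le> norm (z + h) + norm h" using norm_triangle_ineq4[of "z + h" h] by simp
  moreover have "norm z \<le> norm (z - h) + norm h" using norm_triangle_ineq[of "z - h" h] by simp
  moreover have "norm h \<ge> 0" by simp
  ultimately have "norm z > R" "norm (z + h) > R" "norm (z - h) > R" using z by linarith+
  then show ?thesis using R by (simp add: diff2_def)
qed

lemma test_diff2:
  fixes \<kappa> :: "'a::euclidean_space \<Rightarrow> real"
  assumes "\<kappa> \<in> test_functions" shows "diff2 \<kappa> h \<in> test_functions"
proof -
  have "smooth (\<lambda>z. \<kappa> (z + h) + (\<kappa> (z + - h) + (- 2) * \<kappa> z))"
    by (intro smooth_add smooth_mult smooth_const smooth_shift test_smooth assms)
  then have "smooth (diff2 \<kappa> h)" unfolding diff2_def by (simp add: algebra_simps)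
  moreover obtain R where "\<And>x. norm x > R \<Longrightarrow> \<kappa> x = 0" using test_support assms by metis
  ultimately show ?thesis by (metis test_functionsI diff2_eq_0_outside)
qed

text \<open>Interpolation by cases: r^2 is below r^(1 + s) for \<open>r \<le> 1\<close>, and 1 is
  below r^(1 + s) otherwise.\<close>

lemma powr_le_max:
  fixes r s K c :: real
  assumes "0 < s" "s < 1" "0 \<le> r" "0 \<le> K" "c \<le> K * r\<^sup>2" "c \<le> K"
  shows "c \<le> K * r powr (1 + s)"
proof (cases "r \<le> 1")
  case True
  then have "K * r\<^sup>2 \<le> K * r powr (1 + s)" using assms by (intro mult_left_mono square_le_powr) auto
  then show ?thesis using assms by linarith
next
  case False
  then have "K * 1 \<le> K * r powr (1 + s)" using assms by (intro mult_left_mono ge_one_powr_ge_zero) auto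
  then show ?thesis using assms by linarith
qed

section \<open>Differences of averages, and of functions, at all scales\<close>

context averaging_kernels
begin

definition kavg :: "('a \<Rightarrow> real) \<Rightarrow> ('a \<Rightarrow> real) \<Rightarrow> 'a \<Rightarrow> real \<Rightarrow> real" where
  "kavg \<kappa> g x t = (LINT z|lborel. \<kappa> z * g (x - t *\<^sub>R z))"

lemma kernel_test: "\<kappa> \<in> {\<rho>, \<psi>} \<Longrightarrow> \<kappa> \<in> test_functions"
  using rho_test psi by auto

text \<open>Translating the base point by \<open>h\<close> translates the kernel by h / t.
  Differences thus fall on the smooth kernel, at the price of powers of 1 / t.\<close>

lemma kavg_shift:
  assumes t: "\<kappa> \<in> test_functions" and g: "smooth g" and "t > 0"
  shows "kavg \<kappa> g (x + h) t = kavg (\<lambda>z. \<kappa> (z + (1 / t) *\<^sub>R h)) g x t"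
proof -
  have "(\<lambda>z. \<kappa> z * g (x + h - t *\<^sub>R z)) \<in> borel_measurable borel"
    using borel_measurable_integrable[OF integrable_test_affine[OF t g]] by simp
  from integral_shift[OF this, of "(1 / t) *\<^sub>R h"] show ?thesis
    using \<open>t > 0\<close> by (simp add: kavg_def algebra_simps)
qed

lemma kavg_first_difference:
  assumes k: "\<kappa> \<in> {\<rho>, \<psi>}" and g: "smooth g" "\<And>y. \<bar>g y\<bar> \<le> G" and t: "t > 0"
  shows "\<bar>kavg \<kappa> g (x + h) t - kavg \<kappa> g x t\<bar> \<le> G * K * norm h / t"
proof -
  let ?k = "(1 / t) *\<^sub>R h"
  note kt = kernel_test[OF k]
  have i: "integrable lborel (\<lambda>z. \<kappa> (z + ?k) - \<kappa> z)"
    by (intro Bochner_Integration.integrable_diff test_integrable test_shift kt)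
  have "kavg \<kappa> g (x + h) t - kavg \<kappa> g x t = (LINT z|lborel. (\<kappa> (z + ?k) - \<kappa> z) * g (x - t *\<^sub>R z))"
    unfolding kavg_shift[OF kt g(1) t] unfolding kavg_def
    using integrable_test_affine[OF test_shift[OF kt] g(1)] integrable_test_affine[OF kt g(1)]
    by (simp add: left_diff_distrib)
  also have "\<bar>\<dots>\<bar> \<le> (LINT z|lborel. G * \<bar>\<kappa> (z + ?k) - \<kappa> z\<bar>)"
    by (rule abs_integral_le)
       (use i g(2) in \<open>auto simp: abs_mult mult.commute intro!: mult_right_mono\<close>)
  also have "\<dots> = G * (LINT z|lborel. \<bar>\<kappa> (z + ?k) - \<kappa> z\<bar>)" by (rule integral_mult_right_zero)
  also have "\<dots> \<le> G * (K * norm ?k)"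
    using K(2)[OF k, of ?k] g(2)[of 0] by (intro mult_left_mono) auto
  finally show ?thesis using t by simp
qed

lemma kavg_second_difference:
  assumes k: "\<kappa> \<in> test_functions" and g: "smooth g" and t: "t > 0"
  shows "diff2 (\<lambda>x. kavg \<kappa> g x t) h x = (LINT z|lborel. diff2 \<kappa> ((1 / t) *\<^sub>R h) z * g (x - t *\<^sub>R z))"
proof -
  let ?k = "(1 / t) *\<^sub>R h"
  have "diff2 (\<lambda>x. kavg \<kappa> g x t) h x
     = kavg (\<lambda>z. \<kappa> (z + ?k)) g x t + kavg (\<lambda>z. \<kappa> (z + - ?k)) g x t - 2 * kavg \<kappa> g x t"
    using kavg_shift[OF k g t, of x h] kavg_shift[OF k g t, of x "- h"] by (simp add: diff2_def)
  also have "\<dots> = (LINT z|lborel. \<kappa> (z + ?k) * g (x - t *\<^sub>R z) + \<kappa> (z + - ?k) * g (x - t *\<^sub>R z) - 2 * (\<kappa> z * g (x - t *\<^sub>R z)))"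
    unfolding kavg_def
    using integrable_test_affine[OF test_shift[OF k, of ?k] g, of x t]
      integrable_test_affine[OF test_shift[OF k, of "- ?k"] g, of x t] integrable_test_affine[OF k g, of x t]
    by (simp only: Bochner_Integration.integral_add Bochner_Integration.integral_diff integral_mult_right_zero
        Bochner_Integration.integrable_add integrable_mult_right)
  finally show ?thesis by (simp add: diff2_def algebra_simps)
qed

lemma integrable_diff2_test:
  assumes k: "\<kappa> \<in> test_functions"
  shows "integrable lborel (diff2 \<kappa> (h::'a))" "integrable lborel (\<lambda>z. \<bar>diff2 \<kappa> h z\<bar> * (1 + norm z))"
    "(LINT z|lborel. diff2 \<kappa> h z) = 0"
proof -
  have i: "integrable lborel \<kappa>" "integrable lborel (\<lambda>z. \<kappa> (z + h))" for h
    using test_integrable test_shift k by blast+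
  have [measurable]: "\<kappa> \<in> borel_measurable borel" by (rule test_borel[OF k])
  show 1: "integrable lborel (diff2 \<kappa> h)"
    using i i(2)[of "- h"] unfolding diff2_def by simp
  have e: "(LINT z|lborel. \<kappa> (z + h)) = (LINT z|lborel. \<kappa> z)" for h
    using integral_shift[of \<kappa> h] by (simp add: add.commute)
  show "(LINT z|lborel. diff2 \<kappa> h z) = 0"
    using i(2)[of h] i(2)[of "- h"] i(1) e[of h] e[of "- h"] unfolding diff2_def by simp
  obtain R where R: "\<And>x. norm x > R \<Longrightarrow> \<kappa> x = 0" using test_support k by metis
  note 0 = diff2_eq_0_outside[of R \<kappa>, OF R]
  show "integrable lborel (\<lambda>z. \<bar>diff2 \<kappa> h z\<bar> * (1 + norm z))"
  proof (rule Bochner_Integration.integrable_bound)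
    show "integrable lborel (\<lambda>z. (1 + \<bar>R + norm h\<bar>) * diff2 \<kappa> h z)" using 1 by simp
    show "AE z in lborel. norm (\<bar>diff2 \<kappa> h z\<bar> * (1 + norm z)) \<le> norm ((1 + \<bar>R + norm h\<bar>) * diff2 \<kappa> h z)"
    proof (rule AE_I2)
      fix z
      show "norm (\<bar>diff2 \<kappa> h z\<bar> * (1 + norm z)) \<le> norm ((1 + \<bar>R + norm h\<bar>) * diff2 \<kappa> h z)"
      proof (cases "norm z > R + norm h")
        case False
        then have "\<bar>1 + norm z\<bar> \<le> \<bar>1 + \<bar>R + norm h\<bar>\<bar>" by simp
        then show ?thesis by (simp only: real_norm_def abs_mult abs_abs) (metis abs_ge_zero mult.commute mult_left_mono)
      qed (simp add: 0)
    qed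
  qed (simp add: diff2_def)
qed

lemma kavg_second_difference_powr:
  assumes k: "\<kappa> \<in> {\<rho>, \<psi>}" and g: "smooth g" "\<And>y. \<bar>g y\<bar> \<le> G" and t: "t > 0" and s: "0 < s" "s < 1"
  shows "\<bar>diff2 (\<lambda>x. kavg \<kappa> g x t) h x\<bar> \<le> G * K * (norm h / t) powr (1 + s)"
    and "\<bar>diff2 (\<lambda>x. kavg \<kappa> g x t) h x\<bar> \<le> G * K * (norm h / t)\<^sup>2"
proof -
  let ?k = "(1 / t) *\<^sub>R h"
  note kt = kernel_test[OF k] and i = integrable_diff2_test[OF kernel_test[OF k]]
  have G: "G \<ge> 0" using g(2)[of 0] by linarith
  have I2: "(LINT z|lborel. \<bar>diff2 \<kappa> ?k z\<bar>) \<le> K * (norm ?k)\<^sup>2"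
  proof -
    have "(LINT z|lborel. \<bar>diff2 \<kappa> ?k z\<bar>) \<le> (LINT z|lborel. \<bar>diff2 \<kappa> ?k z\<bar> * (1 + norm z))"
      by (intro integral_mono integrable_abs i) (simp add: distrib_left)
    also have "\<dots> \<le> K * (norm ?k)\<^sup>2" by (rule K(3)[OF k])
    finally show ?thesis .
  qed
  have *: "\<bar>diff2 (\<lambda>x. kavg \<kappa> g x t) h x\<bar> \<le> G * (LINT z|lborel. \<bar>diff2 \<kappa> ?k z\<bar>)"
    unfolding kavg_second_difference[OF kt g(1) t] integral_mult_right_zero[symmetric]
    by (rule abs_integral_le)
       (use i g(2) in \<open>auto simp: abs_mult mult.commute intro!: mult_right_mono\<close>)
  have n: "norm ?k = norm h / t" using t by simp
  have "(LINT z|lborel. \<bar>diff2 \<kappa> ?k z\<bar>) \<le> K * (norm ?k) powr (1 + s)"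
    by (rule powr_le_max[OF s _ _ I2 K(4)[OF k]]) (use K(1) in auto)
  then show "\<bar>diff2 (\<lambda>x. kavg \<kappa> g x t) h x\<bar> \<le> G * K * (norm h / t) powr (1 + s)"
    using * mult_left_mono[OF _ G] unfolding n mult.assoc by (meson order_trans)
  show "\<bar>diff2 (\<lambda>x. kavg \<kappa> g x t) h x\<bar> \<le> G * K * (norm h / t)\<^sup>2"
    using * mult_left_mono[OF I2 G] unfolding n mult.assoc by (meson order_trans)
qed

text \<open>The second difference of \<open>\<psi>\<close> has mean zero, which turns the Hoelder continuity of \<open>g\<close>
  into a gain of \<open>t powr \<gamma>\<close>.\<close>

lemma kavg_second_difference_hoelder:
  assumes k: "\<kappa> \<in> {\<rho>, \<psi>}" and g: "smooth g" "\<And>y y'. \<bar>g y - g y'\<bar> \<le> H * norm (y - y') powr \<gamma>"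
    and t: "t > 0" and \<gamma>: "0 < \<gamma>" "\<gamma> \<le> 1"
  shows "\<bar>diff2 (\<lambda>x. kavg \<kappa> g x t) h x\<bar> \<le> H * t powr \<gamma> * (K * (norm h / t)\<^sup>2)"
proof -
  let ?k = "(1 / t) *\<^sub>R h"
  note kt = kernel_test[OF k] and i = integrable_diff2_test[OF kernel_test[OF k]]
  obtain b :: 'a where b: "b \<in> Basis" using nonempty_Basis by blast
  have H: "H \<ge> 0" using g(2)[of b 0] b by simp
  note td = test_diff2[OF kt, of ?k]
  have "diff2 (\<lambda>x. kavg \<kappa> g x t) h x
     = (LINT z|lborel. diff2 \<kappa> ?k z * g (x - t *\<^sub>R z)) - (LINT z|lborel. diff2 \<kappa> ?k z * g x)"
    unfolding kavg_second_difference[OF kt g(1) t] integral_mult_left_zero i(3) by simp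
  also have "\<dots> = (LINT z|lborel. diff2 \<kappa> ?k z * (g (x - t *\<^sub>R z) - g x))"
    using integrable_test_affine[OF td g(1), of x t] i(1)[of ?k] by (simp add: right_diff_distrib)
  also have "\<bar>\<dots>\<bar> \<le> (LINT z|lborel. (H * t powr \<gamma>) * (\<bar>diff2 \<kappa> ?k z\<bar> * (1 + norm z)))"
  proof (rule abs_integral_le[OF integrable_mult_right[OF i(2)]])
    fix z
    have "\<bar>g (x - t *\<^sub>R z) - g x\<bar> \<le> H * norm (t *\<^sub>R z) powr \<gamma>"
      using g(2)[of "x - t *\<^sub>R z" x] by simp
    also have "\<dots> = H * t powr \<gamma> * norm z powr \<gamma>" using t by (simp add: powr_mult)
    also have "\<dots> \<le> H * t powr \<gamma> * (1 + norm z)"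
    proof (intro mult_left_mono)
      have "norm z powr \<gamma> \<le> (1 + norm z) powr \<gamma>" using \<gamma> by (intro powr_mono2) auto
      also have "\<dots> \<le> (1 + norm z) powr 1" using \<gamma> by (intro powr_mono) auto
      finally show "norm z powr \<gamma> \<le> 1 + norm z" by simp
    qed (use H in simp)
    finally have "\<bar>diff2 \<kappa> ?k z\<bar> * \<bar>g (x - t *\<^sub>R z) - g x\<bar> \<le> \<bar>diff2 \<kappa> ?k z\<bar> * (H * t powr \<gamma> * (1 + norm z))"
      by (intro mult_left_mono) auto
    then show "\<bar>diff2 \<kappa> ?k z * (g (x - t *\<^sub>R z) - g x)\<bar> \<le> (H * t powr \<gamma>) * (\<bar>diff2 \<kappa> ?k z\<bar> * (1 + norm z))"
      by (simp add: abs_mult mult_ac)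
  qed
  also have "\<dots> = (H * t powr \<gamma>) * (LINT z|lborel. \<bar>diff2 \<kappa> ?k z\<bar> * (1 + norm z))"
    by (rule integral_mult_right_zero)
  also have "\<dots> \<le> (H * t powr \<gamma>) * (K * (norm ?k)\<^sup>2)"
    using H by (intro mult_left_mono K(3)[OF k]) auto
  finally show ?thesis using t by simp
qed

lemma avg_kavg: "avg w x t = kavg \<rho> w x t" by (simp add: avg_def kavg_def)

text \<open>The difference of averages at scale \<open>T\<close> contributes M / T. Its derivative
  in t is t times a difference of averages of the Laplacian of size G K |h| / t, so the factors t
  cancel and integration gives G T.\<close>

lemma first_difference_estimate:
  fixes w :: "'a \<Rightarrow> real"
  assumes w: "bounded_C2 w" "\<And>x. \<bar>w x\<bar> \<le> M" "\<And>x. \<bar>laplacian w x\<bar> \<le> G" and T: "T > 0"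
  shows "\<bar>w (x + h) - w x\<bar> \<le> K * norm h * (M / T + G * T)"
proof -
  have s: "smooth w" using w by (simp add: bounded_C2_def)
  let ?f = "\<lambda>t. avg w (x + h) t - avg w x t"
  let ?f' = "\<lambda>t. t * kavg \<psi> (laplacian w) (x + h) t - t * kavg \<psi> (laplacian w) x t"
  have "\<bar>?f T - ?f 0\<bar> \<le> (G * K * norm h) * T powr 1 / 1"
  proof (rule mean_value_powr[OF T, of 1 ?f ?f'])
    show "(?f has_real_derivative ?f' t) (at t)" for t
      unfolding kavg_def by (intro DERIV_diff avg_has_derivative w)
    fix t :: real assume t: "0 < t"
    have "\<bar>?f' t\<bar> = t * \<bar>kavg \<psi> (laplacian w) (x + h) t - kavg \<psi> (laplacian w) x t\<bar>"
      using t by (simp add: abs_mult right_diff_distrib[symmetric])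
    also have "\<dots> \<le> t * (G * K * norm h / t)"
      using t by (intro mult_left_mono kavg_first_difference smooth_laplacian s w) auto
    finally show "\<bar>?f' t\<bar> \<le> (G * K * norm h) * t powr (1 - 1)" using t by simp
  qed simp
  moreover have "\<bar>?f T\<bar> \<le> M * K * norm h / T"
    unfolding avg_kavg by (rule kavg_first_difference) (use s w T in auto)
  ultimately have "\<bar>w (x + h) - w x\<bar> \<le> M * K * norm h / T + G * K * norm h * T"
    using T unfolding avg_0 by simp
  then show ?thesis by (simp add: algebra_simps)
qed

text \<open>The factor t in the derivative of the average raises the assumed power from
  \<open>a - 2\<close> to \<open>a - 1\<close>, integrable at 0 exactly because
  \<open>a > 0\<close>.\<close>

lemma second_difference_mean_value:
  fixes w :: "'a \<Rightarrow> real"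
  assumes w: "bounded_C2 w" and T: "T > 0" and a: "a > 0"
    and G: "\<And>t. t > 0 \<Longrightarrow> \<bar>diff2 (\<lambda>x. kavg \<psi> (laplacian w) x t) h x\<bar> \<le> A * t powr (a - 2)"
  shows "\<bar>diff2 w h x\<bar> \<le> \<bar>diff2 (\<lambda>x. kavg \<rho> w x T) h x\<bar> + A * T powr a / a"
proof -
  let ?f = "\<lambda>t. diff2 (\<lambda>x. avg w x t) h x"
  let ?I = "\<lambda>x t. t * kavg \<psi> (laplacian w) x t"
  let ?f' = "\<lambda>t. ?I (x + h) t + ?I (x - h) t - 2 * ?I x t"
  have "\<bar>?f T - ?f 0\<bar> \<le> A * T powr a / a"
  proof (rule mean_value_powr[OF T a, of ?f ?f'])
    show "(?f has_real_derivative ?f' t) (at t)" for t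
      unfolding kavg_def diff2_def by (intro DERIV_diff DERIV_add DERIV_cmult avg_has_derivative w)
    fix t :: real assume t: "0 < t"
    have "?f' t = t * diff2 (\<lambda>x. kavg \<psi> (laplacian w) x t) h x" by (simp add: diff2_def algebra_simps)
    then have "\<bar>?f' t\<bar> = t * \<bar>diff2 (\<lambda>x. kavg \<psi> (laplacian w) x t) h x\<bar>" using t by (simp add: abs_mult)
    also have "\<dots> \<le> t * (A * t powr (a - 2))" using t by (intro mult_left_mono G) auto
    also have "\<dots> = A * (t powr 1 * t powr (a - 2))" using t by simp
    also have "\<dots> = A * t powr (a - 1)" unfolding powr_add[symmetric] by simp
    finally show "\<bar>?f' t\<bar> \<le> A * t powr (a - 1)" .
  qed
  moreover have "?f 0 = diff2 w h x" by (simp add: avg_0)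
  ultimately show ?thesis unfolding avg_kavg by linarith
qed

text \<open>Used with \<open>a = 1 - s\<close>: second differences of order 1 + s cost t^(-1-s), and
  with the extra factor t this is t^(-s). The order 2 would leave t^(-1), which is not integrable at
  0.\<close>

lemma second_difference_estimate:
  fixes w :: "'a \<Rightarrow> real"
  assumes w: "bounded_C2 w" "\<And>x. \<bar>w x\<bar> \<le> M" "\<And>x. \<bar>laplacian w x\<bar> \<le> G" and T: "T > 0"
    and s: "0 < s" "s < 1"
  shows "\<bar>diff2 w h x\<bar> \<le> K * norm h powr (1 + s) * (M * T powr (- (1 + s)) + G * T powr (1 - s) / (1 - s))"
proof -
  have sm: "smooth w" using w by (simp add: bounded_C2_def)
  have q: "(norm h / t) powr (1 + s) = norm h powr (1 + s) * t powr (- (1 + s))" if "t > 0" for t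
  proof -
    have "(norm h / t) powr (1 + s) = norm h powr (1 + s) / t powr (1 + s)"
      using that by (simp add: powr_divide)
    then show ?thesis by (simp only: powr_minus_divide times_divide_eq_right mult_1_right)
  qed
  have "\<bar>diff2 w h x\<bar> \<le> \<bar>diff2 (\<lambda>x. kavg \<rho> w x T) h x\<bar> + (G * K * norm h powr (1 + s)) * T powr (1 - s) / (1 - s)"
  proof (rule second_difference_mean_value[OF w(1) T])
    fix t :: real assume t: "t > 0"
    have "\<bar>diff2 (\<lambda>x. kavg \<psi> (laplacian w) x t) h x\<bar> \<le> G * K * (norm h / t) powr (1 + s)"
      by (rule kavg_second_difference_powr[OF _ _ _ t s]) (use w smooth_laplacian[OF sm] in auto)
    then show "\<bar>diff2 (\<lambda>x. kavg \<psi> (laplacian w) x t) h x\<bar> \<le> (G * K * norm h powr (1 + s)) * t powr (1 - s - 2)"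
      unfolding q[OF t] by (simp add: mult_ac)
  qed (use s in simp)
  moreover have "\<bar>diff2 (\<lambda>x. kavg \<rho> w x T) h x\<bar> \<le> M * K * (norm h / T) powr (1 + s)"
    by (rule kavg_second_difference_powr[OF _ _ _ T s]) (use w sm in auto)
  ultimately have "\<bar>diff2 w h x\<bar> \<le> M * K * (norm h powr (1 + s) * T powr (- (1 + s)))
      + (G * K * norm h powr (1 + s)) * T powr (1 - s) / (1 - s)" unfolding q[OF T] by linarith
  also have "\<dots> = K * norm h powr (1 + s) * (M * T powr (- (1 + s)) + G * T powr (1 - s) / (1 - s))"
    by (simp add: distrib_left mult_ac)
  finally show ?thesis .
qed

text \<open>Used with \<open>a = \<gamma>\<close>: the factor t^\<gamma> gained from Hoelder
  continuity makes the critical t^(-1) integrable, so the full order 2 is reached.\<close>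

lemma second_difference_estimate_hoelder:
  fixes w :: "'a \<Rightarrow> real"
  assumes w: "bounded_C2 w" "\<And>x. \<bar>w x\<bar> \<le> M"
    and H: "\<And>y y'. \<bar>laplacian w y - laplacian w y'\<bar> \<le> H * norm (y - y') powr \<gamma>"
    and T: "T > 0" and \<gamma>: "0 < \<gamma>" "\<gamma> < 1"
  shows "\<bar>diff2 w h x\<bar> \<le> K * (norm h)\<^sup>2 * (M / T\<^sup>2 + H * T powr \<gamma> / \<gamma>)"
proof -
  have sm: "smooth w" using w by (simp add: bounded_C2_def)
  have "\<bar>diff2 w h x\<bar> \<le> \<bar>diff2 (\<lambda>x. kavg \<rho> w x T) h x\<bar> + (H * K * (norm h)\<^sup>2) * T powr \<gamma> / \<gamma>"
  proof (rule second_difference_mean_value[OF w(1) T \<gamma>(1)])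
    fix t :: real assume t: "t > 0"
    have "\<bar>diff2 (\<lambda>x. kavg \<psi> (laplacian w) x t) h x\<bar> \<le> H * t powr \<gamma> * (K * (norm h / t)\<^sup>2)"
      by (rule kavg_second_difference_hoelder[OF _ _ _ t]) (use H \<gamma> smooth_laplacian[OF sm] in auto)
    also have "\<dots> = (H * K * (norm h)\<^sup>2) * (t powr \<gamma> * t powr (- 2))"
      using t by (simp add: power_divide powr_minus_divide)
    also have "\<dots> = (H * K * (norm h)\<^sup>2) * t powr (\<gamma> - 2)" unfolding powr_add[symmetric] by simp
    finally show "\<bar>diff2 (\<lambda>x. kavg \<psi> (laplacian w) x t) h x\<bar> \<le> (H * K * (norm h)\<^sup>2) * t powr (\<gamma> - 2)" .
  qed
  moreover have "\<bar>diff2 (\<lambda>x. kavg \<rho> w x T) h x\<bar> \<le> M * K * (norm h / T)\<^sup>2"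
    by (rule kavg_second_difference_powr(2)[OF _ _ _ T \<gamma>]) (use w sm in auto)
  ultimately have "\<bar>diff2 w h x\<bar> \<le> M * K * (norm h / T)\<^sup>2 + (H * K * (norm h)\<^sup>2) * T powr \<gamma> / \<gamma>" by linarith
  also have "\<dots> = K * (norm h)\<^sup>2 * (M / T\<^sup>2 + H * T powr \<gamma> / \<gamma>)"
    by (simp add: distrib_left mult_ac power_divide)
  finally show ?thesis .
qed

end

section \<open>A priori estimates\<close>

text \<open>Starting from the finite constant \<open>Z0\<close>, n uses of \<open>step\<close> give
  a constant at most 2 P + Z0 / 2^n, and \<open>Z0\<close> disappears in the limit. Working with a
  family of inequalities avoids forming the supremum of the quotients \<open>a i / g i\<close>,
  where \<open>g i\<close> may vanish.\<close>

lemma absorb: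
  fixes a g :: "'i \<Rightarrow> real"
  assumes Z0: "Z0 \<ge> 0" "\<And>i. a i \<le> Z0 * g i" and g: "\<And>i. g i \<ge> 0" and P: "P \<ge> 0"
    and step: "\<And>Z. Z \<ge> 0 \<Longrightarrow> (\<And>i. a i \<le> Z * g i) \<Longrightarrow> (\<And>i. a i \<le> (Z / 2 + P) * g i)"
  shows "a i \<le> 2 * P * g i"
proof -
  have *: "a i \<le> (2 * P + Z0 * (1 / 2) ^ n) * g i" for n i
  proof (induction n arbitrary: i)
    case 0
    have "0 \<le> P * g i" using P g[of i] by simp
    then show ?case using Z0(2)[of i] by (simp add: distrib_right)
  next
    case (Suc n)
    have "a i \<le> ((2 * P + Z0 * (1 / 2) ^ n) / 2 + P) * g i"
      by (rule step) (use Suc P Z0(1) in auto)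
    then show ?case by (simp add: algebra_simps add_divide_distrib)
  qed
  have "(\<lambda>n. (2 * P + Z0 * (1 / 2) ^ n) * g i) \<longlonglongrightarrow> (2 * P + Z0 * 0) * g i"
    by (intro tendsto_intros LIMSEQ_power_zero) simp
  then show ?thesis using * by (intro LIMSEQ_le_const[where a="a i"]) auto
qed

section \<open>Mixed differences, and the Hoelder modulus of second differences\<close>

definition mixed_diff :: "('a::euclidean_space \<Rightarrow> real) \<Rightarrow> 'a \<Rightarrow> 'a \<Rightarrow> 'a \<Rightarrow> real" where
  "mixed_diff w h k x = w (x + h + k) - w (x + h) - w (x + k) + w x"

text \<open>The four points form a parallelogram. Its diagonals share the midpoint
  \<open>?m\<close>, so the mixed difference is the difference of two second differences there, with
  steps (h + k) / 2 and (h - k) / 2; the parallelogram law adds up the squares.\<close>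

lemma mixed_diff_le:
  fixes w :: "'a::euclidean_space \<Rightarrow> real"
  assumes N: "\<And>h x. \<bar>diff2 w h x\<bar> \<le> N * (norm h)\<^sup>2"
  shows "\<bar>mixed_diff w h k x\<bar> \<le> N * ((norm h)\<^sup>2 + (norm k)\<^sup>2) / 2"
proof -
  let ?m = "x + (1/2) *\<^sub>R (h + k)"
  have half: "(1/2) *\<^sub>R v + (1/2) *\<^sub>R v = v" for v :: 'a by (simp flip: scaleR_left_distrib)
  have half2: "(1/2) *\<^sub>R v + ((1/2) *\<^sub>R v + u) = v + u" for u v :: 'a
    by (simp add: half flip: add.assoc)
  have e: "mixed_diff w h k x = diff2 w ((1/2) *\<^sub>R (h + k)) ?m - diff2 w ((1/2) *\<^sub>R (h - k)) ?m"
  proof -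
    have "?m + (1/2) *\<^sub>R (h + k) = x + h + k" "?m - (1/2) *\<^sub>R (h + k) = x"
      "?m + (1/2) *\<^sub>R (h - k) = x + h" "?m - (1/2) *\<^sub>R (h - k) = x + k"
      by (simp_all add: algebra_simps half half2)
    then show ?thesis unfolding mixed_diff_def diff2_def by (simp only:)
  qed
  have "\<bar>mixed_diff w h k x\<bar> \<le> N * (norm ((1/2) *\<^sub>R (h + k)))\<^sup>2 + N * (norm ((1/2) *\<^sub>R (h - k)))\<^sup>2"
    unfolding e using N[of "(1/2) *\<^sub>R (h + k)" ?m] N[of "(1/2) *\<^sub>R (h - k)" ?m] by linarith
  also have "\<dots> = N * ((norm h)\<^sup>2 + (norm k)\<^sup>2) / 2"
    by (simp add: power2_norm_eq_inner inner_add_left inner_add_right inner_diff_left inner_diff_right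
        inner_commute algebra_simps)
  finally show ?thesis .
qed

lemma mixed_diff_multiple:
  assumes "\<And>x. \<bar>mixed_diff w h k x\<bar> \<le> c"
  shows "\<bar>mixed_diff w (real m *\<^sub>R h) k x\<bar> \<le> real m * c"
proof (induction m)
  case (Suc m)
  have "mixed_diff w (real (Suc m) *\<^sub>R h) k x = mixed_diff w h k (x + real m *\<^sub>R h) + mixed_diff w (real m *\<^sub>R h) k x"
    by (simp add: mixed_diff_def algebra_simps)
  then show ?case using Suc assms[of "x + real m *\<^sub>R h"] by (simp add: algebra_simps)
qed (simp add: mixed_diff_def)

text \<open>Splitting the longer increment into pieces no longer than the shorter one.\<close>

lemma mixed_diff_product:
  fixes w :: "'a::euclidean_space \<Rightarrow> real"
  assumes N: "\<And>h x. \<bar>diff2 w h x\<bar> \<le> N * (norm h)\<^sup>2" "N \<ge> 0" and kh: "norm k \<le> norm h"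
  shows "\<bar>mixed_diff w h k x\<bar> \<le> 2 * N * norm h * norm k"
proof (cases "k = 0")
  case False
  then have k: "norm k > 0" by simp
  define q where "q = norm h / norm k"
  have q: "q \<ge> 1" using kh k by (simp add: q_def)
  define m where "m = nat \<lceil>q\<rceil>"
  have m: "q \<le> real m" "real m \<le> q + 1" "m > 0" using q unfolding m_def by linarith+
  define h' where "h' = (1 / real m) *\<^sub>R h"
  have h': "real m *\<^sub>R h' = h" using m by (simp add: h'_def)
  have "norm h' = q * norm k / real m" using k m by (simp add: h'_def q_def)
  also have "\<dots> \<le> norm k" using m k by (simp add: divide_le_eq mult.commute mult_left_mono)
  finally have n: "norm h' \<le> norm k" .
  have "\<bar>mixed_diff w h' k y\<bar> \<le> N * (norm k)\<^sup>2" for y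
  proof -
    have "\<bar>mixed_diff w h' k y\<bar> \<le> N * ((norm h')\<^sup>2 + (norm k)\<^sup>2) / 2" by (rule mixed_diff_le[OF N(1)])
    also have "\<dots> \<le> N * ((norm k)\<^sup>2 + (norm k)\<^sup>2) / 2"
      using n N(2) by (intro divide_right_mono mult_left_mono add_right_mono power_mono) auto
    finally show ?thesis by simp
  qed
  from mixed_diff_multiple[of w h' k, OF this, of m x]
  have "\<bar>mixed_diff w h k x\<bar> \<le> real m * (N * (norm k)\<^sup>2)" unfolding h' .
  also have "\<dots> \<le> (2 * q) * (N * (norm k)\<^sup>2)" using m q N(2) by (intro mult_right_mono) auto
  also have "\<dots> = 2 * N * norm h * norm k" using k by (simp add: q_def power2_eq_square)
  finally show ?thesis .
qed (simp add: mixed_diff_def)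

text \<open>With k = x - y there are two bounds: a multiple of N |h| |k| when \<open>k\<close> is
  the shorter step, from mixed differences, and a multiple of N |h|^2 in general. Each is below N
  |k|^(1 - s) |h|^(1 + s) in its case. The factor in \<open>h\<close> is integrable against the
  kernel, so the nonlocal term inherits the exponent 1 - s.\<close>

lemma diff2_hoelder:
  fixes w :: "'a::euclidean_space \<Rightarrow> real"
  assumes N: "\<And>h x. \<bar>diff2 w h x\<bar> \<le> N * (norm h)\<^sup>2" "N \<ge> 0" and s: "0 < s" "s < 1"
  shows "\<bar>diff2 w h x - diff2 w h y\<bar> \<le> (4 * N * norm (x - y) powr (1 - s)) * norm h powr (1 + s)"
proof (cases "h = 0 \<or> x = y")
  case True then show ?thesis using N(2) by (auto simp: diff2_def)
next
  case False
  then have p: "norm h > 0" "norm (x - y) > 0" by auto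
  define k where "k = x - y"
  have x: "x = y + k" by (simp add: k_def)
  have "\<bar>diff2 w h x - diff2 w h y\<bar> \<le> 4 * N * (norm k powr (1 - s) * norm h powr (1 + s))"
  proof (cases "norm k \<le> norm h")
    case True
    have "diff2 w h x - diff2 w h y = mixed_diff w h k y - mixed_diff w h k (y - h)"
      unfolding x diff2_def mixed_diff_def by (simp add: algebra_simps)
    then have "\<bar>diff2 w h x - diff2 w h y\<bar> \<le> 4 * N * (norm h * norm k)"
      using mixed_diff_product[OF N True, of y] mixed_diff_product[OF N True, of "y - h"] by (simp add: mult.assoc)
    moreover have "norm h * norm k \<le> norm k powr (1 - s) * norm h powr (1 + s)"
    proof -
      have "norm h * norm k = norm h * (norm k powr (1 - s) * norm k powr s)"
        using p by (simp add: k_def flip: powr_add)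
      also have "\<dots> \<le> norm h * (norm k powr (1 - s) * norm h powr s)"
        using True s by (intro mult_left_mono powr_mono2) auto
      also have "\<dots> = norm k powr (1 - s) * norm h powr (1 + s)"
        using p by (simp add: powr_add)
      finally show ?thesis .
    qed
    ultimately show ?thesis using N(2) by (meson mult_left_mono mult_nonneg_nonneg order_trans zero_le_numeral)
  next
    case False
    have "\<bar>diff2 w h x - diff2 w h y\<bar> \<le> 2 * N * (norm h)\<^sup>2"
      using N(1)[of h x] N(1)[of h y] by linarith
    also have "\<dots> \<le> 4 * N * (norm h)\<^sup>2" using N(2) by simp
    also have "(norm h)\<^sup>2 = norm h powr (1 - s) * norm h powr (1 + s)"
      using p by (simp flip: powr_add)
    also have "4 * N * \<dots> \<le> 4 * N * (norm k powr (1 - s) * norm h powr (1 + s))"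
      using False s N(2) by (intro mult_left_mono mult_right_mono powr_mono2) auto
    finally show ?thesis .
  qed
  then show ?thesis by (simp add: k_def mult_ac)
qed

text \<open>The radius \<open>R\<close> makes the near part of the kernel integral small compared
  with 1 / K, so that it can be absorbed; the far part is then merely finite and multiplies sup
  bounds. Everything here is chosen from the dimension and \<open>s\<close> alone.\<close>

locale apriori = averaging_kernels \<rho> \<psi> K
  for \<rho> \<psi> :: "'a::euclidean_space \<Rightarrow> real" and K +
  fixes s R J :: real
  assumes s: "0 < s" "s < 1" and J: "J \<ge> 1"
    and near_int: "integrable lborel (\<lambda>h::'a. kern s h * (indicator (cball 0 R) h * norm h powr (1 + s)))"
    and near: "(LINT h|lborel. kern s (h::'a) * (indicator (cball 0 R) h * norm h powr (1 + s))) \<le> (1 - s) / (8 * K)"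
    and far_int: "integrable lborel (\<lambda>h::'a. kern s h * indicator (- cball 0 R) h)"
    and far: "(LINT h|lborel. kern s (h::'a) * indicator (- cball 0 R) h) \<le> J"

lemma apriori_exists:
  assumes s: "0 < s" "s < 1"
  shows "\<exists>\<rho> \<psi> :: 'a::euclidean_space \<Rightarrow> real. \<exists>K R J. apriori \<rho> \<psi> K s R J"
proof -
  obtain \<rho> \<psi> :: "'a \<Rightarrow> real" and K where K: "averaging_kernels \<rho> \<psi> K" using averaging_kernels_ex by blast
  then have K0: "K > 0" by (simp add: averaging_kernels_def)
  have e: "(1 - s) / (8 * K) > 0" using K0 s by simp
  \<comment> \<open>Dominated convergence along shrinking balls: the integrands tend to 0 pointwise,
    at \<open>h = 0\<close> because the kernel has value 0 there.\<close>
  define R where "R n = 1 / (real n + 1)" for n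
  have R: "0 < R n" "R n \<le> 1" for n by (simp_all add: R_def)
  let ?N = "\<lambda>(n::nat) (h::'a). kern s h * (indicator (cball 0 (R n)) h * norm h powr (1 + s))"
  let ?m = "\<lambda>h::'a. kern s h * min 1 (norm h powr (1 + s))"
  have mb: "?N n \<in> borel_measurable lborel" for n
    by (intro borel_measurable_times borel_measurable_indicator) auto
  have Nb: "norm (?N n h) \<le> ?m h" for n h
  proof (cases "norm h \<le> R n")
    case True
    then have "norm h powr (1 + s) \<le> 1" using R(2)[of n] s by (intro powr_le1) auto
    then show ?thesis using kern_nonneg[of s h] True by simp
  qed (simp add: kern_nonneg)
  note mi = kern_integrable[OF s, where 'a='a]
  have "(\<lambda>n. LINT h|lborel. ?N n h) \<longlonglongrightarrow> (LINT h|(lborel :: 'a measure). (0::real))"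
  proof (rule integral_dominated_convergence[where w="?m"])
    have lim: "(\<lambda>n. ?N n h) \<longlonglongrightarrow> 0" for h :: 'a
    proof (cases "h = 0")
      case False
      then obtain n0 where n0: "1 / (real n0 + 1) < norm h"
        using reals_Archimedean[of "norm h"] by (auto simp: inverse_eq_divide add.commute)
      have "?N n h = 0" if "n \<ge> n0" for n
      proof -
        have "R n \<le> 1 / (real n0 + 1)" unfolding R_def using that by (intro divide_left_mono) auto
        then show ?thesis using n0 by simp
      qed
      then show ?thesis by (intro tendsto_eventually) (auto simp: eventually_sequentially)
    qed (simp add: kern_def)
    show "AE h in lborel. (\<lambda>n. ?N n h) \<longlonglongrightarrow> 0" using lim by (intro AE_I2)
    show "AE h in lborel. norm (?N n h) \<le> ?m h" for n using Nb by (intro AE_I2)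
  qed (use mb mi in auto)
  then have "eventually (\<lambda>n. (LINT h|lborel. ?N n h) < (1 - s) / (8 * K)) sequentially"
    using e by (intro order_tendstoD) auto
  then obtain n where n: "(LINT h|lborel. ?N n h) < (1 - s) / (8 * K)"
    by (auto simp: eventually_sequentially)
  let ?F = "\<lambda>h::'a. kern s h * indicator (- cball 0 (R n)) h"
  have Ni: "integrable lborel (?N n)"
  proof (rule Bochner_Integration.integrable_bound[OF mi mb])
    show "AE h in lborel. norm (?N n h) \<le> norm (?m h)"
      using Nb by (intro AE_I2) (metis abs_ge_self order_trans real_norm_def)
  qed
  have Fi: "integrable lborel ?F"
  proof (rule Bochner_Integration.integrable_bound)
    \<comment> \<open>Outside the ball \<open>min 1 (norm h powr (1 + s))\<close> is at least
      \<open>R n powr (1 + s)\<close>, as \<open>R n \<le> 1\<close>; the factor compensates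
      this.\<close>
    show "integrable lborel (\<lambda>h. R n powr (- (1 + s)) * ?m h)" by (intro integrable_mult_right mi)
    show "AE h in lborel. norm (?F h) \<le> norm (R n powr (- (1 + s)) * ?m h)"
    proof (rule AE_I2)
      fix h :: 'a
      show "norm (?F h) \<le> norm (R n powr (- (1 + s)) * ?m h)"
      proof (cases "norm h \<le> R n")
        case False
        have "R n powr (1 + s) \<le> min 1 (norm h powr (1 + s))"
          using False R[of n] s by (auto intro: powr_le1 powr_mono2)
        then have "R n powr (- (1 + s)) * R n powr (1 + s) \<le> R n powr (- (1 + s)) * min 1 (norm h powr (1 + s))"
          by (intro mult_left_mono) auto
        moreover have "R n powr (- (1 + s)) * R n powr (1 + s) = 1"
          using R(1)[of n] unfolding powr_add[symmetric] by simp
        ultimately have "1 \<le> R n powr (- (1 + s)) * min 1 (norm h powr (1 + s))" by simp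
        then have "kern s h * 1 \<le> kern s h * (R n powr (- (1 + s)) * min 1 (norm h powr (1 + s)))"
          by (intro mult_left_mono kern_nonneg)
        then show ?thesis using False kern_nonneg[of s h] by (simp add: abs_mult mult_ac)
      qed simp
    qed
    show "?F \<in> borel_measurable lborel"
      by (intro borel_measurable_times borel_measurable_indicator) auto
  qed
  have "apriori \<rho> \<psi> K s (R n) (max 1 (LINT h|lborel. ?F h))"
    unfolding apriori_def apriori_axioms_def using K s Ni n Fi by (auto simp: less_imp_le)
  then show ?thesis by blast
qed

section \<open>Estimates for the equation, with the nonlocal term absorbed\<close>

context apriori
begin

text \<open>The 8 is dictated by the second pass: with the factor 4 of \<open>diff2_hoelder\<close>,
  \<open>K * 4 * eps / (1 - s)\<close> is exactly 1/2.\<close>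

definition "eps = (1 - s) / (8 * K)"

lemma eps_pos: "eps > 0" using s K(1) by (simp add: eps_def)

text \<open>Inside radius \<open>R\<close> the bound of order 1 + s is used, outside it the sup
  bound. The function \<open>v\<close> will be a second difference at one point, or the difference
  of second differences at two points.\<close>

lemma nonlocal_bounds:
  assumes v: "\<And>h. \<bar>v h\<bar> \<le> Z * norm h powr (1 + s)" "\<And>h. \<bar>v h\<bar> \<le> m" and Z: "Z \<ge> 0"
  shows "\<bar>LINT h|lborel. kern s (h::'a) * v h\<bar> \<le> Z * eps + m * J"
    and "v \<in> borel_measurable borel \<Longrightarrow> integrable lborel (\<lambda>h::'a. kern s h * v h)"
proof -
  let ?g = "\<lambda>h::'a. Z * (kern s h * (indicator (cball 0 R) h * norm h powr (1 + s)))
      + m * (kern s h * indicator (- cball 0 R) h)"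
  have m: "m \<ge> 0" using v(2)[of 0] by linarith
  have b: "\<bar>kern s h * v h\<bar> \<le> ?g h" for h
  proof (cases "h \<in> cball 0 R")
    case True
    have "\<bar>kern s h * v h\<bar> \<le> kern s h * (Z * norm h powr (1 + s))"
      using v(1)[of h] kern_nonneg[of s h] by (simp add: abs_mult mult_left_mono)
    then show ?thesis using True by (simp add: mult_ac)
  next
    case False
    have "\<bar>kern s h * v h\<bar> \<le> kern s h * m"
      using v(2)[of h] kern_nonneg[of s h] by (simp add: abs_mult mult_left_mono)
    then show ?thesis using False by (simp add: mult_ac)
  qed
  have i: "integrable lborel ?g"
    by (intro Bochner_Integration.integrable_add integrable_mult_right near_int far_int)
  have "\<bar>LINT h|lborel. kern s (h::'a) * v h\<bar> \<le> (LINT h|lborel. ?g h)" by (rule abs_integral_le[OF i b])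
  also have "\<dots> = Z * (LINT h|lborel. kern s (h::'a) * (indicator (cball 0 R) h * norm h powr (1 + s)))
      + m * (LINT h|lborel. kern s (h::'a) * indicator (- cball 0 R) h)"
    using near_int far_int
    by (simp only: Bochner_Integration.integral_add integrable_mult_right integral_mult_right_zero)
  also have "\<dots> \<le> Z * eps + m * J"
    unfolding eps_def using Z m near far by (intro add_mono mult_left_mono) auto
  finally show "\<bar>LINT h|lborel. kern s (h::'a) * v h\<bar> \<le> Z * eps + m * J" .
  show "integrable lborel (\<lambda>h::'a. kern s h * v h)" if [measurable]: "v \<in> borel_measurable borel"
  proof (rule Bochner_Integration.integrable_bound[OF i])
    show "(\<lambda>h::'a. kern s h * v h) \<in> borel_measurable lborel" by measurable
    show "AE h in lborel. norm (kern s h * v h) \<le> norm (?g h)"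
      using b by (intro AE_I2) (metis abs_ge_self order_trans real_norm_def)
  qed
qed

text \<open>There is no factor 1/2 and no normalising constant: \<open>bilinear_form_eq\<close>
  turns the double integral over all pairs into the full integral of second differences.\<close>

definition solves :: "('a \<Rightarrow> real) \<Rightarrow> ('a \<Rightarrow> real) \<Rightarrow> bool" where
  "solves w f \<longleftrightarrow> (\<forall>x. laplacian w x = w x - (LINT h|lborel. kern s h * diff2 w h x) - f x)"

text \<open>The Laplacian is at most Z eps + (4 J + 2) Q with Z the closed constant of order 1 + s;
  \<open>4 * J\<close> is the far nonlocal part, and the 2 stands for \<open>w\<close> and
  \<open>f\<close>. The first summand is the resulting bound for Z eps / Q.\<close>

definition "c_lap = 2 * K * (1 + (4 * J + 2) / (1 - s)) * eps + (4 * J + 2)"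

definition "c_lip = K * (1 + c_lap)"

lemma c_pos: "c_lap > 0" "c_lip > 0"
proof -
  show "c_lap > 0" unfolding c_lap_def using K(1) J s eps_pos by (intro add_nonneg_pos mult_nonneg_nonneg add_nonneg_nonneg divide_nonneg_nonneg) auto
  then show "c_lip > 0" unfolding c_lip_def using K(1) by simp
qed

lemma diff2_bound: "(\<And>x. \<bar>w x\<bar> \<le> M) \<Longrightarrow> \<bar>diff2 w h x\<bar> \<le> 4 * M" for w :: "'a \<Rightarrow> real"
proof -
  assume "\<And>x. \<bar>w x\<bar> \<le> M"
  from this[of "x + h"] this[of "x - h"] this[of x] show ?thesis unfolding diff2_def by linarith
qed

text \<open>Both \<open>w\<close> and \<open>f\<close> are bounded by Q = M / T^2, as T is at most
  1. Second differences of order 1 + s are closed by absorption, which bounds the Laplacian by a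
  multiple of Q; first differences then follow at scale \<open>T\<close>.\<close>

lemma lipschitz_estimate:
  fixes w :: "'a \<Rightarrow> real"
  assumes w: "bounded_C2 w" "\<And>x. \<bar>w x\<bar> \<le> M" and T: "0 < T" "T \<le> 1"
    and f: "\<And>x. \<bar>f x\<bar> \<le> M / T\<^sup>2" and eq: "solves w f"
  shows "\<bar>w (x + h) - w x\<bar> \<le> c_lip * (M / T) * norm h"
proof -
  have M: "M \<ge> 0" using w(2)[of 0] by linarith
  have d4: "\<bar>diff2 w h x\<bar> \<le> 4 * M" for h x by (rule diff2_bound[OF w(2)])
  have T2: "T\<^sup>2 \<le> 1" "T\<^sup>2 > 0" using T by (auto simp: power_le_one)
  define Q where "Q = M / T\<^sup>2"
  have Q: "M \<le> Q" "Q \<ge> 0" using M T2 mult_left_mono[of "T\<^sup>2" 1 M] by (auto simp: Q_def le_divide_eq)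
  define c where "c = 4 * J + 2"
  have c: "c \<ge> 0" using J by (simp add: c_def)
  \<comment> \<open>The part of \<open>second_difference_estimate\<close> that does not contain the
    unknown constant \<open>Z\<close>.\<close>
  define P where "P = K * (M * T powr (- (1 + s)) + c * Q * T powr (1 - s) / (1 - s))"
  have P: "P \<ge> 0" unfolding P_def using K(1) M c Q s by auto
  have lap: "\<bar>laplacian w y\<bar> \<le> Z * eps + c * Q"
    if Z: "Z \<ge> 0" "\<And>h x. \<bar>diff2 w h x\<bar> \<le> Z * norm h powr (1 + s)" for Z y
  proof -
    have "\<bar>LINT h|lborel. kern s h * diff2 w h y\<bar> \<le> Z * eps + (4 * M) * J"
      by (rule nonlocal_bounds(1)) (use Z d4 in auto)
    moreover have "4 * M * J \<le> 4 * Q * J" using Q J by simp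
    moreover have "\<bar>w y\<bar> \<le> Q" "\<bar>f y\<bar> \<le> Q" using w(2)[of y] f[of y] Q by (auto simp: Q_def)
    moreover have "laplacian w y = w y - (LINT h|lborel. kern s h * diff2 w h y) - f y"
      using eq by (simp add: solves_def)
    moreover have "c * Q = 4 * Q * J + 2 * Q" by (simp add: c_def algebra_simps)
    ultimately show ?thesis by linarith
  qed
  obtain C where C: "\<And>b c x. b \<in> Basis \<Longrightarrow> c \<in> Basis \<Longrightarrow> \<bar>partial c (partial b w) x\<bar> \<le> C"
    using w(1) unfolding bounded_C2_def by blast
  \<comment> \<open>The qualitative start: the bound on second derivatives handles small
    \<open>h\<close>, the sup bound large \<open>h\<close>.\<close>
  define Z0 where "Z0 = max (DIM('a)\<^sup>2 * C) (4 * M)"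
  have "\<bar>case p of (h, x) \<Rightarrow> diff2 w h x\<bar> \<le> 2 * P * (case p of (h, x) \<Rightarrow> norm h powr (1 + s))" for p
  proof (rule absorb[where a="\<lambda>p. \<bar>case p of (h, x) \<Rightarrow> diff2 w h x\<bar>" and g="\<lambda>p. case p of (h, x) \<Rightarrow> norm h powr (1 + s)"])
    show Z0: "Z0 \<ge> 0" unfolding Z0_def using M by simp
    show "\<bar>case p of (h, x) \<Rightarrow> diff2 w h x\<bar> \<le> Z0 * (case p of (h, x) \<Rightarrow> norm h powr (1 + s))" for p
    proof (cases p)
      case (Pair h x)
      have "\<bar>diff2 w h x\<bar> \<le> (DIM('a)\<^sup>2 * C) * (norm h)\<^sup>2"
        using diff2_of_partials[of w C h x] C w(1) by (simp add: bounded_C2_def)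
      also have "\<dots> \<le> Z0 * (norm h)\<^sup>2" unfolding Z0_def by (intro mult_right_mono) auto
      finally have "\<bar>diff2 w h x\<bar> \<le> Z0 * norm h powr (1 + s)"
        using d4[of h x] by (intro powr_le_max s Z0) (auto simp: Z0_def)
      then show ?thesis using Pair by simp
    qed
    fix Z and p :: "'a \<times> 'a" assume Z: "Z \<ge> 0" "\<And>p. \<bar>case p of (h, x) \<Rightarrow> diff2 w h x\<bar> \<le> Z * (case p of (h, x) \<Rightarrow> norm h powr (1 + s))"
    obtain h x where p: "p = (h, x)" by force
    have Z': "\<bar>diff2 w h x\<bar> \<le> Z * norm h powr (1 + s)" for h x using Z(2)[of "(h, x)"] by simp
    have "\<bar>diff2 w h x\<bar> \<le> K * norm h powr (1 + s) * (M * T powr (- (1 + s)) + (Z * eps + c * Q) * T powr (1 - s) / (1 - s))"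
      by (rule second_difference_estimate[OF w lap[OF Z(1) Z'] T(1) s])
    also have "\<dots> = (K * (Z * eps * T powr (1 - s) / (1 - s)) + P) * norm h powr (1 + s)"
      unfolding P_def by (simp add: add_divide_distrib algebra_simps)
    also have "\<dots> \<le> (Z / 2 + P) * norm h powr (1 + s)"
    proof (intro mult_right_mono add_right_mono)
      have "K * (Z * eps * T powr (1 - s) / (1 - s)) = Z / 8 * T powr (1 - s)"
        unfolding eps_def using K(1) s by (simp add: field_simps)
      also have "\<dots> \<le> Z / 8 * 1" using Z(1) T s by (intro mult_left_mono powr_le1) auto
      also have "Z / 8 * 1 \<le> Z / 2" using Z(1) by simp
      finally show "K * (Z * eps * T powr (1 - s) / (1 - s)) \<le> Z / 2" .
    qed auto
    finally show "\<bar>case p of (h, x) \<Rightarrow> diff2 w h x\<bar> \<le> (Z / 2 + P) * (case p of (h, x) \<Rightarrow> norm h powr (1 + s))"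
      using p by simp
  qed (auto simp: P)
  from this[of "(_, _)"] have Zf: "\<bar>diff2 w h x\<bar> \<le> 2 * P * norm h powr (1 + s)" for h x by simp
  have TQ: "M * T powr (- (1 + s)) \<le> Q" "Q * T powr (1 - s) \<le> Q"
  proof -
    have "T powr (- (1 + s)) \<le> T powr (- 2)" using T s by (intro powr_mono') auto
    then have "M * T powr (- (1 + s)) \<le> M * T powr (- 2)" using M by (rule mult_left_mono)
    also have "\<dots> = Q" using T by (simp add: Q_def powr_minus_divide)
    finally show "M * T powr (- (1 + s)) \<le> Q" .
    show "Q * T powr (1 - s) \<le> Q" using Q T s powr_le1[of "1 - s" T] by (simp add: mult_left_le)
  qed
  have "P \<le> K * (1 + c / (1 - s)) * Q"
  proof -
    have "c * (Q * T powr (1 - s)) / (1 - s) \<le> c * Q / (1 - s)"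
      using TQ c s by (intro divide_right_mono mult_left_mono) auto
    then have "M * T powr (- (1 + s)) + c * Q * T powr (1 - s) / (1 - s) \<le> Q + c * Q / (1 - s)"
      using TQ by (simp add: mult.assoc)
    then have "P \<le> K * (Q + c * Q / (1 - s))" unfolding P_def using K(1) by (simp add: mult_left_mono)
    then show ?thesis by (simp add: algebra_simps)
  qed
  \<comment> \<open>The closed constant \<open>Z = 2 * P\<close> is fed back into
    \<open>lap\<close>, giving a Laplacian bound without unknowns.\<close>
  then have "2 * P * eps \<le> 2 * (K * (1 + c / (1 - s)) * Q) * eps"
    using eps_pos by (intro mult_right_mono) auto
  then have "2 * P * eps + c * Q \<le> c_lap * Q" unfolding c_lap_def c_def[symmetric] by (simp add: algebra_simps)
  moreover have "2 * P \<ge> 0" using P by simp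
  note lap[OF this Zf]
  ultimately have G: "\<bar>laplacian w y\<bar> \<le> c_lap * Q" for y by (meson order_trans)
  have "\<bar>w (x + h) - w x\<bar> \<le> K * norm h * (M / T + c_lap * Q * T)"
    by (rule first_difference_estimate[OF w G T(1)])
  also have "c_lap * Q * T = c_lap * (M / T)" using T(1) by (simp add: Q_def power2_eq_square)
  finally show ?thesis unfolding c_lip_def by (simp add: algebra_simps)
qed

text \<open>Up to distance \<open>T\<close> the Lipschitz bound is weakened to a power of the
  distance in units of \<open>T\<close>; beyond it the trivial bound \<open>2 * M\<close> is enough.
  The constant \<open>2 + c_lip\<close> serves both.\<close>

lemma hoelder_of_lipschitz:
  fixes w :: "'a \<Rightarrow> real"
  assumes w: "\<And>x. \<bar>w x\<bar> \<le> M" and T: "0 < T"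
    and lip: "\<And>x h. \<bar>w (x + h) - w x\<bar> \<le> c_lip * (M / T) * norm h"
  shows "\<bar>w x - w y\<bar> \<le> (2 + c_lip) * M * (norm (x - y) / T) powr (1 - s)"
proof -
  let ?\<gamma> = "1 - s"
  have \<gamma>: "0 < ?\<gamma>" "?\<gamma> < 1" using s by auto
  have M: "M \<ge> 0" using w[of 0] by linarith
  define L where "L = 2 + c_lip"
  have L: "L \<ge> 0" "c_lip \<le> L" "2 \<le> L" using c_pos by (auto simp: L_def)
  have "\<bar>w x - w y\<bar> \<le> L * M * (norm (x - y) / T) powr ?\<gamma>"
  proof (cases "norm (x - y) \<le> T")
    case True
    have r: "norm (x - y) / T \<le> 1" using True T by simp
    have "\<bar>w x - w y\<bar> \<le> (c_lip * M) * (norm (x - y) / T)"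
      using lip[of y "x - y"] by simp
    also have "\<dots> \<le> (L * M) * (norm (x - y) / T) powr ?\<gamma>"
    proof (intro mult_mono)
      show "norm (x - y) / T \<le> (norm (x - y) / T) powr ?\<gamma>"
        using powr_mono'[of ?\<gamma> 1 "norm (x - y) / T"] r T \<gamma> by simp
    qed (use L M T in \<open>auto intro: mult_right_mono\<close>)
    finally show ?thesis .
  next
    case False
    have "\<bar>w x - w y\<bar> \<le> 2 * M" using w[of x] w[of y] by linarith
    also have "\<dots> \<le> (L * M) * 1" using L M by (simp add: mult_right_mono)
    also have "\<dots> \<le> (L * M) * (norm (x - y) / T) powr ?\<gamma>"
      using False T \<gamma> L M by (intro mult_left_mono ge_one_powr_ge_zero) auto
    finally show ?thesis .
  qed
  then show ?thesis by (simp add: L_def)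
qed

text \<open>The 1 comes from the average at scale \<open>T\<close>. In the sum over
  \<open>1 - s\<close> the terms are the Hoelder constants of the far nonlocal part, of
  \<open>w\<close> and of \<open>f\<close>; the division is the integral over scales, and the
  leading 2 is the cost of absorption.\<close>

definition "c_two F = 2 * K * (1 + (4 * J * (2 + c_lip) + (2 + c_lip) + F) / (1 - s))"

text \<open>A bound N |h|^2 makes the nonlocal term Hoelder continuous with constant proportional to
  \<open>N * eps\<close>, hence the whole Laplacian, which in turn improves \<open>N\<close> to half
  of it plus known terms. The modulus of \<open>f\<close> is an assumption because \<open>f\<close>
  will be a mollified nonlinearity, not a function of \<open>w\<close>.\<close>

lemma second_difference_apriori:
  fixes w :: "'a \<Rightarrow> real"
  assumes w: "bounded_C2 w" "\<And>x. \<bar>w x\<bar> \<le> M" and T: "0 < T" "T \<le> 1"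
    and lip: "\<And>x h. \<bar>w (x + h) - w x\<bar> \<le> c_lip * (M / T) * norm h"
    and F: "F \<ge> 0" and f: "\<And>x y. \<bar>f x - f y\<bar> \<le> F * (M / T\<^sup>2) * (norm (x - y) / T) powr (1 - s)"
    and eq: "solves w f"
  shows "\<bar>diff2 w h x\<bar> \<le> c_two F * (M / T\<^sup>2) * (norm h)\<^sup>2"
proof -
  let ?\<gamma> = "1 - s"
  have \<gamma>: "0 < ?\<gamma>" "?\<gamma> < 1" using s by auto
  have M: "M \<ge> 0" using w(2)[of 0] by linarith
  have d4: "\<bar>diff2 w h x\<bar> \<le> 4 * M" for h x by (rule diff2_bound[OF w(2)])
  have T2: "T\<^sup>2 \<le> 1" "T\<^sup>2 > 0" using T by (auto simp: power_le_one)
  define Q where "Q = M / T\<^sup>2"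
  have Q: "M \<le> Q" "Q \<ge> 0" using M T2 mult_left_mono[of "T\<^sup>2" 1 M] by (auto simp: Q_def le_divide_eq)
  define L where "L = 2 + c_lip"
  have L: "L \<ge> 0" "c_lip \<le> L" "2 \<le> L" using c_pos by (auto simp: L_def)
  define c where "c = 4 * J * L + L + F"
  have c: "c \<ge> 0" using J L F by (simp add: c_def)
  define P where "P = K * (1 + c / ?\<gamma>) * Q"
  have P: "P \<ge> 0" unfolding P_def using K(1) c Q \<gamma> by auto
  note wh = hoelder_of_lipschitz[OF w(2) T(1) lip, folded L_def]
  have dm: "(\<lambda>h. diff2 w h x) \<in> borel_measurable borel" for x
  proof -
    have [measurable]: "w \<in> borel_measurable borel" using w(1) smooth_borel[of w] by (auto simp: bounded_C2_def)
    show ?thesis unfolding diff2_def by measurable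
  qed
  have lap: "\<bar>laplacian w x - laplacian w y\<bar> \<le> (4 * N * eps + c * Q * T powr (- ?\<gamma>)) * norm (x - y) powr ?\<gamma>"
    if N: "N \<ge> 0" "\<And>h x. \<bar>diff2 w h x\<bar> \<le> N * (norm h)\<^sup>2" for N x y
  proof -
    define r where "r = norm (x - y) powr ?\<gamma>"
    define r' where "r' = (norm (x - y) / T) powr ?\<gamma>"
    have "r' = r / T powr ?\<gamma>" using T by (simp add: r_def r'_def powr_divide)
    also have "\<dots> = T powr (- ?\<gamma>) * r" by (simp only: powr_minus_divide times_divide_eq_left mult_1_left)
    finally have r: "r' = T powr (- ?\<gamma>) * r" "r \<ge> 0" "r' \<ge> 0" by (auto simp: r_def r'_def)
    let ?v = "\<lambda>h. diff2 w h x - diff2 w h y"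
    \<comment> \<open>The integral of the difference splits only if both integrals converge; this
      uses a crude constant that enters no estimate.\<close>
    have i: "integrable lborel (\<lambda>h. kern s h * diff2 w h x)" for x
    proof (rule nonlocal_bounds(2)[where Z="max N (4 * M)" and m="4 * M"])
      show "\<bar>diff2 w h x\<bar> \<le> max N (4 * M) * norm h powr (1 + s)" for h
      proof (rule powr_le_max[OF s])
        have "\<bar>diff2 w h x\<bar> \<le> N * (norm h)\<^sup>2" by (rule N(2))
        also have "\<dots> \<le> max N (4 * M) * (norm h)\<^sup>2" by (intro mult_right_mono) auto
        finally show "\<bar>diff2 w h x\<bar> \<le> \<dots>" .
        show "\<bar>diff2 w h x\<bar> \<le> max N (4 * M)" using d4[of h x] by simp
      qed (use N(1) in auto)
    qed (use d4 N(1) dm in auto)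
    \<comment> \<open>The near part uses the Hoelder modulus of second differences, the far part
      only that of \<open>w\<close>, so that \<open>N\<close> is multiplied by the small
      \<open>eps\<close> alone.\<close>
    have "\<bar>LINT h|lborel. kern s h * ?v h\<bar> \<le> (4 * N * r) * eps + (4 * (L * M * r')) * J"
    proof (rule nonlocal_bounds(1))
      show "\<bar>?v h\<bar> \<le> (4 * N * r) * norm h powr (1 + s)" for h
        unfolding r_def by (rule diff2_hoelder[OF N(2,1) s])
      show "\<bar>?v h\<bar> \<le> 4 * (L * M * r')" for h
      proof -
        have "\<bar>w (x + h) - w (y + h)\<bar> \<le> L * M * r'" "\<bar>w (x - h) - w (y - h)\<bar> \<le> L * M * r'" "\<bar>w x - w y\<bar> \<le> L * M * r'"
          using wh[of "x + h" "y + h"] wh[of "x - h" "y - h"] wh[of x y] by (simp_all add: r'_def)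
        then show ?thesis unfolding diff2_def by linarith
      qed
    qed (use N r in auto)
    moreover have "(LINT h|lborel. kern s h * ?v h) = (LINT h|lborel. kern s h * diff2 w h x) - (LINT h|lborel. kern s h * diff2 w h y)"
      using i by (simp add: right_diff_distrib)
    moreover have "laplacian w z = w z - (LINT h|lborel. kern s h * diff2 w h z) - f z" for z
      using eq by (simp add: solves_def)
    note this[of x] this[of y]
    moreover have "\<bar>w x - w y\<bar> \<le> L * M * r'" using wh by (simp add: r'_def)
    moreover have "\<bar>f x - f y\<bar> \<le> F * Q * r'" using f by (simp add: r'_def Q_def)
    ultimately have "\<bar>laplacian w x - laplacian w y\<bar> \<le> (4 * N * r) * eps + (4 * (L * M * r')) * J + L * M * r' + F * Q * r'"
      by linarith
    also have "\<dots> = (4 * N * r) * eps + (4 * J * L + L) * r' * M + F * Q * r'" by (simp add: algebra_simps)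
    also have "\<dots> \<le> (4 * N * r) * eps + (4 * J * L + L) * r' * Q + F * Q * r'"
      using Q(1) r(2,3) J L by (intro add_right_mono add_left_mono mult_left_mono) auto
    also have "\<dots> = (4 * N * eps + c * Q * T powr (- ?\<gamma>)) * r"
      unfolding r(1) c_def by (simp add: algebra_simps)
    finally show ?thesis unfolding r_def .
  qed
  obtain C where C: "\<And>b c x. b \<in> Basis \<Longrightarrow> c \<in> Basis \<Longrightarrow> \<bar>partial c (partial b w) x\<bar> \<le> C"
    using w(1) unfolding bounded_C2_def by blast
  have "\<bar>case p of (h, x) \<Rightarrow> diff2 w h x\<bar> \<le> 2 * P * (case p of (h, x) \<Rightarrow> (norm h)\<^sup>2)" for p
  proof (rule absorb[where a="\<lambda>p. \<bar>case p of (h, x) \<Rightarrow> diff2 w h x\<bar>" and g="\<lambda>p. case p of (h, x) \<Rightarrow> (norm h)\<^sup>2"])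
    show "max 0 (DIM('a)\<^sup>2 * C) \<ge> 0" by simp
    show "\<bar>case p of (h, x) \<Rightarrow> diff2 w h x\<bar> \<le> max 0 (DIM('a)\<^sup>2 * C) * (case p of (h, x) \<Rightarrow> (norm h)\<^sup>2)" for p
    proof (cases p)
      case (Pair h x)
      have "\<bar>diff2 w h x\<bar> \<le> (DIM('a)\<^sup>2 * C) * (norm h)\<^sup>2"
        using diff2_of_partials[of w C h x] C w(1) by (simp add: bounded_C2_def)
      also have "\<dots> \<le> max 0 (DIM('a)\<^sup>2 * C) * (norm h)\<^sup>2" by (intro mult_right_mono) auto
      finally show ?thesis using Pair by simp
    qed
    fix N and p :: "'a \<times> 'a" assume N: "N \<ge> 0" "\<And>p. \<bar>case p of (h, x) \<Rightarrow> diff2 w h x\<bar> \<le> N * (case p of (h, x) \<Rightarrow> (norm h)\<^sup>2)"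
    obtain h x where p: "p = (h, x)" by force
    have N': "\<bar>diff2 w h x\<bar> \<le> N * (norm h)\<^sup>2" for h x using N(2)[of "(h, x)"] by simp
    have "\<bar>diff2 w h x\<bar> \<le> K * (norm h)\<^sup>2 * (M / T\<^sup>2 + (4 * N * eps + c * Q * T powr (- ?\<gamma>)) * T powr ?\<gamma> / ?\<gamma>)"
      by (rule second_difference_estimate_hoelder[OF w lap[OF N(1) N'] T(1) \<gamma>])
    also have "(4 * N * eps + c * Q * T powr (- ?\<gamma>)) * T powr ?\<gamma> = 4 * N * eps * T powr ?\<gamma> + c * Q * (T powr (- ?\<gamma>) * T powr ?\<gamma>)"
      by (simp add: algebra_simps)
    also have "T powr (- ?\<gamma>) * T powr ?\<gamma> = 1" using T unfolding powr_add[symmetric] by simp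
    also have "K * (norm h)\<^sup>2 * (M / T\<^sup>2 + (4 * N * eps * T powr ?\<gamma> + c * Q * 1) / ?\<gamma>)
      = (K * (4 * N * eps * T powr ?\<gamma> / ?\<gamma>) + P) * (norm h)\<^sup>2"
      unfolding P_def Q_def by (simp add: add_divide_distrib algebra_simps)
    also have "\<dots> \<le> (N / 2 + P) * (norm h)\<^sup>2"
    proof (intro mult_right_mono add_right_mono)
      have "K * (4 * N * eps * T powr ?\<gamma> / ?\<gamma>) = N / 2 * T powr ?\<gamma>"
        unfolding eps_def using K(1) s by (simp add: field_simps)
      also have "\<dots> \<le> N / 2 * 1" using N(1) T s by (intro mult_left_mono powr_le1) auto
      finally show "K * (4 * N * eps * T powr ?\<gamma> / ?\<gamma>) \<le> N / 2" by simp
    qed auto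
    finally show "\<bar>case p of (h, x) \<Rightarrow> diff2 w h x\<bar> \<le> (N / 2 + P) * (case p of (h, x) \<Rightarrow> (norm h)\<^sup>2)"
      using p by simp
  qed (auto simp: P)
  from this[of "(h, x)"] show ?thesis
    by (simp add: P_def c_two_def c_def L_def Q_def)
qed

end

section \<open>Regularity from second differences\<close>

text \<open>\<open>E\<close> vanishes on the integers, so E(n c) equals \<open>E\<close> at the
  fractional part of n c and is at most \<open>B\<close>; thus n |E c| is bounded in n. It yields
  real homogeneity of the directional derivatives.\<close>

lemma additive_bounded_eq_0:
  fixes E :: "real \<Rightarrow> real"
  assumes add: "\<And>a b. E (a + b) = E a + E b" and bd: "\<And>c. \<bar>E c\<bar> \<le> B * \<bar>c\<bar>" and one: "E 1 = 0"
  shows "E c = 0"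
proof (rule ccontr)
  assume ne: "E c \<noteq> 0"
  have E0: "E 0 = 0" using add[of 0 0] by simp
  have nat: "E (real n * a) = real n * E a" for n a
    by (induction n) (simp_all add: E0 add distrib_right)
  have neg: "E (- a) = - E a" for a using add[of a "- a"] E0 by simp
  have int: "E (of_int m) = 0" for m :: int
  proof (cases "m \<ge> 0")
    case True
    then show ?thesis using nat[of "nat m" 1] one by simp
  next
    case False
    then show ?thesis using nat[of "nat (- m)" 1] neg[of "of_int m"] one by simp
  qed
  have B: "B \<ge> 0" using bd[of 1] one by simp
  have "real n * \<bar>E c\<bar> \<le> B" for n
  proof -
    let ?m = "of_int \<lfloor>real n * c\<rfloor> :: real"
    have "E (real n * c) = E (real n * c - ?m) + E ?m" using add[of "real n * c - ?m" ?m] by simp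
    then have "\<bar>E (real n * c - ?m)\<bar> = \<bar>real n * E c\<bar>" using int by (simp add: nat)
    then have "real n * \<bar>E c\<bar> = \<bar>E (real n * c - ?m)\<bar>" by (simp add: abs_mult)
    also have "\<dots> \<le> B * \<bar>real n * c - ?m\<bar>" by (rule bd)
    also have "\<dots> \<le> B * 1" using B by (intro mult_left_mono) linarith+
    finally show ?thesis by simp
  qed
  moreover obtain n where "B < real n * \<bar>E c\<bar>"
    using ne reals_Archimedean3[of "\<bar>E c\<bar>"] by auto
  ultimately show False by (meson not_le)
qed

text \<open>The directional derivatives are limits of dyadic difference quotients, which converge
  geometrically; additivity comes from mixed differences.\<close>

lemma differentiable_of_diff2:
  fixes w :: "'a::euclidean_space \<Rightarrow> real"
  assumes N: "\<And>h x. \<bar>diff2 w h x\<bar> \<le> N * (norm h)\<^sup>2" and L: "\<And>x h. \<bar>w (x + h) - w x\<bar> \<le> L * norm h"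
  shows "\<exists>D. (\<forall>x. (w has_derivative D x) (at x)) \<and> (\<forall>x h. \<bar>D x h\<bar> \<le> L * norm h) \<and>
    (\<forall>x k h. \<bar>D (x + k) h - D x h\<bar> \<le> 2 * N * norm k * norm h)"
proof -
  obtain b :: 'a where b: "b \<in> Basis" using nonempty_Basis by blast
  have N0: "N \<ge> 0" using N[of b 0] b by simp
  define d where "d x h k = 2 ^ k * (w (x + (1/2) ^ k *\<^sub>R h) - w x)" for x h k
  have step: "\<bar>d x h (Suc k) - d x h k\<bar> \<le> (N * (norm h)\<^sup>2 / 4) * (1/2) ^ k" for x h k
  proof -
    let ?g = "(1/2) ^ Suc k *\<^sub>R h"
    \<comment> \<open>Consecutive dyadic quotients use steps 2g and g; their difference is a second
      difference centred at \<open>x + ?g\<close>.\<close>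
    have "?g + ?g = (1/2) ^ k *\<^sub>R h" by (simp flip: scaleR_left_distrib)
    then have "d x h k - d x h (Suc k) = 2 ^ k * diff2 w ?g (x + ?g)"
      by (simp add: d_def diff2_def add.assoc right_diff_distrib distrib_left)
    then have "\<bar>d x h (Suc k) - d x h k\<bar> = 2 ^ k * \<bar>diff2 w ?g (x + ?g)\<bar>"
      by (metis abs_minus_commute abs_mult abs_of_nonneg zero_le_numeral zero_le_power)
    also have "\<dots> \<le> 2 ^ k * (N * (norm ?g)\<^sup>2)" by (intro mult_left_mono N) auto
    also have "\<dots> = (N * (norm h)\<^sup>2 / 4) * (2 ^ k * (1/2) ^ k * (1/2) ^ k)"
      by (simp add: power_mult_distrib power2_eq_square)
    also have "2 ^ k * (1/2) ^ k * (1/2) ^ k = ((1/2) ^ k :: real)"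
      by (simp flip: power_mult_distrib)
    finally show ?thesis .
  qed
  have "convergent (d x h)" for x h
  proof -
    have "summable (\<lambda>k. d x h (Suc k) - d x h k)"
    proof (rule summable_comparison_test')
      show "summable (\<lambda>k. (N * (norm h)\<^sup>2 / 4) * (1/2 :: real) ^ k)"
        by (intro summable_mult summable_geometric) simp
      show "norm (d x h (Suc k) - d x h k) \<le> (N * (norm h)\<^sup>2 / 4) * (1/2) ^ k" for k
        using step by simp
    qed
    then have "convergent (\<lambda>n. d x h n - d x h 0)"
      unfolding summable_iff_convergent sum_lessThan_telescope .
    from convergent_add[OF this convergent_const[of "d x h 0"]] show ?thesis by simp
  qed
  then obtain D where D: "\<And>x h. d x h \<longlonglongrightarrow> D x h" unfolding convergent_def by metis
  \<comment> \<open>\<open>d x h 0\<close> is the full increment, so its distance from the limit is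
    the Taylor remainder; the 2 bounds the geometric sum.\<close>
  have taylor: "\<bar>w (x + h) - w x - D x h\<bar> \<le> (N * (norm h)\<^sup>2 / 4) * 2" for x h
  proof -
    have "\<bar>d x h k - d x h 0\<bar> \<le> (N * (norm h)\<^sup>2 / 4) * (\<Sum>j<k. (1/2) ^ j)" for k
    proof (induction k)
      case (Suc k)
      have "\<bar>d x h (Suc k) - d x h 0\<bar> \<le> (N * (norm h)\<^sup>2 / 4) * (\<Sum>j<k. (1/2) ^ j) + (N * (norm h)\<^sup>2 / 4) * (1/2) ^ k"
        using Suc step[of x h k] by linarith
      then show ?case by (simp only: sum.lessThan_Suc distrib_left)
    qed simp
    moreover have "(\<Sum>j<k. (1/2) ^ j) \<le> (2 :: real)" for k
      by (simp add: sum_gp_strict)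
    ultimately have "\<bar>d x h k - d x h 0\<bar> \<le> (N * (norm h)\<^sup>2 / 4) * 2" for k
      using N0 by (meson mult_left_mono order_trans divide_nonneg_nonneg mult_nonneg_nonneg zero_le_power2 zero_le_numeral)
    moreover have "(\<lambda>k. \<bar>d x h k - d x h 0\<bar>) \<longlonglongrightarrow> \<bar>D x h - d x h 0\<bar>" by (intro tendsto_intros D)
    ultimately have "\<bar>D x h - d x h 0\<bar> \<le> (N * (norm h)\<^sup>2 / 4) * 2" by (intro LIMSEQ_le_const2) auto
    then show ?thesis by (simp add: d_def abs_minus_commute)
  qed
  have Db: "\<bar>D x h\<bar> \<le> L * norm h" for x h
  proof -
    have "\<bar>d x h k\<bar> \<le> L * norm h" for k
    proof -
      have "\<bar>d x h k\<bar> = 2 ^ k * \<bar>w (x + (1/2) ^ k *\<^sub>R h) - w x\<bar>" by (simp add: d_def abs_mult)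
      also have "\<dots> \<le> 2 ^ k * (L * norm ((1/2) ^ k *\<^sub>R h))" by (intro mult_left_mono L) simp
      also have "\<dots> = (2 ^ k * (1/2) ^ k) * (L * norm h)" by simp
      also have "2 ^ k * (1/2) ^ k = (1 :: real)" by (simp flip: power_mult_distrib)
      finally show ?thesis by simp
    qed
    moreover have "(\<lambda>k. \<bar>d x h k\<bar>) \<longlonglongrightarrow> \<bar>D x h\<bar>" by (intro tendsto_intros D)
    ultimately show ?thesis by (intro LIMSEQ_le_const2) auto
  qed
  have half0: "(\<lambda>k. c * (1/2) ^ k) \<longlonglongrightarrow> 0" for c :: real
    using tendsto_mult_left[OF LIMSEQ_power_zero[of "1/2 :: real"], of c] by simp
  have add: "D x (g + h) = D x g + D x h" for x g h
  proof -
    let ?c = "N * ((norm g)\<^sup>2 + (norm h)\<^sup>2) / 2"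
    have "\<bar>d x (g + h) k - d x g k - d x h k\<bar> \<le> ?c * (1/2) ^ k" for k
    proof -
      let ?g = "(1/2) ^ k *\<^sub>R g" and ?h = "(1/2) ^ k *\<^sub>R h"
      have "d x (g + h) k - d x g k - d x h k = 2 ^ k * mixed_diff w ?g ?h x"
        by (simp add: d_def mixed_diff_def scaleR_add_right algebra_simps)
      then have "\<bar>d x (g + h) k - d x g k - d x h k\<bar> = 2 ^ k * \<bar>mixed_diff w ?g ?h x\<bar>"
        by (simp add: abs_mult)
      also have "\<dots> \<le> 2 ^ k * (N * ((norm ?g)\<^sup>2 + (norm ?h)\<^sup>2) / 2)"
        by (intro mult_left_mono mixed_diff_le N) auto
      also have "\<dots> = ?c * (2 ^ k * (1/2) ^ k * (1/2) ^ k)"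
        by (simp add: power_mult_distrib power2_eq_square algebra_simps)
      also have "2 ^ k * (1/2) ^ k * (1/2) ^ k = ((1/2) ^ k :: real)"
        by (simp flip: power_mult_distrib)
      finally show ?thesis .
    qed
    then have "(\<lambda>k. d x (g + h) k - d x g k - d x h k) \<longlonglongrightarrow> 0"
      by (intro Lim_null_comparison[OF _ half0[of ?c]] always_eventually) auto
    moreover have "(\<lambda>k. d x (g + h) k - d x g k - d x h k) \<longlonglongrightarrow> D x (g + h) - D x g - D x h"
      by (intro tendsto_intros D)
    ultimately show ?thesis using LIMSEQ_unique by fastforce
  qed
  have lip: "\<bar>D (x + k) h - D x h\<bar> \<le> 2 * N * norm k * norm h" for x k h
  proof (cases "k = 0")
    case False
    \<comment> \<open>From \<open>n0\<close> on the dyadic step is shorter than \<open>k\<close>, as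
      required for the product bound on mixed differences.\<close>
    obtain n0 where n0: "(1/2) ^ n0 * norm h < norm k"
    proof -
      have "eventually (\<lambda>n. norm h * (1/2) ^ n < norm k) sequentially"
        using half0[of "norm h"] False by (intro order_tendstoD) auto
      then show thesis using that by (auto simp: eventually_sequentially mult.commute)
    qed
    have "\<bar>d (x + k) h n - d x h n\<bar> \<le> 2 * N * norm k * norm h" if "n \<ge> n0" for n
    proof -
      let ?h = "(1/2) ^ n *\<^sub>R h"
      have "norm ?h \<le> (1/2) ^ n0 * norm h" using that by (simp add: mult_right_mono power_decreasing)
      then have kh: "norm ?h \<le> norm k" using n0 by linarith
      have "d (x + k) h n - d x h n = 2 ^ n * mixed_diff w k ?h x"
        by (simp add: d_def mixed_diff_def algebra_simps)
      then have "\<bar>d (x + k) h n - d x h n\<bar> = 2 ^ n * \<bar>mixed_diff w k ?h x\<bar>" by (simp add: abs_mult)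
      also have "\<dots> \<le> 2 ^ n * (2 * N * norm k * norm ?h)"
        by (intro mult_left_mono mixed_diff_product N N0 kh) auto
      also have "\<dots> = (2 ^ n * (1/2) ^ n) * (2 * N * norm k * norm h)" by simp
      also have "2 ^ n * (1/2) ^ n = (1 :: real)" by (simp flip: power_mult_distrib)
      finally show ?thesis by simp
    qed
    moreover have "(\<lambda>n. \<bar>d (x + k) h n - d x h n\<bar>) \<longlonglongrightarrow> \<bar>D (x + k) h - D x h\<bar>" by (intro tendsto_intros D)
    ultimately show ?thesis by (intro LIMSEQ_le_const2) auto
  qed simp
  have hom: "D x (c *\<^sub>R h) = c * D x h" for x c h
  proof -
    have "D x (c *\<^sub>R h) - c * D x h = 0"
    proof (rule additive_bounded_eq_0[where E="\<lambda>c. D x (c *\<^sub>R h) - c * D x h" and B="2 * (L * norm h)"])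
      show "D x ((a + b) *\<^sub>R h) - (a + b) * D x h = (D x (a *\<^sub>R h) - a * D x h) + (D x (b *\<^sub>R h) - b * D x h)" for a b
        by (simp add: scaleR_left_distrib add distrib_right)
      show "\<bar>D x (c *\<^sub>R h) - c * D x h\<bar> \<le> 2 * (L * norm h) * \<bar>c\<bar>" for c
      proof -
        have "\<bar>D x (c *\<^sub>R h)\<bar> \<le> L * norm h * \<bar>c\<bar>" using Db[of x "c *\<^sub>R h"] by (simp add: mult_ac)
        moreover have "\<bar>c * D x h\<bar> \<le> L * norm h * \<bar>c\<bar>"
          using mult_right_mono[OF Db[of x h] abs_ge_zero[of c]] by (simp add: abs_mult mult.commute)
        ultimately show ?thesis by linarith
      qed
    qed simp
    then show ?thesis by simp
  qed
  have "(w has_derivative D x) (at x)" for x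
  proof (rule has_derivativeI_sandwich[of 1 _ _ _ _ "\<lambda>y. (N / 2) * norm (y - x)"])
    show "bounded_linear (D x)"
      by (rule bounded_linear_intro[of _ L]) (use add hom Db in \<open>auto simp: mult.commute\<close>)
    show "norm (w y - w x - D x (y - x)) / norm (y - x) \<le> (N / 2) * norm (y - x)" if "y \<noteq> x" for y
      using taylor[of x "y - x"] that by (simp add: divide_le_eq power2_eq_square mult_ac)
    have "((\<lambda>y. (N / 2) * norm (y - x)) \<longlongrightarrow> (N / 2) * norm (x - x)) (at x)" by (intro tendsto_intros)
    then show "((\<lambda>y. (N / 2) * norm (y - x)) \<longlongrightarrow> 0) (at x)" by simp
  qed simp
  then show ?thesis using Db lip by blast
qed

text \<open>The gradient is bounded by \<open>L\<close> and has Lipschitz constant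
  \<open>2 * N\<close>. Pairs at distance at most 1 use the latter, other pairs twice the former,
  and the sum serves both.\<close>

lemma C1_hoelder_of_differences:
  fixes w :: "'a::euclidean_space \<Rightarrow> real"
  assumes M: "\<And>x. \<bar>w x\<bar> \<le> M" and L: "\<And>x h. \<bar>w (x + h) - w x\<bar> \<le> L * norm h"
    and N: "\<And>h x. \<bar>diff2 w h x\<bar> \<le> N * (norm h)\<^sup>2" and \<alpha>: "0 < \<alpha>" "\<alpha> < 1"
  shows "w \<in> C1_hoelder \<alpha> \<and> C1_hoelder_norm \<alpha> w \<le> M + L + (2 * N + 2 * L)"
proof -
  obtain b :: 'a where b: "b \<in> Basis" using nonempty_Basis by blast
  then have b1: "norm b = 1" "b \<noteq> 0" by auto
  have N0: "N \<ge> 0" using N[of b 0] b1 by simp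
  have L0: "L \<ge> 0" using L[of 0 b] b1 by simp
  obtain D where D: "\<And>x. (w has_derivative D x) (at x)" "\<And>x h. \<bar>D x h\<bar> \<le> L * norm h"
    "\<And>x k h. \<bar>D (x + k) h - D x h\<bar> \<le> 2 * N * norm k * norm h"
    using differentiable_of_diff2[OF N L] by blast
  have fd: "frechet_derivative w (at x) = D x" for x using frechet_derivative_at[OF D(1)] by simp
  have g: "grad w x \<bullet> h = D x h" for x h
  proof -
    have l: "linear (D x)" using has_derivative_linear[OF D(1)] .
    have "D x h = D x (\<Sum>b\<in>Basis. (h \<bullet> b) *\<^sub>R b)" by (simp add: euclidean_representation)
    also have "\<dots> = (\<Sum>b\<in>Basis. (h \<bullet> b) * D x b)" by (simp add: linear_sum[OF l] linear_scale[OF l])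
    also have "\<dots> = grad w x \<bullet> h" by (simp add: grad_def fd inner_sum_left inner_commute[of h] mult.commute)
    finally show ?thesis by simp
  qed
  have n: "norm v \<le> c" if "v \<bullet> v \<le> c * norm v" "c \<ge> 0" for v :: 'a and c
    using that by (cases "v = 0") (auto simp: power2_norm_eq_inner[symmetric] power2_eq_square)
  have gb: "norm (grad w x) \<le> L" for x
    by (rule n[OF _ L0]) (use D(2)[of x "grad w x"] in \<open>simp add: g\<close>)
  have gl: "norm (grad w x - grad w y) \<le> 2 * N * norm (x - y)" for x y
  proof (rule n)
    let ?v = "grad w x - grad w y"
    have "?v \<bullet> ?v = D x ?v - D y ?v" unfolding inner_diff_left[of "grad w x"] by (simp only: g)
    also have "\<dots> \<le> 2 * N * norm (x - y) * norm ?v" using D(3)[of y "x - y" ?v] by simp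
    finally show "?v \<bullet> ?v \<le> 2 * N * norm (x - y) * norm ?v" .
  qed (use N0 in auto)
  have hq: "q \<le> 2 * N + 2 * L" if q: "q \<in> hoelder_quotients \<alpha> (grad w)" for q
  proof -
    obtain x y where xy: "x \<noteq> y" "q = norm (grad w x - grad w y) / norm (x - y) powr \<alpha>"
      using q unfolding hoelder_quotients_def by blast
    then have p: "norm (x - y) > 0" by simp
    have "norm (grad w x - grad w y) \<le> (2 * N + 2 * L) * norm (x - y) powr \<alpha>"
    proof (cases "norm (x - y) \<le> 1")
      case True
      have "norm (x - y) \<le> norm (x - y) powr \<alpha>"
        using powr_mono'[of \<alpha> 1 "norm (x - y)"] True \<alpha> by simp
      then have "2 * N * norm (x - y) \<le> (2 * N + 2 * L) * norm (x - y) powr \<alpha>"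
        using N0 L0 by (intro mult_mono) auto
      then show ?thesis using gl[of x y] by linarith
    next
      case False
      have "norm (grad w x - grad w y) \<le> 2 * L"
        using gb[of x] gb[of y] norm_triangle_ineq4[of "grad w x" "grad w y"] by linarith
      also have "\<dots> \<le> (2 * N + 2 * L) * 1" using N0 by simp
      also have "\<dots> \<le> (2 * N + 2 * L) * norm (x - y) powr \<alpha>"
        using False \<alpha> N0 L0 by (intro mult_left_mono ge_one_powr_ge_zero) auto
      finally show ?thesis .
    qed
    then show ?thesis using p xy(2) by (simp add: divide_le_eq)
  qed
  have ne: "hoelder_quotients \<alpha> (grad w) \<noteq> {}" unfolding hoelder_quotients_def using b1(2) by blast
  have "w \<in> C1_hoelder \<alpha>"
  proof -
    have "bdd_above (hoelder_quotients \<alpha> (grad w))" by (rule bdd_aboveI[OF hq])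
    then show ?thesis
      unfolding C1_hoelder_def bounded_iff using D(1) M gb by (auto simp: differentiable_def)
  qed
  moreover have "(SUP x. \<bar>w x\<bar>) \<le> M" by (rule cSUP_least) (use M in auto)
  moreover have "(SUP x. norm (grad w x)) \<le> L" by (rule cSUP_least) (use gb in auto)
  moreover have "Sup (hoelder_quotients \<alpha> (grad w)) \<le> 2 * N + 2 * L" by (rule cSup_least[OF ne hq])
  ultimately show ?thesis unfolding C1_hoelder_norm_def by linarith
qed

text \<open>A point with |w| at least e carries a ball of fixed radius \<open>r\<close> on which |w|
  is at least e / 2, hence a fixed amount of the integral of w^2. The integral outside large balls
  tends to 0, so such points stay in a bounded set.\<close>

lemma lipschitz_square_integrable_tendsto_0:
  fixes w :: "'a::euclidean_space \<Rightarrow> real"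
  assumes L: "\<And>x h. \<bar>w (x + h) - w x\<bar> \<le> L * norm h" and i: "integrable lborel (\<lambda>x. (w x)\<^sup>2)"
  shows "(w \<longlongrightarrow> 0) at_infinity"
proof -
  obtain b :: 'a where b: "b \<in> Basis" using nonempty_Basis by blast
  have L0: "L \<ge> 0" using L[of 0 b] b by simp
  have m: "(\<lambda>x. (w x)\<^sup>2) \<in> borel_measurable lborel" using i by (rule borel_measurable_integrable)
  have "(\<lambda>n. LINT x|lborel. indicator (- cball 0 (real n)) x * (w x)\<^sup>2) \<longlonglongrightarrow> (LINT x|(lborel :: 'a measure). (0::real))"
  proof (rule integral_dominated_convergence[where w="\<lambda>x. (w x)\<^sup>2"])
    have "(\<lambda>n. indicator (- cball 0 (real n)) x * (w x)\<^sup>2) \<longlonglongrightarrow> 0" for x :: 'a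
    proof -
      obtain n0 where "norm x < real n0" using reals_Archimedean2 by blast
      then have "indicator (- cball 0 (real n)) x * (w x)\<^sup>2 = 0" if "n \<ge> n0" for n using that by simp
      then show ?thesis by (intro tendsto_eventually) (auto simp: eventually_sequentially)
    qed
    then show "AE x in lborel. (\<lambda>n. indicator (- cball 0 (real n)) x * (w x)\<^sup>2) \<longlonglongrightarrow> 0" by (intro AE_I2)
    show "(\<lambda>x. indicator (- cball 0 (real n)) x * (w x)\<^sup>2) \<in> borel_measurable lborel" for n
      by (intro borel_measurable_times borel_measurable_indicator m) auto
  qed (auto simp: i indicator_def)
  then have lim: "(\<lambda>n. LINT x|lborel. indicator (- cball 0 (real n)) x * (w x)\<^sup>2) \<longlonglongrightarrow> 0" by simp
  show ?thesis
  proof (unfold Lim_at_infinity, intro allI impI)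
    fix e :: real assume e: "e > 0"
    define r where "r = e / (2 * L + 2)"
    have r: "r > 0" "L * r \<le> e / 2" using e L0 by (auto simp: r_def field_simps)
    define V where "V = measure lborel (cball 0 r :: 'a set)"
    have V: "V > 0" using r by (simp add: V_def)
    have "eventually (\<lambda>n. (LINT x|lborel. indicator (- cball 0 (real n)) x * (w x)\<^sup>2) < (e / 2)\<^sup>2 * V) sequentially"
      using V e by (intro order_tendstoD(2)[OF lim]) auto
    then obtain n where n: "(LINT x|lborel. indicator (- cball 0 (real n)) x * (w x)\<^sup>2) < (e / 2)\<^sup>2 * V"
      by (auto simp: eventually_sequentially)
    have "\<bar>w x\<bar> < e" if x: "norm x \<ge> real n + r + 1" for x
    proof (rule ccontr)
      assume "\<not> \<bar>w x\<bar> < e"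
      then have wx: "\<bar>w x\<bar> \<ge> e" by simp
      have "(LINT y|lborel. (e / 2)\<^sup>2 * indicator (cball x r) y) \<le> (LINT y|lborel. indicator (- cball 0 (real n)) y * (w y)\<^sup>2)"
      proof (rule integral_mono)
        show "integrable lborel (\<lambda>y. (e / 2)\<^sup>2 * indicator (cball x r) y)"
          by (intro integrable_mult_right integrable_real_indicator emeasure_lborel_cball_finite) auto
        have "integrable lborel (\<lambda>y. indicator (- cball 0 (real n)) y *\<^sub>R (w y)\<^sup>2)"
          by (rule integrable_mult_indicator[OF _ i]) auto
        then show "integrable lborel (\<lambda>y. indicator (- cball 0 (real n)) y * (w y)\<^sup>2)" by simp
        fix y
        show "(e / 2)\<^sup>2 * indicator (cball x r) y \<le> indicator (- cball 0 (real n)) y * (w y)\<^sup>2"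
        proof (cases "y \<in> cball x r")
          case True
          then have xy: "norm (x - y) \<le> r" by (simp add: dist_norm)
          have "\<bar>w x - w y\<bar> \<le> L * norm (x - y)" using L[of y "x - y"] by simp
          also have "\<dots> \<le> L * r" using xy L0 by (rule mult_left_mono)
          finally have "\<bar>w y\<bar> \<ge> e / 2" using wx r(2) by linarith
          then have "(e / 2)\<^sup>2 \<le> (w y)\<^sup>2" using e by (metis abs_of_pos half_gt_zero abs_le_square_iff)
          moreover have "norm y > real n" using xy x norm_triangle_ineq2[of x y] by linarith
          ultimately show ?thesis using True by simp
        qed simp
      qed
      moreover have "(LINT y|lborel. (e / 2)\<^sup>2 * indicator (cball x r) y) = (e / 2)\<^sup>2 * V"
        using r(1) by (simp add: V_def content_cball)
      ultimately show False using n by linarith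
    qed
    then show "\<exists>B. \<forall>x. norm x \<ge> B \<longrightarrow> dist (w x) 0 < e" by (intro exI[of _ "real n + r + 1"]) simp
  qed
qed

lemma powr_difference:
  fixes a b M p :: real
  assumes "0 \<le> b" "b \<le> a" "a \<le> M" "1 < p"
  shows "a powr p - b powr p \<le> p * M powr (p - 1) * (a - b)"
\<comment> \<open>The derivative rule for \<open>powr\<close> is applied at positive arguments, so
  \<open>b = 0\<close> is treated by factoring a^p.\<close>
proof (cases "b = 0 \<or> a = b")
  case True
  show ?thesis
  proof (cases "a = b")
    case False
    then have ab: "b = 0" "a > 0" using True assms by auto
    have "a powr p = a powr (p - 1) * a" using ab powr_mult_base[of a "p - 1"] by (simp add: mult.commute)
    also have "\<dots> \<le> M powr (p - 1) * a" using assms ab by (intro mult_right_mono powr_mono2) auto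
    also have "\<dots> \<le> p * (M powr (p - 1) * a)" using assms ab mult_right_mono[of 1 p "M powr (p - 1) * a"] by simp
    finally show ?thesis using ab assms by (simp add: mult.assoc)
  qed simp
next
  case False
  then have b: "0 < b" "b < a" using assms by auto
  have "((\<lambda>t. t powr p) has_real_derivative p * t powr (p - 1)) (at t)" if "b \<le> t" for t
    using that b by (auto intro!: derivative_eq_intros)
  then obtain z where z: "z > b" "z < a" "a powr p - b powr p = (a - b) * (p * z powr (p - 1))"
    using MVT2[OF b(2), of "\<lambda>t. t powr p" "\<lambda>t. p * t powr (p - 1)"] by auto
  have "p * z powr (p - 1) \<le> p * M powr (p - 1)"
    using z b assms by (intro mult_left_mono powr_mono2) auto
  from mult_left_mono[OF this, of "a - b"]
  have "(a - b) * (p * z powr (p - 1)) \<le> (a - b) * (p * M powr (p - 1))" using b by simp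
  then show ?thesis using z(3) by (simp add: mult_ac)
qed

section \<open>The semilinear equation\<close>

definition power_nl :: "real \<Rightarrow> real \<Rightarrow> real" where
  "power_nl p a = \<bar>a\<bar> powr (p - 1) * a"

lemma power_nl_bound: "\<bar>a\<bar> \<le> M \<Longrightarrow> 1 < p \<Longrightarrow> \<bar>power_nl p a\<bar> \<le> M powr p"
proof -
  assume a: "\<bar>a\<bar> \<le> M" "1 < p"
  have "\<bar>power_nl p a\<bar> = \<bar>a\<bar> powr p"
    unfolding power_nl_def abs_mult using powr_mult_base[of "\<bar>a\<bar>" "p - 1"] by (simp add: mult.commute)
  also have "\<dots> \<le> M powr p" using a by (intro powr_mono2) auto
  finally show ?thesis .
qed

lemma power_nl_lipschitz:
  assumes "\<bar>a\<bar> \<le> M" "\<bar>b\<bar> \<le> M" "1 < p"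
  shows "\<bar>power_nl p a - power_nl p b\<bar> \<le> p * M powr (p - 1) * \<bar>a - b\<bar>"
proof -
  have pos: "power_nl p t = t powr p" if "t \<ge> 0" for t
    unfolding power_nl_def using that powr_mult_base[of t "p - 1"] by (simp add: mult.commute)
  have neg: "power_nl p (- t) = - power_nl p t" for t unfolding power_nl_def by simp
  have nn: "\<bar>power_nl p a - power_nl p b\<bar> \<le> p * M powr (p - 1) * \<bar>a - b\<bar>"
    if ab: "0 \<le> a" "0 \<le> b" "a \<le> M" "b \<le> M" for a b
    using powr_difference[of b a M p] powr_difference[of a b M p] powr_mono2[of p a b] powr_mono2[of p b a] ab assms(3)
    by (cases "b \<le> a") (auto simp: pos)
  \<comment> \<open>For opposite signs the comparison goes through 0: the two increments add, and so
    do the two distances to 0.\<close>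
  have op: "\<bar>power_nl p a - power_nl p b\<bar> \<le> p * M powr (p - 1) * \<bar>a - b\<bar>"
    if ab: "0 \<le> a" "b \<le> 0" "a \<le> M" "- b \<le> M" for a b
  proof -
    have "power_nl p a - power_nl p b = (a powr p - 0 powr p) + ((- b) powr p - 0 powr p)"
      using ab pos[of a] pos[of "- b"] neg[of b] by simp
    moreover have "a powr p - 0 powr p \<le> p * M powr (p - 1) * (a - 0)"
      "(- b) powr p - 0 powr p \<le> p * M powr (p - 1) * (- b - 0)"
      using ab assms(3) by (intro powr_difference; simp)+
    moreover have "p * M powr (p - 1) * (a - 0) + p * M powr (p - 1) * (- b - 0) = p * M powr (p - 1) * \<bar>a - b\<bar>"
      using ab by (simp add: algebra_simps)
    moreover have "a powr p \<ge> 0" "(- b) powr p \<ge> 0" "0 powr p = 0" by simp_all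
    ultimately show ?thesis by linarith
  qed
  consider "0 \<le> a" "0 \<le> b" | "a \<le> 0" "b \<le> 0" | "0 \<le> a" "b \<le> 0" | "a \<le> 0" "0 \<le> b" by linarith
  then show ?thesis
  proof cases
    case 2
    then show ?thesis using nn[of "- a" "- b"] assms by (simp add: neg abs_minus_commute)
  next
    case 4
    then show ?thesis using op[of b a] assms by (simp add: abs_minus_commute)
  qed (use nn op assms in auto)
qed

text \<open>The bridge between integrals over the completed measure and Borel representatives.
  Completeness makes a function that agrees almost everywhere with a Borel function
  measurable.\<close>

lemma lebesgue_cong_borel:
  fixes f g :: "'a::euclidean_space \<Rightarrow> real"
  assumes g: "g \<in> borel_measurable borel" and ae: "AE x in lborel. f x = g x"
  shows "f \<in> borel_measurable lebesgue" "(LINT x|lebesgue. f x) = (LINT x|lborel. g x)"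
    "integrable lebesgue f \<longleftrightarrow> integrable lborel g"
proof -
  have ae': "AE x in lebesgue. f x = g x" using ae by (simp add: AE_completion_iff)
  have gl: "g \<in> borel_measurable lborel" "g \<in> borel_measurable lebesgue"
    using g by (auto intro: measurable_completion)
  show f: "f \<in> borel_measurable lebesgue"
  proof (rule measurableI)
    fix A :: "real set" assume A: "A \<in> sets borel"
    show "f -` A \<inter> space lebesgue \<in> sets lebesgue"
    proof (rule completion.in_sets_AE)
      show "AE x in lebesgue. x \<in> g -` A \<inter> space lebesgue \<longleftrightarrow> x \<in> f -` A \<inter> space lebesgue"
        using ae' by eventually_elim auto
      show "g -` A \<inter> space lebesgue \<in> sets lebesgue" using gl(2) A by (rule measurable_sets)
    qed auto
  qed simp
  show "(LINT x|lebesgue. f x) = (LINT x|lborel. g x)"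
    using integral_cong_AE[OF f gl(2) ae'] integral_completion[OF gl(1)] by simp
  show "integrable lebesgue f \<longleftrightarrow> integrable lborel g"
    using integrable_cong_AE[OF f gl(2) ae'] integrable_completion[OF gl(1)] by simp
qed

section \<open>Test functions are admissible in the weak formulation\<close>

lemma grad_inner_Basis: "b \<in> Basis \<Longrightarrow> grad \<phi> x \<bullet> b = partial b \<phi> x"
  by (simp add: grad_def partial_def inner_sum_left inner_Basis if_distrib if_distribR cong: if_cong)

lemma test_has_weak_gradient:
  fixes \<phi> :: "'a::euclidean_space \<Rightarrow> real"
  assumes t: "\<phi> \<in> test_functions"
  shows "has_weak_gradient \<phi> (grad \<phi>)"
proof -
  have il: "integrable lebesgue f" if "f \<in> test_functions" for f :: "'a \<Rightarrow> real"
    using lebesgue_cong_borel(3)[OF test_borel[OF that], of f] test_integrable[OF that] by simp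
  have ig: "integrable lebesgue (grad \<phi>)"
    unfolding grad_def partial_def[symmetric]
    by (intro Bochner_Integration.integrable_sum integrable_scaleR_left il test_partial t)
  have "\<phi> absolutely_integrable_on K \<and> grad \<phi> absolutely_integrable_on K" if "compact K" for K
  proof -
    have "K \<in> sets lebesgue" using compact_imp_closed[OF that] by simp
    from integrable_mult_indicator[OF this il[OF t]] integrable_mult_indicator[OF this ig]
    show ?thesis unfolding set_integrable_def by simp
  qed
  moreover have "(LINT x|lebesgue. \<phi> x * frechet_derivative \<zeta> (at x) b) = - (LINT x|lebesgue. (grad \<phi> x \<bullet> b) * \<zeta> x)"
    if \<zeta>: "\<zeta> \<in> test_functions" and b: "b \<in> Basis" for \<zeta> b
  proof -
    have t1: "(\<lambda>x. \<phi> x * partial b \<zeta> x) \<in> test_functions" "(\<lambda>x. partial b \<phi> x * \<zeta> x) \<in> test_functions"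
      by (intro test_mult t test_partial smooth_partial test_smooth \<zeta> b)+
    have "0 = (LINT x|lborel. \<phi> x * partial b \<zeta> x + partial b \<phi> x * \<zeta> x)"
      using integral_partial_test[OF test_mult[OF t test_smooth[OF \<zeta>]] b]
      by (simp add: partial_mult[OF test_smooth[OF t] test_smooth[OF \<zeta>]])
    also have "\<dots> = (LINT x|lborel. \<phi> x * partial b \<zeta> x) + (LINT x|lborel. partial b \<phi> x * \<zeta> x)"
      by (intro Bochner_Integration.integral_add test_integrable t1)
    finally have "(LINT x|lborel. \<phi> x * partial b \<zeta> x) = - (LINT x|lborel. partial b \<phi> x * \<zeta> x)" by simp
    moreover have "(LINT x|lebesgue. \<phi> x * partial b \<zeta> x) = (LINT x|lborel. \<phi> x * partial b \<zeta> x)"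
      "(LINT x|lebesgue. partial b \<phi> x * \<zeta> x) = (LINT x|lborel. partial b \<phi> x * \<zeta> x)"
      by (rule lebesgue_cong_borel(2)[OF test_borel[OF t1(1)]], simp)
         (rule lebesgue_cong_borel(2)[OF test_borel[OF t1(2)]], simp)
    ultimately show ?thesis unfolding grad_inner_Basis[OF b] partial_def[symmetric] by simp
  qed
  ultimately show ?thesis unfolding has_weak_gradient_def by blast
qed

lemma test_in_H1:
  fixes \<phi> :: "'a::euclidean_space \<Rightarrow> real"
  assumes t: "\<phi> \<in> test_functions" shows "\<phi> \<in> H1"
proof -
  have sq: "integrable lebesgue (\<lambda>x. (f x)\<^sup>2)" "f \<in> borel_measurable lebesgue"
    if "f \<in> test_functions" for f :: "'a \<Rightarrow> real"
  proof -
    have t2: "(\<lambda>x. f x * f x) \<in> test_functions" by (intro test_mult test_smooth that)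
    show "integrable lebesgue (\<lambda>x. (f x)\<^sup>2)"
      using lebesgue_cong_borel(3)[OF test_borel[OF t2], of "\<lambda>x. (f x)\<^sup>2"] test_integrable[OF t2]
      by (simp add: power2_eq_square)
    show "f \<in> borel_measurable lebesgue" using lebesgue_cong_borel(1)[OF test_borel[OF that], of f] by simp
  qed
  have n: "(norm (grad \<phi> x))\<^sup>2 = (\<Sum>b\<in>Basis. (partial b \<phi> x)\<^sup>2)" for x
  proof -
    have "(norm (grad \<phi> x))\<^sup>2 = (\<Sum>b\<in>Basis. (grad \<phi> x \<bullet> b)\<^sup>2)"
      unfolding power2_norm_eq_inner by (subst euclidean_inner) (simp add: power2_eq_square)
    then show ?thesis by (simp add: grad_inner_Basis)
  qed
  have "square_integrable \<phi>" unfolding square_integrable_def using sq[OF t] by simp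
  moreover have "square_integrable (grad \<phi>)"
    unfolding square_integrable_def n
  proof
    show "grad \<phi> \<in> borel_measurable lebesgue"
      unfolding grad_def partial_def[symmetric]
      by (intro borel_measurable_sum borel_measurable_scaleR sq(2) test_partial t borel_measurable_const)
    show "integrable lebesgue (\<lambda>x. \<Sum>b\<in>Basis. (partial b \<phi> x)\<^sup>2)"
      by (intro Bochner_Integration.integrable_sum sq test_partial t)
  qed
  ultimately show ?thesis unfolding H1_def using test_has_weak_gradient[OF t] by blast
qed

section \<open>From the weak formulation to the mollified equation and its limit\<close>

context bounded_borel
begin

lemma weak_gradient_cong:
  assumes w: "has_weak_gradient u0 Du" and ae: "AE x in lborel. u0 x = u x"
  shows "has_weak_gradient u Du"
proof -
  have "u absolutely_integrable_on K" if K: "compact K" for K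
  proof -
    have "u0 absolutely_integrable_on K" using w K unfolding has_weak_gradient_def by blast
    then show ?thesis
      unfolding set_integrable_def
    proof (rule integrable_cong_AE_imp)
      show "AE x in lebesgue. indicator K x *\<^sub>R u0 x = indicator K x *\<^sub>R u x"
        using ae unfolding AE_completion_iff by eventually_elim simp
      have "K \<in> sets borel" using compact_imp_closed[OF K] by simp
      then have "(\<lambda>x. indicator K x *\<^sub>R u x) \<in> borel_measurable lborel"
        by (intro borel_measurable_scaleR borel_measurable_indicator) auto
      then show "(\<lambda>x. indicator K x *\<^sub>R u x) \<in> borel_measurable lebesgue" by (rule measurable_completion)
    qed
  qed
  moreover have "(LINT x|lebesgue. u x * frechet_derivative \<zeta> (at x) b) = - (LINT x|lebesgue. (Du x \<bullet> b) * \<zeta> x)"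
    if \<zeta>: "\<zeta> \<in> test_functions" and b: "b \<in> Basis" for \<zeta> b
  proof -
    have m: "(\<lambda>x. u x * partial b \<zeta> x) \<in> borel_measurable borel"
      by (intro borel_measurable_times borel test_borel test_partial \<zeta> b)
    have "(LINT x|lebesgue. u x * partial b \<zeta> x) = (LINT x|lborel. u x * partial b \<zeta> x)"
      by (rule lebesgue_cong_borel(2)[OF m]) simp
    moreover have "(LINT x|lebesgue. u0 x * partial b \<zeta> x) = (LINT x|lborel. u x * partial b \<zeta> x)"
      by (rule lebesgue_cong_borel(2)[OF m]) (use ae in eventually_elim, simp)
    moreover have "(LINT x|lebesgue. u0 x * frechet_derivative \<zeta> (at x) b) = - (LINT x|lebesgue. (Du x \<bullet> b) * \<zeta> x)"
      using w \<zeta> b unfolding has_weak_gradient_def by blast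
    ultimately show ?thesis unfolding partial_def by simp
  qed
  ultimately show ?thesis using w unfolding has_weak_gradient_def by blast
qed

lemma integrable_weak_gradient_mult:
  assumes w: "has_weak_gradient u Du" and t: "\<phi> \<in> test_functions"
  shows "integrable lebesgue (\<lambda>x. (Du x \<bullet> b) * \<phi> x)"
proof -
  obtain R where R: "\<And>x. norm x > R \<Longrightarrow> \<phi> x = 0" using test_support t by metis
  obtain C where C: "\<And>x. \<bar>\<phi> x\<bar> \<le> C" using test_bounded t by metis
  have "Du absolutely_integrable_on cball 0 R" using w unfolding has_weak_gradient_def by simp
  then have i: "integrable lebesgue (\<lambda>x. (indicator (cball 0 R) x *\<^sub>R Du x) \<bullet> b)"
    unfolding set_integrable_def by (rule integrable_inner_left)
  have p: "\<phi> \<in> borel_measurable lebesgue" using lebesgue_cong_borel(1)[OF test_borel[OF t], of \<phi>] by simp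
  have e: "(Du x \<bullet> b) * \<phi> x = ((indicator (cball 0 R) x *\<^sub>R Du x) \<bullet> b) * \<phi> x" for x
    using R[of x] by (auto simp: indicator_def)
  show ?thesis
    unfolding e
  proof (rule Bochner_Integration.integrable_bound[OF integrable_mult_right[OF i, of C]])
    show "(\<lambda>x. ((indicator (cball 0 R) x *\<^sub>R Du x) \<bullet> b) * \<phi> x) \<in> borel_measurable lebesgue"
      by (intro borel_measurable_times borel_measurable_integrable[OF i] p)
    have "C \<ge> 0" using C[of 0] by simp
    then show "AE x in lebesgue. norm (((indicator (cball 0 R) x *\<^sub>R Du x) \<bullet> b) * \<phi> x)
        \<le> norm (C * ((indicator (cball 0 R) x *\<^sub>R Du x) \<bullet> b))"
      using C by (intro AE_I2) (simp add: abs_mult mult.commute[of C] mult_left_mono)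
  qed
qed

text \<open>The weak formulation with a test function, all derivatives moved onto it: the gradient
  term by testing the weak gradient with each \<open>partial b \<phi>\<close>, the double integral
  by \<open>bilinear_form_eq\<close>.\<close>

lemma distributional_equation:
  assumes ws: "weak_solution s p u0" and ae: "AE x in lborel. u0 x = u x" and t: "\<phi> \<in> test_functions"
    and s: "0 < s" "s < 1"
  shows "(LINT x|lborel. u x * \<phi> x) - (LINT x|lborel. u x * laplacian \<phi> x)
    - (LINT h|lborel. kern s h * (LINT x|lborel. u x * diff2 \<phi> h x)) = (LINT x|lborel. power_nl p (u x) * \<phi> x)"
proof -
  obtain Du where w0: "has_weak_gradient u0 Du" using ws unfolding weak_solution_def H1_def by blast
  have w: "has_weak_gradient u Du" by (rule weak_gradient_cong[OF w0 ae])
  have [measurable]: "\<phi> \<in> borel_measurable borel" by (rule test_borel[OF t])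
  have eq: "(LINT x|lebesgue. u0 x * \<phi> x + Du x \<bullet> grad \<phi> x)
        + (LINT z|(lebesgue :: ('a \<times> 'a) measure).
             (u0 (fst z) - u0 (snd z)) * (\<phi> (fst z) - \<phi> (snd z))
               / norm (fst z - snd z) powr (real DIM('a) + 2 * s))
        = (LINT x|lebesgue. \<bar>u0 x\<bar> powr (p - 1) * u0 x * \<phi> x)"
    using ws test_in_H1[OF t] w0 test_has_weak_gradient[OF t] unfolding weak_solution_def by blast
  have m1: "(\<lambda>x. u x * \<phi> x) \<in> borel_measurable borel" by measurable
  have i1: "integrable lebesgue (\<lambda>x. u0 x * \<phi> x)" "(LINT x|lebesgue. u0 x * \<phi> x) = (LINT x|lborel. u x * \<phi> x)"
  proof -
    have ae1: "AE x in lborel. u0 x * \<phi> x = u x * \<phi> x" using ae by eventually_elim simp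
    show "integrable lebesgue (\<lambda>x. u0 x * \<phi> x)"
      using lebesgue_cong_borel(3)[OF m1 ae1] integrable_mult_test[OF borel bound t] by simp
    show "(LINT x|lebesgue. u0 x * \<phi> x) = (LINT x|lborel. u x * \<phi> x)" by (rule lebesgue_cong_borel(2)[OF m1 ae1])
  qed
  have i2: "integrable lebesgue (\<lambda>x. (Du x \<bullet> b) * partial b \<phi> x)" if "b \<in> Basis" for b
    by (rule integrable_weak_gradient_mult[OF w test_partial[OF t that]])
  have l2: "(LINT x|lebesgue. (Du x \<bullet> b) * partial b \<phi> x) = - (LINT x|lborel. u x * partial b (partial b \<phi>) x)"
    if b: "b \<in> Basis" for b
  proof -
    have "(LINT x|lebesgue. u x * partial b (partial b \<phi>) x) = - (LINT x|lebesgue. (Du x \<bullet> b) * partial b \<phi> x)"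
      using w test_partial[OF t b] b unfolding has_weak_gradient_def partial_def[of b "partial b \<phi>"] by blast
    moreover have "(LINT x|lebesgue. u x * partial b (partial b \<phi>) x) = (LINT x|lborel. u x * partial b (partial b \<phi>) x)"
    proof (rule lebesgue_cong_borel(2))
      show "(\<lambda>x. u x * partial b (partial b \<phi>) x) \<in> borel_measurable borel"
        by (rule borel_measurable_times[OF borel test_borel[OF test_partial[OF test_partial[OF t b] b]]])
    qed simp
    ultimately show ?thesis by simp
  qed
  have "(LINT x|lebesgue. u0 x * \<phi> x + Du x \<bullet> grad \<phi> x)
      = (LINT x|lebesgue. u0 x * \<phi> x + (\<Sum>b\<in>Basis. (Du x \<bullet> b) * partial b \<phi> x))"
    by (intro Bochner_Integration.integral_cong refl, subst euclidean_inner) (simp add: grad_inner_Basis)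
  also have "\<dots> = (LINT x|lebesgue. u0 x * \<phi> x) + (\<Sum>b\<in>Basis. LINT x|lebesgue. (Du x \<bullet> b) * partial b \<phi> x)"
    using i1 i2 by (simp add: Bochner_Integration.integral_sum)
  also have "\<dots> = (LINT x|lborel. u x * \<phi> x) - (\<Sum>b\<in>Basis. LINT x|lborel. u x * partial b (partial b \<phi>) x)"
    using l2 by (simp add: i1 sum_negf)
  also have "(\<Sum>b\<in>Basis. LINT x|lborel. u x * partial b (partial b \<phi>) x) = (LINT x|lborel. u x * laplacian \<phi> x)"
    unfolding laplacian_def sum_distrib_left
    by (rule Bochner_Integration.integral_sum[symmetric])
       (intro integrable_mult_test[OF borel bound] test_partial t)
  finally have e1: "(LINT x|lebesgue. u0 x * \<phi> x + Du x \<bullet> grad \<phi> x)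
      = (LINT x|lborel. u x * \<phi> x) - (LINT x|lborel. u x * laplacian \<phi> x)" .
  have e2: "(LINT z|(lebesgue :: ('a \<times> 'a) measure).
             (u0 (fst z) - u0 (snd z)) * (\<phi> (fst z) - \<phi> (snd z))
               / norm (fst z - snd z) powr (real DIM('a) + 2 * s))
      = - (LINT h|lborel. kern s h * (LINT x|lborel. u x * diff2 \<phi> h x))"
  proof -
    have "(\<lambda>z. (u (fst z) - u (snd z)) * (\<phi> (fst z) - \<phi> (snd z))
        / norm (fst z - snd z) powr (real DIM('a) + 2 * s)) \<in> borel_measurable (borel \<Otimes>\<^sub>M borel)"
      by measurable
    then have m: "(\<lambda>z. (u (fst z) - u (snd z)) * (\<phi> (fst z) - \<phi> (snd z))
        / norm (fst z - snd z) powr (real DIM('a) + 2 * s)) \<in> borel_measurable borel"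
      by (simp only: borel_prod)
    \<comment> \<open>The exceptional set for pairs is the union of the two cylinders over
      \<open>Z\<close>, null in the product measure.\<close>
    obtain Z where Z: "Z \<in> null_sets lborel" "{x. u0 x \<noteq> u x} \<subseteq> Z"
      using ae unfolding eventually_ae_filter by auto
    have "Z \<times> (UNIV :: 'a set) \<in> null_sets (lborel \<Otimes>\<^sub>M lborel)" "(UNIV :: 'a set) \<times> Z \<in> null_sets (lborel \<Otimes>\<^sub>M lborel)"
      using lborel.times_in_null_sets1[OF Z(1), of UNIV] lborel.times_in_null_sets2[of UNIV lborel, OF _ Z(1)] by auto
    then have nz: "Z \<times> UNIV \<union> UNIV \<times> Z \<in> null_sets (lborel :: ('a \<times> 'a) measure)"
      unfolding lborel_prod by (rule null_sets.Un)
    have "AE z in (lborel :: ('a \<times> 'a) measure). u0 (fst z) = u (fst z) \<and> u0 (snd z) = u (snd z)"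
      using AE_not_in[OF nz] by eventually_elim (use Z(2) in auto)
    then have "AE z in (lborel :: ('a \<times> 'a) measure). (u0 (fst z) - u0 (snd z)) * (\<phi> (fst z) - \<phi> (snd z))
               / norm (fst z - snd z) powr (real DIM('a) + 2 * s) = (u (fst z) - u (snd z)) * (\<phi> (fst z) - \<phi> (snd z))
               / norm (fst z - snd z) powr (real DIM('a) + 2 * s)"
      by eventually_elim simp
    from lebesgue_cong_borel(2)[OF m this] show ?thesis using bilinear_form_eq[OF w t s] by simp
  qed
  have e3: "(LINT x|lebesgue. \<bar>u0 x\<bar> powr (p - 1) * u0 x * \<phi> x) = (LINT x|lborel. power_nl p (u x) * \<phi> x)"
  proof (rule lebesgue_cong_borel(2))
    show "(\<lambda>x. power_nl p (u x) * \<phi> x) \<in> borel_measurable borel" unfolding power_nl_def by measurable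
    show "AE x in lborel. \<bar>u0 x\<bar> powr (p - 1) * u0 x * \<phi> x = power_nl p (u x) * \<phi> x"
      using ae by eventually_elim (simp add: power_nl_def)
  qed
  show ?thesis using eq unfolding e1 e2 e3 by simp
qed

text \<open>The distributional equation is tested with the reflected kernel centred at
  \<open>x\<close>. Laplacian and second differences are even operations, so the reflection leaves
  no sign.\<close>

lemma mollified_equation:
  assumes ws: "weak_solution s p u0" and ae: "AE x in lborel. u0 x = u x" and t: "\<eta> \<in> test_functions"
    and s: "0 < s" "s < 1"
  shows "laplacian (conv u \<eta>) x = conv u \<eta> x - (LINT h|lborel. kern s h * diff2 (conv u \<eta>) h x)
    - conv (\<lambda>y. power_nl p (u y)) \<eta> x"
proof -
  let ?\<phi> = "\<lambda>y. \<eta> (x - y)"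
  have st: "smooth \<eta>" by (rule test_smooth[OF t])
  have l: "laplacian ?\<phi> y = laplacian \<eta> (x - y)" for y
  proof -
    have "partial b (partial b ?\<phi>) y = partial b (partial b \<eta>) (x - y)" if b: "b \<in> Basis" for b
    proof -
      have sb: "smooth (partial b \<eta>)" by (rule smooth_partial[OF st b])
      have "partial b ?\<phi> = (\<lambda>y. 0 - partial b \<eta> (x - y))" using partial_reflect[OF st] by auto
      then have "partial b (partial b ?\<phi>) y = partial b (\<lambda>y. 0 - partial b \<eta> (x - y)) y" by simp
      also have "\<dots> = partial b (\<lambda>_. 0) y - partial b (\<lambda>y. partial b \<eta> (x - y)) y"
        by (rule partial_diff[OF smooth_const]) (use smooth_affine[OF sb, of x "-1"] in simp)
      also have "\<dots> = partial b (partial b \<eta>) (x - y)"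
        by (simp add: partial_reflect[OF sb] partial_eqI[OF has_derivative_const])
      finally show ?thesis .
    qed
    then show ?thesis by (simp add: laplacian_def)
  qed
  have d: "diff2 ?\<phi> h y = diff2 \<eta> h (x - y)" for h y by (simp add: diff2_def algebra_simps)
  have "conv u \<eta> x - conv u (laplacian \<eta>) x - (LINT h|lborel. kern s h * conv u (diff2 \<eta> h) x)
     = conv (\<lambda>y. power_nl p (u y)) \<eta> x"
    using distributional_equation[OF ws ae test_reflect[OF t] s, of x] unfolding l d conv_def .
  then show ?thesis by (simp add: laplacian_conv[OF t] diff2_conv[OF t])
qed

text \<open>Equal Lipschitz constants spread |v i x - v j x| over a ball around \<open>x\<close>
  with error 2 L r, and there its average is controlled by the L^1 distances to \<open>u\<close>.
  Hence the whole sequence is Cauchy at every point, without passing to a subsequence.\<close>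

lemma equilipschitz_L1_limit:
  assumes v: "\<And>j x. \<bar>v j x\<bar> \<le> M" and lip: "\<And>j x h. \<bar>v j (x + h) - v j x\<bar> \<le> L * norm h"
    and m: "\<And>j::nat. v j \<in> borel_measurable borel"
    and lim: "\<And>R. (\<lambda>j. LINT x|lborel. indicator (cball 0 R) x * \<bar>v j x - u x\<bar>) \<longlonglongrightarrow> 0"
  shows "\<exists>w. (\<forall>x. (\<lambda>j. v j x) \<longlonglongrightarrow> w x) \<and> (AE x in lborel. w x = u x)"
proof -
  obtain b :: 'a where b: "b \<in> Basis" using nonempty_Basis by blast
  have L0: "L \<ge> 0" using lip[of 0 0 b] b by simp
  have db: "\<bar>\<bar>v j x - u x\<bar>\<bar> \<le> 2 * M" for j x using v[of j x] bound[of x] by linarith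
  have vi: "integrable lborel (\<lambda>x. indicator (cball 0 R) x * \<bar>v j x - u x\<bar>)" for R j
    by (rule integrable_indicator_cball[OF _ db]) (use m[of j] borel in measurable)
  have "Cauchy (\<lambda>j. v j x)" for x
  proof (rule CauchyI)
    fix e :: real assume e: "e > 0"
    define r where "r = e / (4 * L + 4)"
    have r: "r > 0" "2 * L * r \<le> e / 2" using e L0 by (auto simp: r_def field_simps)
    define V where "V = measure lborel (cball 0 r :: 'a set)"
    have V: "V > 0" using r by (simp add: V_def)
    define E where "E j = (LINT y|lborel. indicator (cball 0 (norm x + r)) y * \<bar>v j y - u y\<bar>)" for j
    have "eventually (\<lambda>j. E j < V * e / 8) sequentially"
      unfolding E_def using V e by (intro order_tendstoD(2)[OF lim]) auto
    then obtain n where n: "\<And>j. j \<ge> n \<Longrightarrow> E j < V * e / 8" by (auto simp: eventually_sequentially)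
    have "norm (v i x - v j x) < e" if ij: "i \<ge> n" "j \<ge> n" for i j
    proof -
      let ?c = "\<bar>v i x - v j x\<bar>"
      have ib: "integrable lborel (\<lambda>y. c * indicator (cball x r) y)" for c :: real
        by (intro integrable_mult_right integrable_real_indicator emeasure_lborel_cball_finite) auto
      have mb: "(LINT y|lborel. c * indicator (cball x r) y) = c * V" for c :: real
        using r(1) by (simp add: V_def content_cball)
      have "?c * V = (LINT y|lborel. ?c * indicator (cball x r) y)" by (rule mb[symmetric])
      also have "\<dots> \<le> (LINT y|lborel. (2 * L * r) * indicator (cball x r) y
          + indicator (cball 0 (norm x + r)) y * \<bar>v i y - u y\<bar> + indicator (cball 0 (norm x + r)) y * \<bar>v j y - u y\<bar>)"
      proof (intro integral_mono ib Bochner_Integration.integrable_add vi)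
        fix y
        show "?c * indicator (cball x r) y \<le> (2 * L * r) * indicator (cball x r) y
          + indicator (cball 0 (norm x + r)) y * \<bar>v i y - u y\<bar> + indicator (cball 0 (norm x + r)) y * \<bar>v j y - u y\<bar>"
        proof (cases "y \<in> cball x r")
          case True
          then have xy: "norm (x - y) \<le> r" by (simp add: dist_norm)
          have l: "\<bar>v k x - v k y\<bar> \<le> L * r" for k
          proof -
            have "\<bar>v k x - v k y\<bar> \<le> L * norm (x - y)" using lip[of k y "x - y"] by simp
            also have "\<dots> \<le> L * r" using xy L0 by (rule mult_left_mono)
            finally show ?thesis .
          qed
          have "norm y \<le> norm x + r" using xy norm_triangle_ineq3[of x y] by linarith
          then show ?thesis using True l[of i] l[of j] by simp
        qed simp
      qed
      also have "\<dots> = (2 * L * r) * V + E i + E j"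
        using ib vi mb unfolding E_def by simp
      also have "\<dots> < (e / 2) * V + V * e / 8 + V * e / 8"
        using n[OF ij(1)] n[OF ij(2)] mult_right_mono[OF r(2), of V] V by linarith
      also have "\<dots> \<le> e * V" using V e by simp
      finally show ?thesis using V by simp
    qed
    then show "\<exists>n. \<forall>i\<ge>n. \<forall>j\<ge>n. norm (v i x - v j x) < e" by blast
  qed
  then obtain w where w: "\<And>x. (\<lambda>j. v j x) \<longlonglongrightarrow> w x"
    unfolding Cauchy_convergent_iff convergent_def by metis
  have wm: "w \<in> borel_measurable borel" by (rule borel_measurable_LIMSEQ_real[OF w m])
  have wb: "\<bar>w x\<bar> \<le> M" for x
    by (rule LIMSEQ_le_const2[OF tendsto_rabs[OF w]]) (use v in auto)
  have ae: "AE x in lborel. indicator (cball 0 R) x * \<bar>w x - u x\<bar> = 0" for R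
  proof -
    have "(\<lambda>j. LINT x|lborel. indicator (cball 0 R) x * \<bar>v j x - u x\<bar>) \<longlonglongrightarrow> (LINT x|lborel. indicator (cball 0 R) x * \<bar>w x - u x\<bar>)"
    proof (rule integral_dominated_convergence[where w="\<lambda>x::'a. 2 * M * indicator (cball 0 R) x"])
      show "integrable lborel (\<lambda>x::'a. 2 * M * indicator (cball 0 R) x)"
        by (intro integrable_mult_right integrable_real_indicator emeasure_lborel_cball_finite) auto
      show "AE x in lborel. (\<lambda>j. indicator (cball 0 R) x * \<bar>v j x - u x\<bar>) \<longlonglongrightarrow> indicator (cball 0 R) x * \<bar>w x - u x\<bar>"
        by (intro AE_I2 tendsto_intros w)
      show "AE x in lborel. norm (indicator (cball 0 R) x * \<bar>v j x - u x\<bar>) \<le> 2 * M * indicator (cball 0 R) x" for j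
        using db by (intro AE_I2) (simp add: indicator_def)
      show "(\<lambda>x. indicator (cball 0 R) x * \<bar>v j x - u x\<bar>) \<in> borel_measurable lborel" for j
        by (rule borel_measurable_integrable[OF vi])
      show "(\<lambda>x. indicator (cball 0 R) x * \<bar>w x - u x\<bar>) \<in> borel_measurable lborel"
        by (intro borel_measurable_times borel_measurable_indicator borel_measurable_abs borel_measurable_diff)
           (use wm borel in auto)
    qed
    then have z: "(LINT x|lborel. indicator (cball 0 R) x * \<bar>w x - u x\<bar>) = 0"
      using lim LIMSEQ_unique by blast
    have "integrable lborel (\<lambda>x. indicator (cball 0 R) x * \<bar>w x - u x\<bar>)"
    proof (rule integrable_indicator_cball[of _ "2 * M"])
      show "\<bar>\<bar>w x - u x\<bar>\<bar> \<le> 2 * M" for x using wb[of x] bound[of x] by linarith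
    qed (use wm borel in measurable)
    then show ?thesis
      using z by (subst (asm) integral_nonneg_eq_0_iff_AE) (auto simp: indicator_def)
  qed
  have "AE x in lborel. \<forall>n::nat. indicator (cball 0 (real n)) x * \<bar>w x - u x\<bar> = 0"
    by (simp only: AE_all_countable) (use ae in blast)
  then have "AE x in lborel. w x = u x"
  proof eventually_elim
    case (elim x)
    obtain n where "norm x < real n" using reals_Archimedean2 by blast
    then show ?case using elim[rule_format, of n] by simp
  qed
  then show ?thesis using w by blast
qed

end

text \<open>The increment of a mollification is the mollification of the translated difference, so
  any modulus \<open>H\<close> passes over with the same constant.\<close>

lemma (in bounded_borel) conv_hoelder:
  assumes m: "mollifier e \<eta>" and H: "\<And>x y. \<bar>u x - u y\<bar> \<le> H (x - y)"
  shows "\<bar>conv u \<eta> x - conv u \<eta> y\<bar> \<le> H (x - y)"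
proof -
  note t = mollifier_test[OF m]
  let ?k = "x - y"
  interpret D: bounded_borel "\<lambda>z. u (z + ?k) - u z" "H ?k"
  proof
    show "(\<lambda>z. u (z + ?k) - u z) \<in> borel_measurable borel" by measurable
    show "\<bar>u (z + ?k) - u z\<bar> \<le> H ?k" for z using H[of "z + ?k" z] by simp
  qed
  interpret U: bounded_borel "\<lambda>z. u (z + ?k)" M by unfold_locales (use bound in auto)
  have [measurable]: "\<eta> \<in> borel_measurable borel" by (rule test_borel[OF t])
  have "conv u \<eta> x = (LINT z|lborel. u (z + ?k) * \<eta> (y - z))"
    unfolding conv_def using integral_shift[of "\<lambda>z. u z * \<eta> (x - z)" ?k] by (simp add: algebra_simps)
  then have "conv u \<eta> x - conv u \<eta> y = conv (\<lambda>z. u (z + ?k) - u z) \<eta> y"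
    using U.conv_integrable[OF t, of y] conv_integrable[OF t, of y]
    unfolding conv_def by (simp add: left_diff_distrib)
  then show ?thesis using D.conv_mollifier_bound[OF m] by simp
qed

section \<open>Passage to the limit in the mollification\<close>

context apriori
begin

lemma c_two_nonneg: "F \<ge> 0 \<Longrightarrow> c_two F \<ge> 0"
  unfolding c_two_def using K(1) J s c_pos(2)
  by (intro mult_nonneg_nonneg add_nonneg_nonneg divide_nonneg_nonneg) auto

text \<open>Both passes act on the same mollifications \<open>v j\<close>. The uniform Lipschitz
  bound gives a limit \<open>w\<close>, and the regularity of \<open>w\<close> supplies the Hoelder
  modulus of the right-hand sides for the second pass.\<close>

lemma regular_representative:
  assumes u: "bounded_borel u M" and M: "M > 0" and p: "1 < p"
    and eq: "\<And>e \<eta>. mollifier e \<eta> \<Longrightarrow> solves (conv u \<eta>) (conv (\<lambda>y. power_nl p (u y)) \<eta>)"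
  defines "Q \<equiv> M + M powr p"
  shows "\<exists>w. (AE x in lborel. w x = u x) \<and> (\<forall>x. \<bar>w x\<bar> \<le> M) \<and>
    (\<forall>x h. \<bar>w (x + h) - w x\<bar> \<le> c_lip * Q * norm h) \<and>
    (\<forall>x h. \<bar>diff2 w h x\<bar> \<le> c_two (p * (2 + c_lip)) * Q * (norm h)\<^sup>2)"
proof -
  interpret u: bounded_borel u M by (rule u)
  \<comment> \<open>The scale at which M / T^2 equals the larger of \<open>M\<close> and
    \<open>M powr p\<close>, hence bounds both the solution and the nonlinearity.\<close>
  define T where "T = min 1 (M powr ((1 - p) / 2))"
  have T: "0 < T" "T \<le> 1" using M by (auto simp: T_def)
  have T2: "T\<^sup>2 = min 1 (M powr (1 - p))"
  proof -
    have "(M powr ((1 - p) / 2))\<^sup>2 = M powr (1 - p)"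
      using M by (simp add: power2_eq_square flip: powr_add)
    moreover have "T\<^sup>2 = min 1 ((M powr ((1 - p) / 2))\<^sup>2)"
    proof (cases "M powr ((1 - p) / 2) \<le> 1")
      case True
      then show ?thesis by (simp add: T_def power_le_one)
    next
      case False
      then have "(M powr ((1 - p) / 2))\<^sup>2 \<ge> 1" by (intro one_le_power) simp
      then show ?thesis using False by (simp add: T_def)
    qed
    ultimately show ?thesis by simp
  qed
  have inv: "1 / T\<^sup>2 = max 1 (M powr (p - 1))"
  proof -
    have b: "M powr (p - 1) = 1 / M powr (1 - p)" using powr_minus_divide[of M "1 - p"] by simp
    have a: "M powr (1 - p) > 0" using M by simp
    show ?thesis
      using a unfolding T2 b by (cases "M powr (1 - p) \<le> 1") (simp_all add: max_absorb1 max_absorb2)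
  qed
  have MT2: "M / T\<^sup>2 = max M (M powr p)"
  proof -
    have "M / T\<^sup>2 = M * max 1 (M powr (p - 1))" unfolding inv[symmetric] by simp
    also have "\<dots> = max M (M * M powr (p - 1))" using M by (simp add: max_mult_distrib_left)
    finally show ?thesis using M by (simp add: powr_mult_base)
  qed
  have Q: "M / T\<^sup>2 \<le> Q" "M / T \<le> Q"
  proof -
    show 1: "M / T\<^sup>2 \<le> Q" unfolding MT2 Q_def using M by auto
    have "T\<^sup>2 \<le> T" using T by (simp add: power2_eq_square mult_left_le)
    then have "M / T \<le> M / T\<^sup>2" using M T by (intro divide_left_mono) auto
    then show "M / T \<le> Q" using 1 by linarith
  qed
  let ?f = "\<lambda>y. power_nl p (u y)"
  interpret f: bounded_borel ?f "M powr p"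
  proof
    show "?f \<in> borel_measurable borel" unfolding power_nl_def by measurable
    show "\<bar>?f x\<bar> \<le> M powr p" for x by (rule power_nl_bound[OF u.bound p])
  qed
  have "\<exists>\<eta> :: 'a \<Rightarrow> real. mollifier (1 / (real j + 1)) \<eta>" for j by (rule mollifier_exists) simp
  then obtain \<eta> :: "nat \<Rightarrow> 'a \<Rightarrow> real" where \<eta>: "\<And>j. mollifier (1 / (real j + 1)) (\<eta> j)" by metis
  note t = mollifier_test[OF \<eta>]
  define v where "v j = conv u (\<eta> j)" for j
  have v2: "bounded_C2 (v j)" for j unfolding v_def by (rule u.bounded_C2_conv[OF t])
  have vb: "\<bar>v j x\<bar> \<le> M" for j x unfolding v_def by (rule u.conv_mollifier_bound[OF \<eta>])
  have ve: "solves (v j) (conv ?f (\<eta> j))" for j unfolding v_def by (rule eq[OF \<eta>])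
  have fb: "\<bar>conv ?f (\<eta> j) x\<bar> \<le> M / T\<^sup>2" for j x
    using f.conv_mollifier_bound[OF \<eta>, of j x] unfolding MT2 by simp
  have vl: "\<bar>v j (x + h) - v j x\<bar> \<le> c_lip * (M / T) * norm h" for j x h
    by (rule lipschitz_estimate[OF v2 vb T fb ve])
  have vm: "v j \<in> borel_measurable borel" for j
    using v2[of j] smooth_borel[of "v j"] by (simp add: bounded_C2_def)
  have L1: "(\<lambda>j. LINT x|lborel. indicator (cball 0 R) x * \<bar>v j x - u x\<bar>) \<longlonglongrightarrow> 0" for R
  proof (rule LIMSEQ_I)
    fix e :: real assume e: "e > 0"
    obtain d where d: "d > 0" "\<And>\<eta>. mollifier d \<eta> \<Longrightarrow> (LINT x|lborel. indicator (cball 0 R) x * \<bar>conv u \<eta> x - u x\<bar>) \<le> e / 2"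
      using u.mollification_L1[of "e / 2" R] e by auto
    obtain n0 :: nat where n0: "1 / (real n0 + 1) < d"
      using reals_Archimedean[OF d(1)] by (auto simp: inverse_eq_divide add.commute)
    have "norm ((LINT x|lborel. indicator (cball 0 R) x * \<bar>v j x - u x\<bar>) - 0) < e" if "j \<ge> n0" for j
    proof -
      have "1 / (real j + 1) \<le> 1 / (real n0 + 1)" using that by (intro divide_left_mono) auto
      then have "mollifier d (\<eta> j)" using n0 by (intro mollifier_mono[OF \<eta>]) linarith
      then have "(LINT x|lborel. indicator (cball 0 R) x * \<bar>v j x - u x\<bar>) \<le> e / 2"
        unfolding v_def by (rule d(2))
      moreover have "(LINT x|lborel. indicator (cball 0 R) x * \<bar>v j x - u x\<bar>) \<ge> 0"
        by (rule Bochner_Integration.integral_nonneg) simp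
      ultimately show ?thesis using e by simp
    qed
    then show "\<exists>n0. \<forall>j\<ge>n0. norm ((LINT x|lborel. indicator (cball 0 R) x * \<bar>v j x - u x\<bar>) - 0) < e" by blast
  qed
  have "\<exists>w. (\<forall>x. (\<lambda>j. v j x) \<longlonglongrightarrow> w x) \<and> (AE x in lborel. w x = u x)"
    by (rule u.equilipschitz_L1_limit[where v=v and L="c_lip * (M / T)"]) (fact vb vl vm L1)+
  then obtain w where w: "\<And>x. (\<lambda>j. v j x) \<longlonglongrightarrow> w x" "AE x in lborel. w x = u x" by blast
  have wb: "\<bar>w x\<bar> \<le> M" for x by (rule LIMSEQ_le_const2[OF tendsto_rabs[OF w(1)]]) (use vb in auto)
  have wl: "\<bar>w (x + h) - w x\<bar> \<le> c_lip * (M / T) * norm h" for x h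
    by (rule LIMSEQ_le_const2[OF tendsto_rabs[OF tendsto_diff[OF w(1) w(1)]]]) (use vl in auto)
  let ?g = "\<lambda>y. power_nl p (w y)"
  interpret g: bounded_borel ?g "M powr p"
  proof
    have [measurable]: "w \<in> borel_measurable borel"
      by (rule borel_measurable_LIMSEQ_real[OF w(1) vm])
    show "?g \<in> borel_measurable borel" unfolding power_nl_def by measurable
    show "\<bar>?g x\<bar> \<le> M powr p" for x by (rule power_nl_bound[OF wb p])
  qed
  \<comment> \<open>Integrals do not see null sets, so the merely measurable \<open>u\<close> may be
    replaced by its Lipschitz representative inside the mollified nonlinearity.\<close>
  have fg: "conv ?f (\<eta> j) = conv ?g (\<eta> j)" for j
  proof
    fix x
    show "conv ?f (\<eta> j) x = conv ?g (\<eta> j) x"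
      unfolding conv_def
      by (rule integral_cong_AE[OF borel_measurable_integrable[OF f.conv_integrable[OF t]]
            borel_measurable_integrable[OF g.conv_integrable[OF t]]])
         (use w(2) in eventually_elim, simp)
  qed
  \<comment> \<open>The power has Lipschitz constant \<open>p * M powr (p - 1)\<close> on the range
    of \<open>w\<close>, which is at most p / T^2; the remaining factors are the Hoelder bound of
    \<open>w\<close>.\<close>
  define H where "H k = (p * (2 + c_lip)) * (M / T\<^sup>2) * (norm k / T) powr (1 - s)" for k :: 'a
  have gH: "\<bar>?g x - ?g y\<bar> \<le> H (x - y)" for x y
  proof -
    let ?r = "(norm (x - y) / T) powr (1 - s)"
    have "\<bar>?g x - ?g y\<bar> \<le> p * M powr (p - 1) * \<bar>w x - w y\<bar>"
      by (rule power_nl_lipschitz[OF wb wb p])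
    also have "\<dots> \<le> p * M powr (p - 1) * ((2 + c_lip) * M * ?r)"
      using p by (intro mult_left_mono hoelder_of_lipschitz[OF wb T(1) wl]) auto
    also have "\<dots> \<le> p * (1 / T\<^sup>2) * ((2 + c_lip) * M * ?r)"
      using p M c_pos(2) unfolding inv by (intro mult_right_mono mult_left_mono mult_nonneg_nonneg) auto
    also have "\<dots> = H (x - y)" by (simp add: H_def)
    finally show ?thesis .
  qed
  have vN: "\<bar>diff2 (v j) h x\<bar> \<le> c_two (p * (2 + c_lip)) * (M / T\<^sup>2) * (norm h)\<^sup>2" for j h x
  proof (rule second_difference_apriori[OF v2 vb T vl _ _ ve])
    show "0 \<le> p * (2 + c_lip)" using p c_pos(2) by simp
    show "\<bar>conv ?f (\<eta> j) x - conv ?f (\<eta> j) y\<bar> \<le> p * (2 + c_lip) * (M / T\<^sup>2) * (norm (x - y) / T) powr (1 - s)" for x y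
      using g.conv_hoelder[OF \<eta> gH, of j x y] unfolding fg H_def .
  qed
  have wN: "\<bar>diff2 w h x\<bar> \<le> c_two (p * (2 + c_lip)) * (M / T\<^sup>2) * (norm h)\<^sup>2" for h x
  proof (rule LIMSEQ_le_const2)
    show "(\<lambda>j. \<bar>diff2 (v j) h x\<bar>) \<longlonglongrightarrow> \<bar>diff2 w h x\<bar>"
      unfolding diff2_def by (intro tendsto_intros w(1))
  qed (use vN in auto)
  have c2: "c_two (p * (2 + c_lip)) \<ge> 0"
    using p c_pos(2) by (intro c_two_nonneg) simp
  show ?thesis
  proof (intro exI[of _ w] conjI allI w(2) wb)
    fix x h :: 'a
    have "c_lip * (M / T) * norm h \<le> c_lip * Q * norm h"
      using Q(2) c_pos(2) by (intro mult_right_mono mult_left_mono) auto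
    then show "\<bar>w (x + h) - w x\<bar> \<le> c_lip * Q * norm h" using wl[of x h] by linarith
    have "c_two (p * (2 + c_lip)) * (M / T\<^sup>2) * (norm h)\<^sup>2 \<le> c_two (p * (2 + c_lip)) * Q * (norm h)\<^sup>2"
      using Q(1) c2 by (intro mult_right_mono mult_left_mono) auto
    then show "\<bar>diff2 w h x\<bar> \<le> c_two (p * (2 + c_lip)) * Q * (norm h)\<^sup>2" using wN[of h x] by linarith
  qed
qed

end

text \<open>Comparison with the zero function excludes minus infinity, so the conversion of the
  essential supremum to a real number loses nothing.\<close>

lemma Linfty_norm_AE:
  assumes "u \<in> Linfty"
  shows "0 \<le> Linfty_norm u" "AE x in lebesgue. \<bar>u x\<bar> \<le> Linfty_norm u"
proof -
  let ?S = "esssup lebesgue (\<lambda>x. ereal \<bar>u x\<bar>)"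
  have fin: "?S < \<infinity>" using assms by (simp add: Linfty_def)
  have "esssup lebesgue (\<lambda>x::'a. ereal 0) \<le> ?S" by (rule esssup_mono) auto
  moreover have "esssup lebesgue (\<lambda>x::'a. ereal 0) = ereal 0"
    by (rule esssup_const) simp
  ultimately have nn: "?S \<ge> 0" by (simp add: zero_ereal_def)
  then have r: "ereal (Linfty_norm u) = ?S" unfolding Linfty_norm_def using fin by (intro ereal_real') auto
  show "0 \<le> Linfty_norm u" unfolding Linfty_norm_def using nn by (rule real_of_ereal_pos)
  have "AE x in lebesgue. ereal \<bar>u x\<bar> \<le> ?S" by (rule esssup_AE)
  then show "AE x in lebesgue. \<bar>u x\<bar> \<le> Linfty_norm u"
    unfolding r[symmetric] by simp
qed

lemma C1_hoelder_0:
  "(\<lambda>x::'a::euclidean_space. 0) \<in> C1_hoelder \<alpha>" "C1_hoelder_norm \<alpha> (\<lambda>x::'a. 0) = 0"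
proof -
  obtain b :: 'a where "b \<in> Basis" using nonempty_Basis by blast
  then have b: "b \<noteq> 0" by auto
  have g: "grad (\<lambda>x::'a. 0) x = 0" for x by (simp add: grad_def)
  have "hoelder_quotients \<alpha> (grad (\<lambda>x::'a. 0)) = {0}"
  proof (intro equalityI subsetI)
    fix q :: real assume "q \<in> {0}"
    then show "q \<in> hoelder_quotients \<alpha> (grad (\<lambda>x::'a. 0))"
      unfolding hoelder_quotients_def using b by (intro CollectI exI[of _ b] exI[of _ 0]) (simp add: g)
  qed (auto simp: hoelder_quotients_def g)
  then show "(\<lambda>x::'a::euclidean_space. 0) \<in> C1_hoelder \<alpha>" "C1_hoelder_norm \<alpha> (\<lambda>x::'a. 0) = 0"
    by (auto simp: C1_hoelder_def C1_hoelder_norm_def g image_constant_conv)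
qed

theorem theorem1p3:
  fixes s p :: real
  assumes "CARD('n::finite) \<ge> 2"
    and "0 < s" and "s < 1"
    and "1 < p"
    and "CARD('n) > 2 \<Longrightarrow> p < (real CARD('n) + 2) / (real CARD('n) - 2)"
  shows "\<exists>c>0. \<forall>u :: real ^ 'n \<Rightarrow> real. u \<in> H1 \<and> u \<in> Linfty \<and> weak_solution s p u \<longrightarrow>
    (\<exists>w. (AE x in lebesgue. w x = u x) \<and>
         (\<forall>\<alpha>. 0 < \<alpha> \<and> \<alpha> < 1 \<longrightarrow>
            w \<in> C1_hoelder \<alpha> \<and>
            C1_hoelder_norm \<alpha> w \<le> c * (Linfty_norm u + Linfty_norm u powr p)) \<and>
         (w \<longlongrightarrow> 0) at_infinity)"
proof -
  note s = \<open>0 < s\<close> \<open>s < 1\<close> and p = \<open>1 < p\<close>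
  \<comment> \<open>Kernels and constants are fixed before any solution is introduced, so
    \<open>c\<close> depends only on the dimension, \<open>s\<close> and \<open>p\<close>.\<close>
  obtain \<rho> \<psi> :: "real ^ 'n \<Rightarrow> real" and K R J where "apriori \<rho> \<psi> K s R J"
    using apriori_exists[OF s] by blast
  then interpret apriori \<rho> \<psi> K s R J .
  define N where "N = c_two (p * (2 + c_lip))"
  have N: "N \<ge> 0" unfolding N_def using p c_pos(2) by (intro c_two_nonneg) simp
  show ?thesis
  \<comment> \<open>The bound M + L + (2 N' + 2 L) with \<open>M \<le> Q\<close>, L = c_lip Q and N'
    = N Q, where Q = M + M^p.\<close>
  proof (intro exI[of _ "1 + 3 * c_lip + 2 * N"] conjI allI impI)
    show "1 + 3 * c_lip + 2 * N > 0" using c_pos(2) N by linarith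
    fix u0 :: "real ^ 'n \<Rightarrow> real"
    assume u0: "u0 \<in> H1 \<and> u0 \<in> Linfty \<and> weak_solution s p u0"
    define M where "M = Linfty_norm u0"
    have M0: "M \<ge> 0" and aeM: "AE x in lebesgue. \<bar>u0 x\<bar> \<le> M"
      unfolding M_def using Linfty_norm_AE u0 by blast+
    show "\<exists>w. (AE x in lebesgue. w x = u0 x) \<and>
         (\<forall>\<alpha>. 0 < \<alpha> \<and> \<alpha> < 1 \<longrightarrow> w \<in> C1_hoelder \<alpha> \<and>
            C1_hoelder_norm \<alpha> w \<le> (1 + 3 * c_lip + 2 * N) * (Linfty_norm u0 + Linfty_norm u0 powr p)) \<and>
         (w \<longlongrightarrow> 0) at_infinity"
    proof (cases "M = 0")
      case True
      \<comment> \<open>For \<open>M = 0\<close> the scale \<open>T\<close> would be 0, so this case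
        is settled by the zero function.\<close>
      have "AE x in lebesgue. 0 = u0 x" using aeM by eventually_elim (simp add: True)
      then show ?thesis
        using True by (intro exI[of _ "\<lambda>x. 0"]) (simp add: C1_hoelder_0 M_def[symmetric])
    next
      case False
      then have M: "M > 0" using M0 by simp
      have sq: "u0 \<in> borel_measurable lebesgue" "integrable lebesgue (\<lambda>x. (u0 x)\<^sup>2)"
        using u0 by (auto simp: H1_def square_integrable_def)
      obtain u1 where u1: "u1 \<in> borel_measurable lborel" "AE x in lborel. u0 x = u1 x"
        using completion_ex_borel_measurable_real[OF sq(1)] by blast
      \<comment> \<open>Truncation changes the Borel representative only on a null set and makes the
        bound by \<open>M\<close> hold at every point.\<close>
      define u where "u x = max (- M) (min M (u1 x))" for x
      have ae: "AE x in lborel. u0 x = u x"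
        using u1(2) aeM[unfolded AE_completion_iff] by eventually_elim (auto simp: u_def)
      have ub: "bounded_borel u M"
      proof
        show "u \<in> borel_measurable borel" unfolding u_def using u1(1) by measurable
        show "\<bar>u x\<bar> \<le> M" for x unfolding u_def using M by auto
      qed
      have eq: "solves (conv u \<eta>) (conv (\<lambda>y. power_nl p (u y)) \<eta>)" if "mollifier e \<eta>" for e \<eta>
        unfolding solves_def
        using bounded_borel.mollified_equation[OF ub _ ae mollifier_test[OF that] s] u0 by blast
      define Q where "Q = M + M powr p"
      obtain w where w: "AE x in lborel. w x = u x" "\<And>x. \<bar>w x\<bar> \<le> M"
        "\<And>x h. \<bar>w (x + h) - w x\<bar> \<le> (c_lip * Q) * norm h" "\<And>h x. \<bar>diff2 w h x\<bar> \<le> (N * Q) * (norm h)\<^sup>2"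
      proof -
        have "\<exists>w. (AE x in lborel. w x = u x) \<and> (\<forall>x. \<bar>w x\<bar> \<le> M) \<and>
            (\<forall>x h. \<bar>w (x + h) - w x\<bar> \<le> c_lip * Q * norm h) \<and>
            (\<forall>x h. \<bar>diff2 w h x\<bar> \<le> N * Q * (norm h)\<^sup>2)"
          unfolding Q_def N_def by (rule regular_representative[OF ub M p]) (rule eq)
        then show ?thesis using that by blast
      qed
      have wu: "AE x in lborel. u0 x = w x" using ae w(1) by eventually_elim simp
      have wb: "w \<in> borel_measurable borel"
      proof -
        obtain D where "\<And>x. (w has_derivative D x) (at x)"
          using differentiable_of_diff2[OF w(4,3)] by blast
        then have "continuous_on UNIV w"
          using has_derivative_continuous by (blast intro: continuous_at_imp_continuous_on)
        then show ?thesis by (rule borel_measurable_continuous_onI)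
      qed
      have "integrable lborel (\<lambda>x. (w x)\<^sup>2)"
      proof -
        have m: "(\<lambda>x. (w x)\<^sup>2) \<in> borel_measurable borel" using wb by measurable
        have "AE x in lborel. (u0 x)\<^sup>2 = (w x)\<^sup>2" using wu by eventually_elim simp
        from lebesgue_cong_borel(3)[OF m this] show ?thesis using sq(2) by simp
      qed
      then have lim: "(w \<longlongrightarrow> 0) at_infinity" by (rule lipschitz_square_integrable_tendsto_0[OF w(3)])
      have Q: "M \<le> Q" by (simp add: Q_def)
      have "w \<in> C1_hoelder \<alpha> \<and> C1_hoelder_norm \<alpha> w \<le> (1 + 3 * c_lip + 2 * N) * Q" if "0 < \<alpha>" "\<alpha> < 1" for \<alpha>
        using C1_hoelder_of_differences[OF w(2,3,4) that] Q by (simp add: algebra_simps)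
      moreover have "AE x in lebesgue. w x = u0 x"
        unfolding AE_completion_iff using wu by eventually_elim simp
      ultimately show ?thesis using lim unfolding M_def[symmetric] Q_def by blast
    qed
  qed
qed

end
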